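(* Let $T$ be a complete theory of fields in a language $L\supseteq L_{\mathrm{rings}}$. If $T$ is NIP, then $\mathrm{ACF}_T$ is NIP.
   Context: $L_{\mathrm{rings}}$ is the language of rings. A theory of fields is a theory in a language $L\supseteq L_{\mathrm{rings}}$ which contains all the field axioms. $\mathrm{ACF}$ is the theory of algebraically closed fields. The theory $\mathrm{ACF}_T$: let $L^P=L\cup\{P\}$ with $P$ a unary predicate. $\mathrm{ACF}_T$ is the $L^P$-theory consisting of $\mathrm{ACF}$ (for the $L_{\mathrm{rings}}$-reduct of the universe) together with: (1) $P$ is a subfield of the universe; (2) $P$ (with the induced $L$-structure) is a model of $T$; (3) for every $n$-ary function symbol $f\in L\setminus L_{\mathrm{rings}}$: if $x_0,\dots,x_{n-1}\in P$ then $f(x_0,\dots,x_{n-1})\in P$, and if some $x_i\notin P$ then $f(x_0,\dots,x_{n-1})=0$; (4) for every $n$-ary relation symbol $R\in L$, if some $x_i\notin P$ then $\lnot R(x_0,\dots,x_{n-1})$; (5) the degree of the field extension of the universe over $P$ is infinite. (When $T$ is complete, $\mathrm{ACF}_T$ is complete.) A formula $\phi(x,y)$ has the independence property (IP) if there is a sequence $(a_i)_{i<\omega}$ in a model of the theory such that for every $s\subseteq\omega$ the set $\{\phi(a_i,y)\mid i\in s\}\cup\{\lnot\phi(a_i,y)\mid i\notin s\}$ is consistent. A theory is NIP if no formula has IP. *)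

theory Defs
  imports Main
begin

section \<open>First-order logic\<close>

text \<open>A language assigns arities to the symbols belonging to it; a symbol that is mapped to
  \<^term>\<open>None\<close> does not belong to the language. Thus every set of symbols, including the empty
  one, is covered.\<close>

record ('f, 'r) language =
  fun_ar :: "'f \<rightharpoonup> nat"
  rel_ar :: "'r \<rightharpoonup> nat"

definition sublanguage :: "('f, 'r) language \<Rightarrow> ('f, 'r) language \<Rightarrow> bool" (infix "\<subseteq>\<^sub>L" 50) where
  "L \<subseteq>\<^sub>L L' \<longleftrightarrow> fun_ar L \<subseteq>\<^sub>m fun_ar L' \<and> rel_ar L \<subseteq>\<^sub>m rel_ar L'"

datatype 'f tm = Var nat | Fn 'f "'f tm list"

datatype ('f, 'r) fm =
    Eq "'f tm" "'f tm"
  | Rel 'r "'f tm list"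
  | Neg "('f, 'r) fm"
  | Conj "('f, 'r) fm" "('f, 'r) fm"
  | Ex nat "('f, 'r) fm"

abbreviation Imp :: "('f, 'r) fm \<Rightarrow> ('f, 'r) fm \<Rightarrow> ('f, 'r) fm" where
  "Imp \<phi> \<psi> \<equiv> Neg (Conj \<phi> (Neg \<psi>))"

abbreviation All :: "nat \<Rightarrow> ('f, 'r) fm \<Rightarrow> ('f, 'r) fm" where
  "All x \<phi> \<equiv> Neg (Ex x (Neg \<phi>))"

abbreviation Alls :: "nat list \<Rightarrow> ('f, 'r) fm \<Rightarrow> ('f, 'r) fm" where
  "Alls xs \<phi> \<equiv> foldr All xs \<phi>"

abbreviation Imps :: "('f, 'r) fm list \<Rightarrow> ('f, 'r) fm \<Rightarrow> ('f, 'r) fm" where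
  "Imps \<phi>s \<psi> \<equiv> foldr Imp \<phi>s \<psi>"

primrec tm_vars :: "'f tm \<Rightarrow> nat set" where
  "tm_vars (Var x) = {x}"
| "tm_vars (Fn f ts) = \<Union> (set (map tm_vars ts))"

primrec free_vars :: "('f, 'r) fm \<Rightarrow> nat set" where
  "free_vars (Eq s t) = tm_vars s \<union> tm_vars t"
| "free_vars (Rel r ts) = \<Union> (set (map tm_vars ts))"
| "free_vars (Neg \<phi>) = free_vars \<phi>"
| "free_vars (Conj \<phi> \<psi>) = free_vars \<phi> \<union> free_vars \<psi>"
| "free_vars (Ex x \<phi>) = free_vars \<phi> - {x}"

primrec is_term :: "('f, 'r) language \<Rightarrow> 'f tm \<Rightarrow> bool" where
  "is_term L (Var x) \<longleftrightarrow> True"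
| "is_term L (Fn f ts) \<longleftrightarrow> fun_ar L f = Some (length ts) \<and> list_all (is_term L) ts"

primrec is_formula :: "('f, 'r) language \<Rightarrow> ('f, 'r) fm \<Rightarrow> bool" where
  "is_formula L (Eq s t) \<longleftrightarrow> is_term L s \<and> is_term L t"
| "is_formula L (Rel r ts) \<longleftrightarrow> rel_ar L r = Some (length ts) \<and> list_all (is_term L) ts"
| "is_formula L (Neg \<phi>) \<longleftrightarrow> is_formula L \<phi>"
| "is_formula L (Conj \<phi> \<psi>) \<longleftrightarrow> is_formula L \<phi> \<and> is_formula L \<psi>"
| "is_formula L (Ex x \<phi>) \<longleftrightarrow> is_formula L \<phi>"

definition is_sentence :: "('f, 'r) language \<Rightarrow> ('f, 'r) fm \<Rightarrow> bool" where
  "is_sentence L \<phi> \<longleftrightarrow> is_formula L \<phi> \<and> free_vars \<phi> = {}"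

definition is_theory :: "('f, 'r) language \<Rightarrow> ('f, 'r) fm set \<Rightarrow> bool" where
  "is_theory L T \<longleftrightarrow> (\<forall>\<phi>\<in>T. is_sentence L \<phi>)"

record ('f, 'r, 'u) struct =
  univ :: "'u set"
  fun_int :: "'f \<Rightarrow> 'u list \<Rightarrow> 'u"
  rel_int :: "'r \<Rightarrow> 'u list \<Rightarrow> bool"

definition is_structure :: "('f, 'r) language \<Rightarrow> ('f, 'r, 'u) struct \<Rightarrow> bool" where
  "is_structure L M \<longleftrightarrow> univ M \<noteq> {} \<and>
     (\<forall>f n. fun_ar L f = Some n \<longrightarrow>
        (\<forall>xs. length xs = n \<and> set xs \<subseteq> univ M \<longrightarrow> fun_int M f xs \<in> univ M))"

primrec tm_val :: "('f, 'r, 'u) struct \<Rightarrow> (nat \<Rightarrow> 'u) \<Rightarrow> 'f tm \<Rightarrow> 'u" where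
  "tm_val M e (Var x) = e x"
| "tm_val M e (Fn f ts) = fun_int M f (map (tm_val M e) ts)"

primrec sat :: "('f, 'r, 'u) struct \<Rightarrow> (nat \<Rightarrow> 'u) \<Rightarrow> ('f, 'r) fm \<Rightarrow> bool" where
  "sat M e (Eq s t) \<longleftrightarrow> tm_val M e s = tm_val M e t"
| "sat M e (Rel r ts) \<longleftrightarrow> rel_int M r (map (tm_val M e) ts)"
| "sat M e (Neg \<phi>) \<longleftrightarrow> \<not> sat M e \<phi>"
| "sat M e (Conj \<phi> \<psi>) \<longleftrightarrow> sat M e \<phi> \<and> sat M e \<psi>"
| "sat M e (Ex x \<phi>) \<longleftrightarrow> (\<exists>a\<in>univ M. sat M (e(x := a)) \<phi>)"

definition holds :: "('f, 'r, 'u) struct \<Rightarrow> ('f, 'r) fm \<Rightarrow> bool" where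
  "holds M \<phi> \<longleftrightarrow> (\<forall>e. range e \<subseteq> univ M \<longrightarrow> sat M e \<phi>)"

definition is_model ::
  "('f, 'r) language \<Rightarrow> ('f, 'r) fm set \<Rightarrow> ('f, 'r, 'u) struct \<Rightarrow> bool" where
  "is_model L T M \<longleftrightarrow> is_structure L M \<and> (\<forall>\<phi>\<in>T. holds M \<phi>)"

text \<open>HOL cannot quantify over all structures of arbitrary type inside a formula. The notions below
  that quantify over structures therefore carry the type of the elements of these structures as a
  parameter. By the Loewenheim-Skolem theorems they agree with the unrestricted
  ones as soon as that type has at least as many elements as there are formulas, in particular for
  the type \<^typ>\<open>('f, 'r) fm\<close> itself.\<close>

definition entails ::
  "'u itself \<Rightarrow> ('f, 'r) language \<Rightarrow> ('f, 'r) fm set \<Rightarrow> ('f, 'r) fm \<Rightarrow> bool" where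
  "entails U L T \<phi> \<longleftrightarrow> (\<forall>M :: ('f, 'r, 'u) struct. is_model L T M \<longrightarrow> holds M \<phi>)"

definition complete_theory ::
  "'u itself \<Rightarrow> ('f, 'r) language \<Rightarrow> ('f, 'r) fm set \<Rightarrow> bool" where
  "complete_theory U L T \<longleftrightarrow> is_theory L T \<and>
     (\<exists>M :: ('f, 'r, 'u) struct. is_model L T M) \<and>
     (\<forall>\<phi>. is_sentence L \<phi> \<longrightarrow> entails U L T \<phi> \<or> entails U L T (Neg \<phi>))"


section \<open>The independence property\<close>

definition elementary_embedding ::
  "('f, 'r) language \<Rightarrow> ('f, 'r, 'u) struct \<Rightarrow> ('f, 'r, 'v) struct \<Rightarrow> ('u \<Rightarrow> 'v) \<Rightarrow> bool" where
  "elementary_embedding L M N h \<longleftrightarrow> h ` univ M \<subseteq> univ N \<and>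
     (\<forall>\<phi> e. is_formula L \<phi> \<and> range e \<subseteq> univ M \<longrightarrow> (sat M e \<phi> \<longleftrightarrow> sat N (h \<circ> e) \<phi>))"

text \<open>A pair \<open>(\<phi>, a)\<close> stands for the formula \<open>\<phi>(a, y)\<close> with parameters \<open>a\<close>: the variables
  \<open>0, \<dots>, length a - 1\<close> are replaced by \<open>a\<close> and the next \<open>n\<close> variables form the tuple \<open>y\<close>.
  A set of such formulas with parameters in \<open>M\<close> is consistent if it is satisfiable together with
  the elementary diagram of \<open>M\<close>, that is, if it is realised in an elementary extension of \<open>M\<close>.\<close>

definition consistent_over ::
  "('f, 'r) language \<Rightarrow> ('f, 'r, 'u) struct \<Rightarrow> nat \<Rightarrow> (('f, 'r) fm \<times> 'u list) set \<Rightarrow> bool" where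
  "consistent_over L M n \<Sigma> \<longleftrightarrow>
     (\<exists>(N :: ('f, 'r, 'u) struct) h b.
        is_structure L N \<and> elementary_embedding L M N h \<and>
        length b = n \<and> set b \<subseteq> univ N \<and>
        (\<forall>(\<phi>, a) \<in> \<Sigma>. sat N (nth (map h a @ b)) \<phi>))"

text \<open>Here the formula \<open>\<phi>(x, y)\<close> has its free variables among \<open>0, \<dots>, m + n - 1\<close>; the first \<open>m\<close> of
  them form the tuple \<open>x\<close> and the remaining \<open>n\<close> the tuple \<open>y\<close>.\<close>

definition has_IP ::
  "'u itself \<Rightarrow> ('f, 'r) language \<Rightarrow> ('f, 'r) fm set \<Rightarrow> nat \<Rightarrow> nat \<Rightarrow> ('f, 'r) fm \<Rightarrow> bool" where
  "has_IP U L T m n \<phi> \<longleftrightarrow>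
     (\<exists>(M :: ('f, 'r, 'u) struct) (a :: nat \<Rightarrow> 'u list).
        is_model L T M \<and> (\<forall>i. length (a i) = m \<and> set (a i) \<subseteq> univ M) \<and>
        (\<forall>S. consistent_over L M n ({(\<phi>, a i) | i. i \<in> S} \<union> {(Neg \<phi>, a i) | i. i \<notin> S})))"

definition NIP :: "'u itself \<Rightarrow> ('f, 'r) language \<Rightarrow> ('f, 'r) fm set \<Rightarrow> bool" where
  "NIP U L T \<longleftrightarrow>
     (\<forall>\<phi> m n. is_formula L \<phi> \<and> free_vars \<phi> \<subseteq> {..<m + n} \<longrightarrow> \<not> has_IP U L T m n \<phi>)"


section \<open>Theories of fields\<close>

datatype 'f ring_sym = Zero | One | Plus | Times | Minus | Other 'f

definition L_rings :: "('f ring_sym, 'r) language" where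
  "L_rings = \<lparr>fun_ar = [Zero \<mapsto> 0, One \<mapsto> 0, Plus \<mapsto> 2, Times \<mapsto> 2, Minus \<mapsto> 1],
              rel_ar = Map.empty\<rparr>"

abbreviation tzero :: "'f ring_sym tm" where "tzero \<equiv> Fn Zero []"
abbreviation tone :: "'f ring_sym tm" where "tone \<equiv> Fn One []"
abbreviation tplus :: "'f ring_sym tm \<Rightarrow> 'f ring_sym tm \<Rightarrow> 'f ring_sym tm" where
  "tplus s t \<equiv> Fn Plus [s, t]"
abbreviation ttimes :: "'f ring_sym tm \<Rightarrow> 'f ring_sym tm \<Rightarrow> 'f ring_sym tm" where
  "ttimes s t \<equiv> Fn Times [s, t]"
abbreviation tminus :: "'f ring_sym tm \<Rightarrow> 'f ring_sym tm" where
  "tminus t \<equiv> Fn Minus [t]"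

primrec tpower :: "'f ring_sym tm \<Rightarrow> nat \<Rightarrow> 'f ring_sym tm" where
  "tpower t 0 = tone"
| "tpower t (Suc n) = ttimes t (tpower t n)"

abbreviation tsum :: "'f ring_sym tm list \<Rightarrow> 'f ring_sym tm" where
  "tsum ts \<equiv> foldr tplus ts tzero"

definition field_axioms :: "('f ring_sym, 'r) fm set" where
  "field_axioms =
    (let x = Var 0; y = Var 1; z = Var 2 in
     {Alls [0, 1, 2] (Eq (tplus (tplus x y) z) (tplus x (tplus y z))),
      Alls [0, 1] (Eq (tplus x y) (tplus y x)),
      Alls [0] (Eq (tplus x tzero) x),
      Alls [0] (Eq (tplus x (tminus x)) tzero),
      Alls [0, 1, 2] (Eq (ttimes (ttimes x y) z) (ttimes x (ttimes y z))),
      Alls [0, 1] (Eq (ttimes x y) (ttimes y x)),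
      Alls [0] (Eq (ttimes x tone) x),
      Alls [0, 1, 2] (Eq (ttimes x (tplus y z)) (tplus (ttimes x y) (ttimes x z))),
      Neg (Eq tzero tone),
      Alls [0] (Imp (Neg (Eq x tzero)) (Ex 1 (Eq (ttimes x y) tone)))})"

definition theory_of_fields ::
  "('f ring_sym, 'r) language \<Rightarrow> ('f ring_sym, 'r) fm set \<Rightarrow> bool" where
  "theory_of_fields L T \<longleftrightarrow> L_rings \<subseteq>\<^sub>L L \<and> is_theory L T \<and> field_axioms \<subseteq> T"

text \<open>Every polynomial \<open>c\<^sub>0 + c\<^sub>1 X + \<dots> + c\<^sub>n\<^sub>-\<^sub>1 X^(n-1) + X^n\<close> with \<open>n \<ge> 1\<close> has a root;
  variable \<open>i < n\<close> is \<open>c\<^sub>i\<close>, variable \<open>n\<close> is the root.\<close>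

definition root_axiom :: "nat \<Rightarrow> ('f ring_sym, 'r) fm" where
  "root_axiom n = Alls [0..<n]
     (Ex n (Eq (tplus (tsum (map (\<lambda>i. ttimes (Var i) (tpower (Var n) i)) [0..<n]))
                      (tpower (Var n) n))
               tzero))"

definition ACF :: "('f ring_sym, 'r) fm set" where
  "ACF = field_axioms \<union> {root_axiom n | n. n \<ge> 1}"


section \<open>The theory \<open>ACF\<^sub>T\<close>\<close>

datatype 'r plus_P = Pred_P | Old 'r

definition L_P :: "('f, 'r) language \<Rightarrow> ('f, 'r plus_P) language" where
  "L_P L = \<lparr>fun_ar = fun_ar L, rel_ar = case_plus_P (Some 1) (rel_ar L)\<rparr>"

abbreviation inP :: "'f tm \<Rightarrow> ('f, 'r plus_P) fm" where
  "inP t \<equiv> Rel Pred_P [t]"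

text \<open>A sentence holds in the structure induced on \<open>P\<close> iff its relativisation to \<open>P\<close> holds.\<close>

primrec relativise :: "('f, 'r) fm \<Rightarrow> ('f, 'r plus_P) fm" where
  "relativise (Eq s t) = Eq s t"
| "relativise (Rel r ts) = Rel (Old r) ts"
| "relativise (Neg \<phi>) = Neg (relativise \<phi>)"
| "relativise (Conj \<phi> \<psi>) = Conj (relativise \<phi>) (relativise \<psi>)"
| "relativise (Ex x \<phi>) = Ex x (Conj (inP (Var x)) (relativise \<phi>))"

definition P_subfield_axioms :: "('f ring_sym, 'r plus_P) fm set" where
  "P_subfield_axioms =
    (let x = Var 0; y = Var 1 in
     {inP tzero,
      inP tone,
      Alls [0, 1] (Imps [inP x, inP y] (inP (tplus x y))),
      Alls [0, 1] (Imps [inP x, inP y] (inP (ttimes x y))),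
      Alls [0] (Imp (inP x) (inP (tminus x))),
      Alls [0] (Imps [inP x, Neg (Eq x tzero)] (Ex 1 (Conj (inP y) (Eq (ttimes x y) tone))))})"

definition fun_axioms :: "('f ring_sym, 'r) language \<Rightarrow> ('f ring_sym, 'r plus_P) fm set" where
  "fun_axioms L =
     {Alls [0..<n] (Imps (map (inP \<circ> Var) [0..<n]) (inP (Fn f (map Var [0..<n])))) | f n.
        fun_ar L f = Some n \<and> f \<notin> dom (fun_ar (L_rings :: ('f ring_sym, 'r) language))} \<union>
     {Alls [0..<n] (Imp (Neg (inP (Var i))) (Eq (Fn f (map Var [0..<n])) tzero)) | f n i.
        fun_ar L f = Some n \<and> f \<notin> dom (fun_ar (L_rings :: ('f ring_sym, 'r) language)) \<and> i < n}"

definition rel_axioms :: "('f, 'r) language \<Rightarrow> ('f, 'r plus_P) fm set" where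
  "rel_axioms L =
     {Alls [0..<n] (Imp (Neg (inP (Var i))) (Neg (Rel (Old R) (map Var [0..<n])))) | R n i.
        rel_ar L R = Some n \<and> i < n}"

text \<open>No \<open>n\<close> elements \<open>x\<^sub>0, \<dots>, x\<^sub>n\<^sub>-\<^sub>1\<close> span the universe as a vector space over \<open>P\<close>: some \<open>y\<close> is
  different from all sums \<open>c\<^sub>0 x\<^sub>0 + \<dots> + c\<^sub>n\<^sub>-\<^sub>1 x\<^sub>n\<^sub>-\<^sub>1\<close> with coefficients in \<open>P\<close>. Variable \<open>i < n\<close> is
  \<open>x\<^sub>i\<close>, variable \<open>n\<close> is \<open>y\<close>, variable \<open>n + 1 + i\<close> is \<open>c\<^sub>i\<close>. The extension has infinite degree iff
  this holds for all \<open>n\<close>.\<close>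

definition degree_axiom :: "nat \<Rightarrow> ('f ring_sym, 'r plus_P) fm" where
  "degree_axiom n = Alls [0..<n] (Ex n (Alls [n + 1..<n + 1 + n]
     (Imps (map (\<lambda>i. inP (Var (n + 1 + i))) [0..<n])
           (Neg (Eq (Var n) (tsum (map (\<lambda>i. ttimes (Var (n + 1 + i)) (Var i)) [0..<n])))))))"

definition ACF_T ::
  "('f ring_sym, 'r) language \<Rightarrow> ('f ring_sym, 'r) fm set \<Rightarrow> ('f ring_sym, 'r plus_P) fm set" where
  "ACF_T L T = ACF \<union> P_subfield_axioms \<union> relativise ` T \<union> fun_axioms L \<union> rel_axioms L \<union>
     range degree_axiom"

end

(* Let (K, P) be a model of ACF_T. The P-linear relations among the monomials of bounded degree in a
   tuple e of K form the kernel of a matrix over P, and every formula of the pair is equivalent to a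
   T-formula in such a matrix. A quantifier over K is eliminated as follows: the new element is either
   generic over the monomials in e up to the degree in question, or it is a root of a polynomial
   over them of minimal degree, and then a polynomial expression in it vanishes iff its
   pseudo-remainder modulo this minimal polynomial does.

   If phi(x, y) has the independence property, then in an ultrapower there are a_i and, for every set
   S of indices, a tuple b_S with phi(a_i, b_S) iff i is in S. The relations of the monomials in b_S
   over the ring P[a_0, a_1, ...] involve only finitely many coefficients p_S in P and are of some
   degree n_S. By Baire category, one value of n_S suffices to realise all finite patterns on a tail
   of the a_i. For this value phi(a_i, b_S) becomes a condition on p_S and the a_j, hence a T-formula
   in p_S and a relation matrix of the a_j; so T has the independence property. *)

theory Submission
  imports Defs "HOL-Algebra.Ring" "HOL-Library.Countable"
begin

section \<open>First-order logic\<close>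

text \<open>Minimality over the field P(e) is not visible at any finite degree: a relation matrix
  knows only polynomials whose coefficients have bounded degree in e. Irreducibility and the absence
  of relations therefore occur only up to explicit bounds. The bounds grow as the degree of the
  polynomial drops, so that each pseudo-division stays within what is already granted for the lower
  degrees. Existence of a generic element could depend on e, which would spoil the elimination. If
  some tuple \<open>e0\<close> has none, its entries become parameters \<open>\<kappa>\<close>; from
  some level on no tuple has one, and existence is a constant truth value. The category argument
  assigns a degree to every set of indices, so each infinite pattern must be realised in one model.
  The independence property realises each pattern in an extension of its own, which leaves finite
  patterns inside one model; the ultrapower closes this gap. Since only finite patterns are
  transferred to P, a second ultrapower follows, and Loewenheim-Skolem leads back to the type of
  formulas, over which NIP of T is stated.\<close>

lemma tm_val_cong:
  "(\<And>x. x \<in> tm_vars t \<Longrightarrow> e x = e' x) \<Longrightarrow> tm_val M e t = tm_val M e' t"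
proof (induction t)
  case (Fn f ts)
  then have "map (tm_val M e) ts = map (tm_val M e') ts" by auto
  then show ?case by (simp only: tm_val.simps)
qed simp

lemma sat_cong:
  "(\<And>x. x \<in> free_vars \<phi> \<Longrightarrow> e x = e' x) \<Longrightarrow> sat M e \<phi> = sat M e' \<phi>"
proof (induction \<phi> arbitrary: e e')
  case (Eq s t)
  then show ?case using tm_val_cong[of s e e' M] tm_val_cong[of t e e' M] by simp
next
  case (Rel r ts)
  then have "map (tm_val M e) ts = map (tm_val M e') ts"
    by (auto intro!: tm_val_cong)
  then show ?case by (metis sat.simps(2))
next
  case (Neg \<phi>)
  have "sat M e \<phi> = sat M e' \<phi>" using Neg.prems by (intro Neg.IH) simp
  then show ?case by simp
next
  case (Conj \<phi> \<psi>)
  have "sat M e \<phi> = sat M e' \<phi>" using Conj.prems by (intro Conj.IH(1)) simp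
  moreover have "sat M e \<psi> = sat M e' \<psi>" using Conj.prems by (intro Conj.IH(2)) simp
  ultimately show ?case by simp
next
  case (Ex x \<phi>)
  have "sat M (e(x := a)) \<phi> = sat M (e'(x := a)) \<phi>" for a
    by (rule Ex.IH) (use Ex.prems in simp)
  then show ?case by simp
qed

lemma finite_tm_vars [simp]: "finite (tm_vars t)"
  by (induction t) auto

lemma finite_free_vars [simp]: "finite (free_vars \<phi>)"
  by (induction \<phi>) auto

section \<open>Injective renaming of variables\<close>

primrec ren_tm :: "(nat \<Rightarrow> nat) \<Rightarrow> 'f tm \<Rightarrow> 'f tm" where
  "ren_tm \<rho> (Var x) = Var (\<rho> x)"
| "ren_tm \<rho> (Fn f ts) = Fn f (map (ren_tm \<rho>) ts)"

text \<open>Bound variables are renamed along with the free ones, so for injective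
  \<open>\<rho>\<close> no capture can occur and no fresh names have to be chosen.\<close>

primrec ren :: "(nat \<Rightarrow> nat) \<Rightarrow> ('f, 'r) fm \<Rightarrow> ('f, 'r) fm" where
  "ren \<rho> (Eq s t) = Eq (ren_tm \<rho> s) (ren_tm \<rho> t)"
| "ren \<rho> (Rel r ts) = Rel r (map (ren_tm \<rho>) ts)"
| "ren \<rho> (Neg \<phi>) = Neg (ren \<rho> \<phi>)"
| "ren \<rho> (Conj \<phi> \<psi>) = Conj (ren \<rho> \<phi>) (ren \<rho> \<psi>)"
| "ren \<rho> (Ex x \<phi>) = Ex (\<rho> x) (ren \<rho> \<phi>)"

lemma tm_val_ren: "tm_val M e (ren_tm \<rho> t) = tm_val M (e \<circ> \<rho>) t"
proof (induction t)
  case (Fn f ts)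
  then have "map (tm_val M e \<circ> ren_tm \<rho>) ts = map (tm_val M (e \<circ> \<rho>)) ts"
    unfolding map_eq_conv by (metis comp_apply)
  then show ?case by (simp only: tm_val.simps ren_tm.simps map_map)
qed simp

lemma sat_ren: "inj \<rho> \<Longrightarrow> sat M e (ren \<rho> \<phi>) = sat M (e \<circ> \<rho>) \<phi>"
proof (induction \<phi> arbitrary: e)
  case (Rel r ts)
  have "map (tm_val M e \<circ> ren_tm \<rho>) ts = map (tm_val M (e \<circ> \<rho>)) ts"
    by (simp add: tm_val_ren)
  then show ?case by (simp only: sat.simps ren.simps map_map)
next
  case (Ex x \<phi>)
  have "e(\<rho> x := a) \<circ> \<rho> = (e \<circ> \<rho>)(x := a)" for a
    using Ex.prems by (auto simp: inj_eq)
  then show ?case using Ex by (simp only: ren.simps sat.simps)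
qed (simp_all add: tm_val_ren)

lemma is_term_ren [simp]: "is_term L (ren_tm \<rho> t) = is_term L t"
  by (induction t) (auto simp: list_all_iff)

lemma is_formula_ren [simp]: "is_formula L (ren \<rho> \<phi>) = is_formula L \<phi>"
  by (induction \<phi>) (auto simp: list_all_iff)

lemma tm_vars_ren: "tm_vars (ren_tm \<rho> t) = \<rho> ` tm_vars t"
  by (induction t) auto

lemma free_vars_ren: "inj \<rho> \<Longrightarrow> free_vars (ren \<rho> \<phi>) = \<rho> ` free_vars \<phi>"
  by (induction \<phi>) (auto simp: tm_vars_ren inj_eq)

text \<open>One assignment \<open>E\<close> that may differ from \<open>e\<close> on
  \<open>xs\<close> replaces nested updates, and repetitions in \<open>xs\<close> do no
  harm.\<close>

lemma sat_Exs:
  assumes "range e \<subseteq> univ M"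
  shows "sat M e (foldr Ex xs \<phi>) \<longleftrightarrow>
    (\<exists>E. range E \<subseteq> univ M \<and> (\<forall>k. k \<notin> set xs \<longrightarrow> E k = e k) \<and> sat M E \<phi>)"
  using assms
proof (induction xs arbitrary: e)
  case Nil
  have "E = e" if "\<forall>k. E k = e k" for E using that by auto
  then show ?case using Nil by auto
next
  case (Cons x xs)
  show ?case
  proof
    assume "sat M e (foldr Ex (x # xs) \<phi>)"
    then obtain a where a: "a \<in> univ M" "sat M (e(x := a)) (foldr Ex xs \<phi>)" by auto
    moreover have "range (e(x := a)) \<subseteq> univ M" using Cons.prems a by auto
    ultimately obtain E where E: "range E \<subseteq> univ M" "\<forall>k. k \<notin> set xs \<longrightarrow> E k = (e(x := a)) k" "sat M E \<phi>"
      using Cons.IH by blast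
    have "\<forall>k. k \<notin> set (x # xs) \<longrightarrow> E k = e k" using E(2) by auto
    then show "\<exists>E. range E \<subseteq> univ M \<and> (\<forall>k. k \<notin> set (x # xs) \<longrightarrow> E k = e k) \<and> sat M E \<phi>"
      using E by blast
  next
    assume "\<exists>E. range E \<subseteq> univ M \<and> (\<forall>k. k \<notin> set (x # xs) \<longrightarrow> E k = e k) \<and> sat M E \<phi>"
    then obtain E where E: "range E \<subseteq> univ M" "\<forall>k. k \<notin> set (x # xs) \<longrightarrow> E k = e k" "sat M E \<phi>"
      by blast
    have x: "E x \<in> univ M" using E(1) by auto
    have r: "range (e(x := E x)) \<subseteq> univ M" using Cons.prems x by auto
    have "\<forall>k. k \<notin> set xs \<longrightarrow> E k = (e(x := E x)) k" using E(2) by auto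
    then have "sat M (e(x := E x)) (foldr Ex xs \<phi>)" unfolding Cons.IH[OF r] using E by blast
    then show "sat M e (foldr Ex (x # xs) \<phi>)" using x by auto
  qed
qed

lemma sat_Alls:
  assumes "range e \<subseteq> univ M"
  shows "sat M e (Alls xs \<phi>) \<longleftrightarrow>
    (\<forall>E. range E \<subseteq> univ M \<and> (\<forall>k. k \<notin> set xs \<longrightarrow> E k = e k) \<longrightarrow> sat M E \<phi>)"
proof -
  have "sat M e (Alls xs \<phi>) \<longleftrightarrow> \<not> sat M e (foldr Ex xs (Neg \<phi>))" for e
    by (induction xs arbitrary: e) auto
  from this[of e] show ?thesis
    by (simp only: sat_Exs[OF assms, of xs "Neg \<phi>"] sat.simps) blast
qed

lemma sat_Imps: "sat M e (Imps \<phi>s \<psi>) \<longleftrightarrow> ((\<forall>\<phi>\<in>set \<phi>s. sat M e \<phi>) \<longrightarrow> sat M e \<psi>)"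
  by (induction \<phi>s) auto

lemma is_formula_Exs [simp]: "is_formula L (foldr Ex xs \<phi>) = is_formula L \<phi>"
  by (induction xs) auto

text \<open>The empty conjunction must be a formula over every language, and the syntax has no
  constant for truth.\<close>

definition Conjs :: "('f, 'r) fm list \<Rightarrow> ('f, 'r) fm" where
  "Conjs \<phi>s = foldr Conj \<phi>s (Eq (Var 0) (Var 0))"

lemma sat_Conjs [simp]: "sat M e (Conjs \<phi>s) \<longleftrightarrow> (\<forall>\<phi>\<in>set \<phi>s. sat M e \<phi>)"
  unfolding Conjs_def by (induction \<phi>s) auto

lemma is_formula_Conjs [simp]: "is_formula L (Conjs \<phi>s) \<longleftrightarrow> (\<forall>\<phi>\<in>set \<phi>s. is_formula L \<phi>)"
  unfolding Conjs_def by (induction \<phi>s) auto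

lemma tm_val_closed:
  assumes "is_structure L M" "range e \<subseteq> univ M" "is_term L t"
  shows "tm_val M e t \<in> univ M"
  using assms(3)
proof (induction t)
  case (Var x) then show ?case using assms(2) by auto
next
  case (Fn f ts)
  then have "set (map (tm_val M e) ts) \<subseteq> univ M" by (auto simp: list_all_iff)
  then show ?case using assms(1) Fn.prems unfolding is_structure_def by (simp del: set_map)
qed

lemma sat_sentence:
  assumes "is_sentence L \<phi>"
  shows "sat M e \<phi> = sat M e' \<phi>"
  using assms sat_cong unfolding is_sentence_def by (metis empty_iff)

section \<open>Ultrapowers\<close>

lemma holds_iff_sat:
  fixes M :: "('a, 'b, 'c) struct"
  assumes "is_sentence L \<phi>" "range e \<subseteq> univ M"
  shows "holds M \<phi> \<longleftrightarrow> sat M e \<phi>"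
proof -
  define b where "b = sat M e \<phi>"
  have "sat M e' \<phi> = b" for e' unfolding b_def by (rule sat_sentence[OF assms(1)])
  then have "holds M \<phi> \<longleftrightarrow> ((\<exists>e :: nat \<Rightarrow> 'c. range e \<subseteq> univ M) \<longrightarrow> b)"
    unfolding holds_def by (simp only:) blast
  then show ?thesis using assms(2) unfolding b_def by blast
qed

lemma structure_env: "is_structure L M \<Longrightarrow> \<exists>e :: nat \<Rightarrow> 'u. range e \<subseteq> univ M"
proof -
  assume "is_structure L M"
  then obtain a where "a \<in> univ M" unfolding is_structure_def by auto
  then show ?thesis by (intro exI[of _ "\<lambda>_. a"]) auto
qed

lemma elementary_embedding_model_iff:
  assumes "elementary_embedding L M N h" "is_structure L M" "is_structure L N" "is_theory L T"
  shows "is_model L T M \<longleftrightarrow> is_model L T N"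
proof -
  obtain e :: "nat \<Rightarrow> _" where e: "range e \<subseteq> univ M" using structure_env assms(2) by blast
  have he: "range (h \<circ> e) \<subseteq> univ N"
    using e assms(1) unfolding elementary_embedding_def by auto
  have "holds M \<phi> \<longleftrightarrow> holds N \<phi>" if "\<phi> \<in> T" for \<phi>
  proof -
    have s: "is_sentence L \<phi>" using that assms(4) unfolding is_theory_def by blast
    then have "is_formula L \<phi>" by (simp add: is_sentence_def)
    then show ?thesis using holds_iff_sat[OF s e] holds_iff_sat[OF s he] assms(1) e
      unfolding elementary_embedding_def by blast
  qed
  then show ?thesis using assms unfolding is_model_def by blast
qed

text \<open>\<open>J\<close> is the set of variables that make up the tuple y; all others belong to
  x. Arbitrary sets are allowed because the formulas over P obtained later keep y at scattered code
  numbers.\<close>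

definition mix :: "nat set \<Rightarrow> (nat \<Rightarrow> 'u) \<Rightarrow> (nat \<Rightarrow> 'u) \<Rightarrow> nat \<Rightarrow> 'u" where
  "mix J A B k = (if k \<in> J then B k else A k)"

lemma mix_range: "range A \<subseteq> X \<Longrightarrow> range B \<subseteq> X \<Longrightarrow> range (mix J A B) \<subseteq> X"
  by (auto simp: mix_def)

text \<open>What the independence property leaves inside a single model: each pattern is matched on
  every initial segment, by a \<open>B\<close> that depends on the segment.\<close>

definition fin_shattered ::
  "('f, 'r, 'u) struct \<Rightarrow> ('f, 'r) fm \<Rightarrow> nat set \<Rightarrow> (nat \<Rightarrow> nat \<Rightarrow> 'u) \<Rightarrow> bool" where
  "fin_shattered M \<phi> J A \<longleftrightarrow> (\<forall>i. range (A i) \<subseteq> univ M) \<and>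
     (\<forall>r S. \<exists>B. range B \<subseteq> univ M \<and> (\<forall>i<r. sat M (mix J (A i) B) \<phi> \<longleftrightarrow> i \<in> S))"

definition shattered ::
  "('f, 'r, 'u) struct \<Rightarrow> ('f, 'r) fm \<Rightarrow> nat set \<Rightarrow> (nat \<Rightarrow> nat \<Rightarrow> 'u) \<Rightarrow> bool" where
  "shattered M \<phi> J A \<longleftrightarrow> (\<forall>i. range (A i) \<subseteq> univ M) \<and>
     (\<forall>S. \<exists>B. range B \<subseteq> univ M \<and> (\<forall>i. sat M (mix J (A i) B) \<phi> \<longleftrightarrow> i \<in> S))"

text \<open>In the order of filters smaller means finer, so an ultrafilter is a minimal proper
  filter; lying below \<open>sequentially\<close> makes it free.\<close>

lemma ultrafilter_exists:
  "\<exists>U :: nat filter. U \<noteq> bot \<and> U \<le> sequentially \<and>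
     (\<forall>Q. eventually Q U \<or> eventually (\<lambda>n. \<not> Q n) U)"
proof -
  define A where "A = {F :: nat filter. F \<noteq> bot \<and> F \<le> sequentially}"
  have "\<exists>m\<in>A. \<forall>a\<in>A. m \<ge> a \<longrightarrow> a = m"
  proof (rule predicate_Zorn)
    show "partial_order_on A (relation_of (\<ge>) A)"
      by (rule partial_order_on_relation_ofI) auto
    fix C assume "C \<in> Chains (relation_of (\<ge>) A)"
    then have C: "C \<subseteq> A" and chain: "\<And>F G. F \<in> C \<Longrightarrow> G \<in> C \<Longrightarrow> F \<le> G \<or> G \<le> F"
      unfolding Chains_def relation_of_def by auto
    show "\<exists>u\<in>A. \<forall>a\<in>C. a \<ge> u"
    proof (cases "C = {}")
      case True then show ?thesis unfolding A_def by (intro bexI[of _ sequentially]) auto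
    next
      case False
      \<comment> \<open>In a chain, what is eventual for the infimum is already eventual for a
        member; hence falsity is not.\<close>
      have "eventually P (Inf C) \<longleftrightarrow> (\<exists>b\<in>C. eventually P b)" for P
        by (rule eventually_Inf_base[OF False]) (metis chain inf.orderE inf.commute order_refl)
      then have "Inf C \<noteq> bot"
        using C unfolding A_def by (auto simp: trivial_limit_def)
      moreover have "Inf C \<le> sequentially"
        using False C unfolding A_def by (auto intro: Inf_lower2)
      ultimately show ?thesis unfolding A_def by (auto intro!: bexI[of _ "Inf C"] Inf_lower)
    qed
  qed
  then obtain U where U: "U \<noteq> bot" "U \<le> sequentially"
    and max: "\<And>F. F \<noteq> bot \<Longrightarrow> F \<le> U \<Longrightarrow> F = U"
    unfolding A_def by (metis (mono_tags, lifting) mem_Collect_eq order_trans)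
  have "eventually Q U \<or> eventually (\<lambda>n. \<not> Q n) U" for Q
  proof (rule disjCI)
    assume n: "\<not> eventually (\<lambda>n. \<not> Q n) U"
    \<comment> \<open>If the negation of \<open>Q\<close> is not eventual, restricting
      \<open>U\<close> to \<open>Q\<close> leaves a proper filter, and minimality forces it to be
      \<open>U\<close>.\<close>
    have "inf U (principal {n. Q n}) \<noteq> bot"
      using n by (auto simp: trivial_limit_def eventually_inf_principal)
    then have "inf U (principal {n. Q n}) = U" by (rule max) simp
    moreover have "eventually Q (inf U (principal {n. Q n}))" by (simp add: eventually_inf_principal)
    ultimately show "eventually Q U" by simp
  qed
  then show ?thesis using U by blast
qed

section \<open>Ultrapowers along a free ultrafilter on the natural numbers\<close>

locale free_ultrafilter =
  fixes U :: "nat filter"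
  assumes U_nontrivial: "U \<noteq> bot" and U_free: "U \<le> sequentially"
    and U_ultra: "eventually Q U \<or> eventually (\<lambda>n. \<not> Q n) U"
begin

lemma eventually_not_iff: "eventually (\<lambda>n. \<not> Q n) U \<longleftrightarrow> \<not> eventually Q U"
proof
  assume a: "eventually (\<lambda>n. \<not> Q n) U"
  show "\<not> eventually Q U"
  proof
    assume "eventually Q U"
    with a have "eventually (\<lambda>n. False) U" by eventually_elim simp
    then show False using U_nontrivial by (simp add: trivial_limit_def)
  qed
qed (use U_ultra in blast)

text \<open>Classes of the ultrapower are represented by chosen sequences, which avoids a quotient.\<close>

definition chosen_rep :: "'u set \<Rightarrow> (nat \<Rightarrow> 'u) \<Rightarrow> nat \<Rightarrow> 'u" where
  "chosen_rep X f = (SOME g. range g \<subseteq> X \<and> eventually (\<lambda>n. f n = g n) U)"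

definition ultrapower :: "('f, 'r, 'u) struct \<Rightarrow> ('f, 'r, nat \<Rightarrow> 'u) struct" where
  "ultrapower M = \<lparr>univ = chosen_rep (univ M) ` {f. range f \<subseteq> univ M},
     fun_int = (\<lambda>f xs. chosen_rep (univ M) (\<lambda>n. fun_int M f (map (\<lambda>x. x n) xs))),
     rel_int = (\<lambda>r xs. eventually (\<lambda>n. rel_int M r (map (\<lambda>x. x n) xs)) U)\<rparr>"

lemma ultrapower_fun_int:
    "fun_int (ultrapower M) f xs = chosen_rep (univ M) (\<lambda>n. fun_int M f (map (\<lambda>x. x n) xs))"
  and ultrapower_rel_int: "rel_int (ultrapower M) r xs = eventually (\<lambda>n. rel_int M r (map (\<lambda>x. x n) xs)) U"
  by (simp_all add: ultrapower_def)

lemma chosen_rep: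
  assumes "range f \<subseteq> X"
  shows "range (chosen_rep X f) \<subseteq> X" "eventually (\<lambda>n. f n = chosen_rep X f n) U"
proof -
  have "\<exists>g. range g \<subseteq> X \<and> eventually (\<lambda>n. f n = g n) U" using assms by (intro exI[of _ f]) simp
  from someI_ex[OF this] show "range (chosen_rep X f) \<subseteq> X" "eventually (\<lambda>n. f n = chosen_rep X f n) U"
    unfolding chosen_rep_def by blast+
qed

lemma chosen_rep_eqI:
  assumes "eventually (\<lambda>n. f n = g n) U"
  shows "chosen_rep X f = chosen_rep X g"
proof -
  have "eventually (\<lambda>n. f n = h n) U \<longleftrightarrow> eventually (\<lambda>n. g n = h n) U" for h
    by (rule eventually_cong[OF assms]) simp
  then have "(\<lambda>h. range h \<subseteq> X \<and> eventually (\<lambda>n. f n = h n) U) =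
      (\<lambda>h. range h \<subseteq> X \<and> eventually (\<lambda>n. g n = h n) U)" by (intro ext) blast
  then show ?thesis unfolding chosen_rep_def by (rule arg_cong)
qed

lemma ultrapower_univ_range: "x \<in> univ (ultrapower M) \<Longrightarrow> x n \<in> univ M"
proof -
  assume "x \<in> univ (ultrapower M)"
  then obtain f where "range f \<subseteq> univ M" "x = chosen_rep (univ M) f" unfolding ultrapower_def by auto
  then show ?thesis using chosen_rep(1)[of f "univ M"] by blast
qed

lemma chosen_rep_in_ultrapower: "range f \<subseteq> univ M \<Longrightarrow> chosen_rep (univ M) f \<in> univ (ultrapower M)"
  unfolding ultrapower_def by auto

lemma ultrapower_eq_iff:
  assumes "x \<in> univ (ultrapower M)" "y \<in> univ (ultrapower M)"
  shows "x = y \<longleftrightarrow> eventually (\<lambda>n. x n = y n) U"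
proof
  assume e: "eventually (\<lambda>n. x n = y n) U"
  obtain f g where f: "range f \<subseteq> univ M" "x = chosen_rep (univ M) f"
    and g: "range g \<subseteq> univ M" "y = chosen_rep (univ M) g"
    using assms unfolding ultrapower_def by auto
  have "eventually (\<lambda>n. f n = g n) U"
    using e chosen_rep(2)[OF f(1)] chosen_rep(2)[OF g(1)] unfolding f g by eventually_elim simp
  then show "x = y" using chosen_rep_eqI f g by blast
qed simp

lemma ultrapower_structure:
  assumes "is_structure L M"
  shows "is_structure L (ultrapower M)"
  unfolding is_structure_def
proof (intro conjI allI impI)
  show "univ (ultrapower M) \<noteq> {}"
    using structure_env[OF assms] unfolding ultrapower_def by auto
next
  fix f n xs assume f: "fun_ar L f = Some n" and xs: "length xs = n \<and> set xs \<subseteq> univ (ultrapower M)"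
  have "fun_int M f (map (\<lambda>x. x k) xs) \<in> univ M" for k
  proof -
    have "set (map (\<lambda>x. x k) xs) \<subseteq> univ M" using xs ultrapower_univ_range by fastforce
    then show ?thesis using assms f xs unfolding is_structure_def by (metis length_map)
  qed
  then have "chosen_rep (univ M) (\<lambda>n. fun_int M f (map (\<lambda>x. x n) xs)) \<in> univ (ultrapower M)"
    by (intro chosen_rep_in_ultrapower) auto
  then show "fun_int (ultrapower M) f xs \<in> univ (ultrapower M)" by (simp add: ultrapower_def)
qed

lemma eventually_list:
  "(\<And>x. x \<in> set xs \<Longrightarrow> eventually (Q x) F) \<Longrightarrow> eventually (\<lambda>n. \<forall>x\<in>set xs. Q x n) F"
  by (simp add: eventually_ball_finite)

lemma ultrapower_tm_val:
  assumes M: "is_structure L M" and e: "range e \<subseteq> univ (ultrapower M)" and t: "is_term L t"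
  shows "eventually (\<lambda>n. tm_val (ultrapower M) e t n = tm_val M (\<lambda>k. e k n) t) U"
  using t
proof (induction t)
  case (Fn f ts)
  have ts: "tm_val (ultrapower M) e t \<in> univ (ultrapower M)" if "t \<in> set ts" for t
    using tm_val_closed[OF ultrapower_structure[OF M] e] Fn.prems that by (auto simp: list_all_iff)
  have "fun_int M f (map (\<lambda>t. tm_val (ultrapower M) e t n) ts) \<in> univ M" for n
  proof -
    have "set (map (\<lambda>t. tm_val (ultrapower M) e t n) ts) \<subseteq> univ M" using ts ultrapower_univ_range by fastforce
    then show ?thesis using M Fn.prems unfolding is_structure_def by (simp del: set_map)
  qed
  then have 1: "eventually (\<lambda>n. fun_int M f (map (\<lambda>t. tm_val (ultrapower M) e t n) ts) =
      chosen_rep (univ M) (\<lambda>n. fun_int M f (map (\<lambda>t. tm_val (ultrapower M) e t n) ts)) n) U"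
    by (intro chosen_rep(2)) auto
  have "eventually (\<lambda>n. \<forall>t\<in>set ts. tm_val (ultrapower M) e t n = tm_val M (\<lambda>k. e k n) t) U"
    using Fn by (intro eventually_list) (auto simp: list_all_iff)
  with 1 show ?case
  proof eventually_elim
    case (elim n)
    have "map (\<lambda>t. tm_val (ultrapower M) e t n) ts = map (tm_val M (\<lambda>k. e k n)) ts"
      using elim(2) by simp
    then show ?case using elim(1) by (simp only: tm_val.simps ultrapower_fun_int map_map o_def)
  qed
qed simp

theorem Los:
  assumes M: "is_structure L M"
  shows "is_formula L \<phi> \<Longrightarrow> range e \<subseteq> univ (ultrapower M) \<Longrightarrow>
    sat (ultrapower M) e \<phi> \<longleftrightarrow> eventually (\<lambda>n. sat M (\<lambda>k. e k n) \<phi>) U"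
proof (induction \<phi> arbitrary: e)
  case (Eq s t)
  have "sat (ultrapower M) e (Eq s t) \<longleftrightarrow> eventually (\<lambda>n. tm_val (ultrapower M) e s n = tm_val (ultrapower M) e t n) U"
    using ultrapower_eq_iff[OF tm_val_closed[OF ultrapower_structure[OF M] Eq(2), of s]
        tm_val_closed[OF ultrapower_structure[OF M] Eq(2), of t]] Eq(1)
    by (simp only: sat.simps is_formula.simps)
  also have "\<dots> \<longleftrightarrow> eventually (\<lambda>n. sat M (\<lambda>k. e k n) (Eq s t)) U"
  proof (rule eventually_cong)
    show "eventually (\<lambda>n. tm_val (ultrapower M) e s n = tm_val M (\<lambda>k. e k n) s \<and>
        tm_val (ultrapower M) e t n = tm_val M (\<lambda>k. e k n) t) U"
      using ultrapower_tm_val[OF M Eq(2)] Eq(1) by (auto intro: eventually_conj)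
  qed auto
  finally show ?case .
next
  case (Rel r ts)
  have ev: "eventually (\<lambda>n. \<forall>t\<in>set ts. tm_val (ultrapower M) e t n = tm_val M (\<lambda>k. e k n) t) U"
    using ultrapower_tm_val[OF M Rel(2)] Rel(1) by (intro eventually_list) (auto simp: list_all_iff)
  have "sat (ultrapower M) e (Rel r ts) \<longleftrightarrow>
      eventually (\<lambda>n. rel_int M r (map (\<lambda>t. tm_val (ultrapower M) e t n) ts)) U"
    by (simp only: sat.simps ultrapower_rel_int map_map o_def)
  also have "\<dots> \<longleftrightarrow> eventually (\<lambda>n. sat M (\<lambda>k. e k n) (Rel r ts)) U"
  proof (rule eventually_cong[OF ev])
    fix n assume "\<forall>t\<in>set ts. tm_val (ultrapower M) e t n = tm_val M (\<lambda>k. e k n) t"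
    then have "map (\<lambda>t. tm_val (ultrapower M) e t n) ts = map (tm_val M (\<lambda>k. e k n)) ts" by simp
    then show "rel_int M r (map (\<lambda>t. tm_val (ultrapower M) e t n) ts) \<longleftrightarrow> sat M (\<lambda>k. e k n) (Rel r ts)"
      by (simp only: sat.simps)
  qed
  finally show ?case .
next
  case (Neg \<phi>) then show ?case by (simp add: eventually_not_iff)
next
  case (Conj \<phi> \<psi>) then show ?case by (simp add: eventually_conj_iff)
next
  case (Ex x \<phi>)
  have IH: "sat (ultrapower M) (e(x := a)) \<phi> \<longleftrightarrow> eventually (\<lambda>n. sat M ((\<lambda>k. e k n)(x := a n)) \<phi>) U"
    if "a \<in> univ (ultrapower M)" for a
  proof -
    have "range (e(x := a)) \<subseteq> univ (ultrapower M)" using Ex.prems(2) that by auto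
    then have "sat (ultrapower M) (e(x := a)) \<phi> \<longleftrightarrow> eventually (\<lambda>n. sat M (\<lambda>k. (e(x := a)) k n) \<phi>) U"
      using Ex by (intro Ex.IH) auto
    moreover have "(\<lambda>k. (e(x := a)) k n) = (\<lambda>k. e k n)(x := a n)" for n by auto
    ultimately show ?thesis by simp
  qed
  show ?case
  proof
    assume "sat (ultrapower M) e (Ex x \<phi>)"
    then obtain a where a: "a \<in> univ (ultrapower M)" "sat (ultrapower M) (e(x := a)) \<phi>" by auto
    have "eventually (\<lambda>n. sat M ((\<lambda>k. e k n)(x := a n)) \<phi>) U" using IH a by blast
    then show "eventually (\<lambda>n. sat M (\<lambda>k. e k n) (Ex x \<phi>)) U"
      by eventually_elim (use ultrapower_univ_range[OF a(1)] in auto)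
  next
    assume ev: "eventually (\<lambda>n. sat M (\<lambda>k. e k n) (Ex x \<phi>)) U"
    obtain d where d: "d \<in> univ M" using M unfolding is_structure_def by auto
    \<comment> \<open>Where there is no witness the value is the arbitrary \<open>d\<close>; by
      \<open>ev\<close> this happens only outside a set of the ultrafilter.\<close>
    define f where "f n = (if sat M (\<lambda>k. e k n) (Ex x \<phi>)
      then SOME a. a \<in> univ M \<and> sat M ((\<lambda>k. e k n)(x := a)) \<phi> else d)" for n
    have f: "f n \<in> univ M \<and> (sat M (\<lambda>k. e k n) (Ex x \<phi>) \<longrightarrow> sat M ((\<lambda>k. e k n)(x := f n)) \<phi>)" for n
    proof (cases "sat M (\<lambda>k. e k n) (Ex x \<phi>)")
      case True
      then have "\<exists>a. a \<in> univ M \<and> sat M ((\<lambda>k. e k n)(x := a)) \<phi>" by auto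
      from someI_ex[OF this] show ?thesis using True unfolding f_def by (simp only: if_True) blast
    next
      case False then show ?thesis using d unfolding f_def by (simp only: if_False) blast
    qed
    have rf: "range f \<subseteq> univ M" using f by auto
    have "eventually (\<lambda>n. sat M ((\<lambda>k. e k n)(x := chosen_rep (univ M) f n)) \<phi>) U"
      using ev chosen_rep(2)[OF rf]
    proof eventually_elim
      case (elim n) then show ?case using f[of n] by metis
    qed
    then have "sat (ultrapower M) (e(x := chosen_rep (univ M) f)) \<phi>" using IH chosen_rep_in_ultrapower[OF rf] by blast
    then show "sat (ultrapower M) e (Ex x \<phi>)" using chosen_rep_in_ultrapower[OF rf] by auto
  qed
qed

lemma ultrapower_holds:
  assumes "is_structure L M" "is_formula L \<psi>" "holds M \<psi>"
  shows "holds (ultrapower M) \<psi>"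
  unfolding holds_def
proof (intro allI impI)
  fix e :: "nat \<Rightarrow> nat \<Rightarrow> _" assume e: "range e \<subseteq> univ (ultrapower M)"
  have "range (\<lambda>k. e k n) \<subseteq> univ M" for n using e ultrapower_univ_range by blast
  then have "sat M (\<lambda>k. e k n) \<psi>" for n using assms(3) unfolding holds_def by simp
  then show "sat (ultrapower M) e \<psi>" using Los[OF assms(1,2) e] by simp
qed

lemma diag_elementary:
  fixes M :: "('a, 'b, 'c) struct"
  assumes M: "is_structure L M"
  shows "elementary_embedding L M (ultrapower M) (\<lambda>a. chosen_rep (univ M) (\<lambda>_. a))"
  unfolding elementary_embedding_def
proof (intro conjI allI impI)
  show "(\<lambda>a. chosen_rep (univ M) (\<lambda>_. a)) ` univ M \<subseteq> univ (ultrapower M)"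
    by (auto intro!: chosen_rep_in_ultrapower)
  fix \<phi> and e :: "nat \<Rightarrow> 'c" assume a: "is_formula L \<phi> \<and> range e \<subseteq> univ M"
  let ?h = "\<lambda>a. chosen_rep (univ M) (\<lambda>_. a)"
  have "range (?h \<circ> e) \<subseteq> univ (ultrapower M)" using a by (auto intro!: chosen_rep_in_ultrapower)
  then have "sat (ultrapower M) (?h \<circ> e) \<phi> \<longleftrightarrow> eventually (\<lambda>n. sat M (\<lambda>k. (?h \<circ> e) k n) \<phi>) U"
    using Los[OF M] a by blast
  also have "\<dots> \<longleftrightarrow> eventually (\<lambda>n. sat M e \<phi>) U"
  proof (rule eventually_cong)
    show "eventually (\<lambda>n. \<forall>k\<in>free_vars \<phi>. e k = ?h (e k) n) U"
      using a by (auto intro!: eventually_ball_finite chosen_rep(2))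
    fix n assume "\<forall>k\<in>free_vars \<phi>. e k = ?h (e k) n"
    then show "sat M (\<lambda>k. (?h \<circ> e) k n) \<phi> = sat M e \<phi>" by (intro sat_cong) simp
  qed
  finally show "sat M e \<phi> = sat (ultrapower M) (?h \<circ> e) \<phi>"
    using U_nontrivial by (cases "sat M e \<phi>") (auto simp: trivial_limit_def)
qed

text \<open>Diagonal choice: \<open>B r\<close> is correct for the first r instances, so the class
  of this sequence is correct for instance i at all indices beyond i, and these are almost all
  because the ultrafilter is free.\<close>

lemma shattered_ultrapower:
  assumes M: "is_structure L M" and \<phi>: "is_formula L \<phi>" and fs: "fin_shattered M \<phi> J A"
  shows "shattered (ultrapower M) \<phi> J (\<lambda>i k. chosen_rep (univ M) (\<lambda>_. A i k))"
  unfolding shattered_def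
proof (intro conjI allI)
  let ?h = "\<lambda>a. chosen_rep (univ M) (\<lambda>_. a)"
  have A: "A i k \<in> univ M" for i k using fs unfolding fin_shattered_def by blast
  have hA: "?h (A i k) \<in> univ (ultrapower M)" for i k using A by (intro chosen_rep_in_ultrapower) auto
  show "range (\<lambda>k. ?h (A i k)) \<subseteq> univ (ultrapower M)" for i
    using hA by auto
  fix S
  have "\<exists>B. range B \<subseteq> univ M \<and> (\<forall>i<r. sat M (mix J (A i) B) \<phi> \<longleftrightarrow> i \<in> S)" for r
    using fs unfolding fin_shattered_def by blast
  then obtain B where B: "\<And>r. range (B r) \<subseteq> univ M"
    "\<And>r i. i < r \<Longrightarrow> sat M (mix J (A i) (B r)) \<phi> \<longleftrightarrow> i \<in> S" by metis
  define B' where "B' k = chosen_rep (univ M) (\<lambda>r. B r k)" for k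
  have rB: "range (\<lambda>r. B r k) \<subseteq> univ M" for k using B(1) by auto
  have B': "range B' \<subseteq> univ (ultrapower M)" unfolding B'_def using rB by (auto intro!: chosen_rep_in_ultrapower)
  have "sat (ultrapower M) (mix J (\<lambda>k. ?h (A i k)) B') \<phi> \<longleftrightarrow> i \<in> S" for i
  proof -
    have "range (mix J (\<lambda>k. ?h (A i k)) B') \<subseteq> univ (ultrapower M)"
      using B' hA by (intro mix_range) auto
    then have "sat (ultrapower M) (mix J (\<lambda>k. ?h (A i k)) B') \<phi> \<longleftrightarrow>
       eventually (\<lambda>n. sat M (\<lambda>k. mix J (\<lambda>k. ?h (A i k)) B' k n) \<phi>) U"
      by (rule Los[OF M \<phi>])
    also have "\<dots> \<longleftrightarrow> eventually (\<lambda>n. i \<in> S) U"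
    proof (rule eventually_cong)
      have "eventually (\<lambda>n. i < n) U"
        using U_free eventually_gt_at_top filter_leD by blast
      moreover have "eventually (\<lambda>n. \<forall>k\<in>free_vars \<phi>. A i k = ?h (A i k) n) U"
        using A by (auto intro!: eventually_ball_finite chosen_rep(2))
      moreover have "eventually (\<lambda>n. \<forall>k\<in>free_vars \<phi>. B n k = B' k n) U"
        unfolding B'_def using rB by (auto intro!: eventually_ball_finite chosen_rep(2))
      ultimately show "eventually (\<lambda>n. i < n \<and> (\<forall>k\<in>free_vars \<phi>. A i k = ?h (A i k) n) \<and>
          (\<forall>k\<in>free_vars \<phi>. B n k = B' k n)) U" by (simp add: eventually_conj_iff)
      fix n assume n: "i < n \<and> (\<forall>k\<in>free_vars \<phi>. A i k = ?h (A i k) n) \<and>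
          (\<forall>k\<in>free_vars \<phi>. B n k = B' k n)"
      have "sat M (\<lambda>k. mix J (\<lambda>k. ?h (A i k)) B' k n) \<phi> = sat M (mix J (A i) (B n)) \<phi>"
        by (rule sat_cong) (use n in \<open>simp add: mix_def\<close>)
      then show "sat M (\<lambda>k. mix J (\<lambda>k. ?h (A i k)) B' k n) \<phi> \<longleftrightarrow> i \<in> S" using B(2) n by simp
    qed
    also have "\<dots> \<longleftrightarrow> i \<in> S" using U_nontrivial by (cases "i \<in> S") (auto simp: trivial_limit_def)
    finally show ?thesis .
  qed
  then show "\<exists>B. range B \<subseteq> univ (ultrapower M) \<and>
      (\<forall>i. sat (ultrapower M) (mix J (\<lambda>k. ?h (A i k)) B) \<phi> \<longleftrightarrow> i \<in> S)"
    using B' by blast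
qed

end

text \<open>Countably many instances are handled by an ultrapower along the natural numbers, whence
  the element type \<open>nat \<Rightarrow> 'u\<close>.\<close>

lemma shattered_elementary_extension:
  fixes M :: "('f, 'r, 'u) struct"
  assumes "is_structure L M" "is_formula L \<phi>" "fin_shattered M \<phi> J A"
  obtains N :: "('f, 'r, nat \<Rightarrow> 'u) struct" and h where "is_structure L N"
    "elementary_embedding L M N h" "\<And>\<psi>. is_formula L \<psi> \<Longrightarrow> holds M \<psi> \<Longrightarrow> holds N \<psi>"
    "shattered N \<phi> J (\<lambda>i k. h (A i k))"
proof -
  obtain U :: "nat filter" where U: "U \<noteq> bot \<and> U \<le> sequentially \<and>
     (\<forall>Q. eventually Q U \<or> eventually (\<lambda>n. \<not> Q n) U)" using ultrafilter_exists by blast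
  interpret free_ultrafilter U by unfold_locales (use U in auto)
  show ?thesis
    using ultrapower_structure[OF assms(1)] diag_elementary[OF assms(1)] ultrapower_holds[OF assms(1)]
      shattered_ultrapower[OF assms] by (rule that)
qed

section \<open>Downward Loewenheim-Skolem\<close>

text \<open>Formulas serve as codes for the elements of a Skolem hull.\<close>

fun skolem_code :: "(nat \<Rightarrow> ('f, 'r) fm \<Rightarrow> (nat \<Rightarrow> 'v) \<Rightarrow> 'v) \<Rightarrow> (nat \<Rightarrow> 'v) \<Rightarrow> (('f, 'r) fm \<Rightarrow> 'v) \<Rightarrow>
    ('f, 'r) fm \<Rightarrow> 'v"
  and skolem_codes :: "(nat \<Rightarrow> ('f, 'r) fm \<Rightarrow> (nat \<Rightarrow> 'v) \<Rightarrow> 'v) \<Rightarrow> (nat \<Rightarrow> 'v) \<Rightarrow> (('f, 'r) fm \<Rightarrow> 'v) \<Rightarrow>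
    ('f, 'r) fm \<Rightarrow> 'v list" where
  "skolem_code sk X Y (Neg \<chi>) = Y \<chi>"
| "skolem_code sk X Y (Ex k \<chi>) = X k"
| "skolem_code sk X Y (Conj \<phi> \<psi>) = (case \<phi> of
     Ex x \<chi> \<Rightarrow> sk x \<chi> (\<lambda>k. let as = skolem_codes sk X Y \<psi> in if k < length as then as ! k else X 0)
   | _ \<Rightarrow> X 0)"
| "skolem_code sk X Y _ = X 0"
| "skolem_codes sk X Y (Conj \<phi> \<psi>) = skolem_code sk X Y \<phi> # skolem_codes sk X Y \<psi>"
| "skolem_codes sk X Y _ = []"

text \<open>Conjunctions act as list cells and any other formula ends the list, so every finite
  tuple of the hull can be the argument of a Skolem function.\<close>

lemma skolem_codes_surj:
  assumes "set as \<subseteq> range (skolem_code sk X Y)"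
  shows "\<exists>\<psi>. skolem_codes sk X Y \<psi> = as"
  using assms
proof (induction as)
  case Nil
  then show ?case by (intro exI[of _ "Rel undefined []"]) simp
next
  case (Cons a as)
  then obtain \<psi> \<phi> where "skolem_codes sk X Y \<psi> = as" "skolem_code sk X Y \<phi> = a" by auto
  then show ?case by (intro exI[of _ "Conj \<phi> \<psi>"]) simp
qed

lemma is_structure_fun:
  "is_structure L M \<Longrightarrow> fun_ar L f = Some (length xs) \<Longrightarrow> set xs \<subseteq> univ M \<Longrightarrow>
    fun_int M f xs \<in> univ M"
  by (auto simp: is_structure_def)

lemma tm_val_univ_update [simp]: "tm_val (N\<lparr>univ := H\<rparr>) e t = tm_val N e t"
proof (induction t)
  case (Fn f ts)
  then have "map (tm_val (N\<lparr>univ := H\<rparr>) e) ts = map (tm_val N e) ts" by simp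
  then show ?case by (simp del: map_eq_conv)
qed simp

lemma sat_univ_update_Rel: "sat (N\<lparr>univ := H\<rparr>) e (Rel r ts) \<longleftrightarrow> sat N e (Rel r ts)"
proof -
  have "map (tm_val (N\<lparr>univ := H\<rparr>) e) ts = map (tm_val N e) ts" by simp
  then show ?thesis by (simp del: map_eq_conv)
qed

lemma tarski_vaught:
  fixes N :: "('f, 'r, 'v) struct"
  assumes H: "H \<subseteq> univ N"
    and tv: "\<And>x \<phi> e a. range e \<subseteq> H \<Longrightarrow> a \<in> univ N \<Longrightarrow> sat N (e(x := a)) \<phi> \<Longrightarrow>
      \<exists>b\<in>H. sat N (e(x := b)) \<phi>"
  shows "range e \<subseteq> H \<Longrightarrow> sat (N\<lparr>univ := H\<rparr>) e \<phi> \<longleftrightarrow> sat N e \<phi>"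
proof (induction \<phi> arbitrary: e)
  case (Rel r ts) show ?case by (rule sat_univ_update_Rel)
next
  case (Ex x \<phi>)
    have "sat (N\<lparr>univ := H\<rparr>) (e(x := a)) \<phi> \<longleftrightarrow> sat N (e(x := a)) \<phi>" if "a \<in> H" for a
      using Ex.prems that by (intro Ex.IH) auto
    then have "sat (N\<lparr>univ := H\<rparr>) e (Ex x \<phi>) \<longleftrightarrow> (\<exists>a\<in>H. sat N (e(x := a)) \<phi>)" by simp
    also have "\<dots> \<longleftrightarrow> sat N e (Ex x \<phi>)" using tv[OF Ex.prems] H by auto
    finally show ?case .
qed auto

text \<open>The carrier consists of codes, one for each element of the Skolem hull of
  \<open>X\<close> and \<open>Y\<close>, so the small model lives on the type of formulas whatever
  the size of the language. \<open>Y\<close> is indexed by formulas so that a small model built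
  before can be put into the next hull.\<close>

lemma downward_loewenheim_skolem:
  fixes N :: "('f, 'r, 'v) struct" and X :: "nat \<Rightarrow> 'v" and Y :: "('f, 'r) fm \<Rightarrow> 'v"
  assumes N: "is_structure L N" and X: "range X \<subseteq> univ N" and Y: "range Y \<subseteq> univ N"
  shows "\<exists>(M :: ('f, 'r, ('f, 'r) fm) struct) D. is_structure L M \<and> elementary_embedding L M N D \<and>
    inj_on D (univ M) \<and> range X \<subseteq> D ` univ M \<and> range Y \<subseteq> D ` univ M"
proof -
  \<comment> \<open>Skolem functions; without a witness the value is \<open>X 0\<close>, which lies
    in \<open>N\<close>.\<close>
  define sk where "sk x \<phi> e = (if \<exists>a\<in>univ N. sat N (e(x := a)) \<phi>
    then SOME a. a \<in> univ N \<and> sat N (e(x := a)) \<phi> else X 0)" for x and \<phi> :: "('f, 'r) fm" and e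
  have sk: "sk x \<phi> e \<in> univ N \<and> (\<forall>a\<in>univ N. sat N (e(x := a)) \<phi> \<longrightarrow> sat N (e(x := sk x \<phi> e)) \<phi>)"
    for x \<phi> e
  proof (cases "\<exists>a\<in>univ N. sat N (e(x := a)) \<phi>")
    case True
    then have "\<exists>a. a \<in> univ N \<and> sat N (e(x := a)) \<phi>" by blast
    from someI_ex[OF this] show ?thesis using True unfolding sk_def by (simp only: if_True) blast
  next
    case False then show ?thesis using X unfolding sk_def by auto
  qed
  define D where "D = skolem_code sk X Y"
  define H where "H = range D"
  have D_in: "D \<chi> \<in> univ N" for \<chi>
  proof (cases \<chi>)
    case (Conj \<phi> \<psi>)
    then show ?thesis unfolding D_def using sk X by (cases \<phi>) auto
  qed (use X Y in \<open>auto simp: D_def\<close>)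
  then have HN: "H \<subseteq> univ N" unfolding H_def by auto
  have tv: "\<exists>b\<in>H. sat N (e(x := b)) \<phi>"
    if e: "range e \<subseteq> H" and a: "a \<in> univ N" "sat N (e(x := a)) \<phi>" for x \<phi> e a
  proof -
    obtain n where n: "free_vars \<phi> \<subseteq> {..<n}"
      using finite_free_vars[of \<phi>] unfolding finite_nat_set_iff_bounded by auto
    have "set (map e [0..<n]) \<subseteq> range (skolem_code sk X Y)" using e unfolding H_def D_def by auto
    then obtain \<psi> where \<psi>: "skolem_codes sk X Y \<psi> = map e [0..<n]" using skolem_codes_surj by metis
    \<comment> \<open>A code carries finitely many arguments only, so beyond the free variables of
      \<open>\<phi>\<close> the assignment is replaced by the default of the decoding.\<close>
    define e' where "e' k = (if k < n then e k else X 0)" for k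
    have D: "D (Conj (Ex x \<phi>) \<psi>) = sk x \<phi> e'"
    proof -
      have "(\<lambda>k. let as = skolem_codes sk X Y \<psi> in if k < length as then as ! k else X 0) = e'"
        by (auto simp: \<psi> e'_def)
      then show ?thesis unfolding D_def by (simp only: skolem_code.simps fm.case)
    qed
    have eq: "sat N (e'(x := b)) \<phi> = sat N (e(x := b)) \<phi>" for b
      by (rule sat_cong) (use n in \<open>auto simp: e'_def\<close>)
    have "sat N (e(x := sk x \<phi> e')) \<phi>" using sk a eq by blast
    moreover have "sk x \<phi> e' \<in> H" unfolding H_def using D by (metis rangeI)
    ultimately show ?thesis by blast
  qed
  have H_sat: "sat (N\<lparr>univ := H\<rparr>) e \<phi> \<longleftrightarrow> sat N e \<phi>" if "range e \<subseteq> H" for e \<phi>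
    using that by (rule tarski_vaught[OF HN, rotated]) (rule tv)
  \<comment> \<open>The value of a function symbol is the only solution of an equation, hence a
    witness that the hull contains.\<close>
  have H_fun: "fun_int N f xs \<in> H" if f: "fun_ar L f = Some (length xs)" and xs: "set xs \<subseteq> H" for f xs
  proof -
    define n where "n = length xs"
    define e where "e k = (if k < n then xs ! k else X 0)" for k
    define \<phi> :: "('f, 'r) fm" where "\<phi> = Eq (Var n) (Fn f (map Var [0..<n]))"
    have X0: "X 0 \<in> H" unfolding H_def D_def
      by (rule image_eqI[of _ _ "Ex 0 (Rel undefined [])"]) simp_all
    have e: "range e \<subseteq> H" using xs X0 by (auto simp: e_def n_def)
    have val: "map (tm_val N (e(n := b)) \<circ> Var) [0..<n] = xs" for b
      by (rule nth_equalityI) (auto simp: e_def n_def)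
    have \<phi>: "sat N (e(n := b)) \<phi> \<longleftrightarrow> b = fun_int N f xs" for b
      unfolding \<phi>_def by (simp only: sat.simps tm_val.simps map_map val fun_upd_same)
    have "set xs \<subseteq> univ N" using xs HN by blast
    then have "fun_int N f xs \<in> univ N" using is_structure_fun[OF N f] by blast
    from tv[OF e this iffD2[OF \<phi> refl]] show ?thesis unfolding \<phi> by auto
  qed
  \<comment> \<open>Different codes may denote the same element; \<open>c\<close> selects one of
    them, which makes \<open>D\<close> injective on the carrier.\<close>
  define c where "c x = inv_into UNIV D x" for x
  have Dc: "D (c x) = x" if "x \<in> H" for x
    unfolding c_def using that H_def by (simp add: f_inv_into_f)
  define M :: "('f, 'r, ('f, 'r) fm) struct" where
    "M = \<lparr>univ = c ` H, fun_int = (\<lambda>f xs. c (fun_int N f (map D xs))),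
          rel_int = (\<lambda>r xs. rel_int N r (map D xs))\<rparr>"
  have DH: "D x \<in> H" for x unfolding H_def by blast
  have M_str: "is_structure L M"
    unfolding is_structure_def
  proof (intro conjI allI impI)
    show "univ M \<noteq> {}" unfolding M_def H_def by auto
    fix f n xs assume f: "fun_ar L f = Some n" and xs: "length xs = n \<and> set xs \<subseteq> univ M"
    have "fun_int N f (map D xs) \<in> H" using f xs DH by (intro H_fun) auto
    then show "fun_int M f xs \<in> univ M" unfolding M_def by simp
  qed
  have M_tm: "D (tm_val M e t) = tm_val N (D \<circ> e) t" if "range e \<subseteq> univ M" "is_term L t" for e t
    using that(2)
  proof (induction t)
    case (Fn f ts)
    then have eq: "map (D \<circ> tm_val M e) ts = map (tm_val N (D \<circ> e)) ts"
      unfolding map_eq_conv by (metis (no_types, lifting) comp_apply is_term.simps(2) list_all_iff)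
    have "fun_int N f (map (D \<circ> tm_val M e) ts) \<in> H"
      using Fn.prems DH by (intro H_fun) auto
    then have "D (c (fun_int N f (map (D \<circ> tm_val M e) ts))) = fun_int N f (map (D \<circ> tm_val M e) ts)"
      by (rule Dc)
    moreover have "tm_val M e (Fn f ts) = c (fun_int N f (map (D \<circ> tm_val M e) ts))"
      by (simp add: M_def)
    ultimately show ?case by (simp only: tm_val.simps eq)
  qed simp
  have inj: "inj_on D (univ M)"
    by (rule inj_onI) (use Dc in \<open>auto simp: M_def\<close>)
  have M_sat: "sat M e \<phi> \<longleftrightarrow> sat (N\<lparr>univ := H\<rparr>) (D \<circ> e) \<phi>" if "is_formula L \<phi>" "range e \<subseteq> univ M" for e \<phi>
    using that
  proof (induction \<phi> arbitrary: e)
      case (Eq s t)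
      have "tm_val M e s \<in> univ M" "tm_val M e t \<in> univ M"
        using tm_val_closed[OF M_str Eq(2)] Eq(1) by auto
      then have "tm_val M e s = tm_val M e t \<longleftrightarrow> D (tm_val M e s) = D (tm_val M e t)"
        using inj by (auto dest: inj_onD)
      then show ?case using Eq by (simp only: sat.simps tm_val_univ_update M_tm is_formula.simps)
    next
      case (Rel r ts)
      then have "map (D \<circ> tm_val M e) ts = map (tm_val N (D \<circ> e)) ts"
        using M_tm by (auto simp: list_all_iff)
      moreover have "sat M e (Rel r ts) \<longleftrightarrow> rel_int N r (map (D \<circ> tm_val M e) ts)"
        by (simp add: M_def)
      ultimately show ?case unfolding sat_univ_update_Rel by (simp only: sat.simps)
    next
      case (Ex x \<phi>)
      have "sat M (e(x := a)) \<phi> \<longleftrightarrow> sat (N\<lparr>univ := H\<rparr>) ((D \<circ> e)(x := D a)) \<phi>" if "a \<in> univ M" for a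
      proof -
        have "sat M (e(x := a)) \<phi> \<longleftrightarrow> sat (N\<lparr>univ := H\<rparr>) (D \<circ> e(x := a)) \<phi>"
          using Ex.prems that by (intro Ex.IH) auto
        moreover have "D \<circ> e(x := a) = (D \<circ> e)(x := D a)" by auto
        ultimately show ?thesis by simp
      qed
      then have "sat M e (Ex x \<phi>) \<longleftrightarrow>
          (\<exists>b\<in>D ` univ M. sat (N\<lparr>univ := H\<rparr>) ((D \<circ> e)(x := b)) \<phi>)"
        unfolding sat.simps by blast
      moreover have "D ` univ M = univ (N\<lparr>univ := H\<rparr>)" unfolding M_def using Dc by force
      ultimately show ?case by (simp only: sat.simps)
  qed auto
  have emb: "elementary_embedding L M N D"
    unfolding elementary_embedding_def
  proof (intro conjI allI impI)
    show "D ` univ M \<subseteq> univ N" using D_in by auto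
    fix \<phi> and e :: "nat \<Rightarrow> _" assume a: "is_formula L \<phi> \<and> range e \<subseteq> univ M"
    have "range (D \<circ> e) \<subseteq> H" using DH by auto
    then show "sat M e \<phi> = sat N (D \<circ> e) \<phi>"
      using M_sat[of \<phi> e] H_sat[of "D \<circ> e" \<phi>] a by simp
  qed
  have "x \<in> D ` univ M" if "x \<in> H" for x
    using Dc[OF that] that unfolding M_def by force
  moreover have "X k \<in> H" for k unfolding H_def D_def
    by (rule image_eqI[of _ _ "Ex k (Rel undefined [])"]) simp_all
  moreover have "Y \<chi> \<in> H" for \<chi> unfolding H_def D_def
    by (rule image_eqI[of _ _ "Neg \<chi>"]) simp_all
  ultimately show ?thesis using M_str emb inj by blast
qed

lemma elementary_embeddingD:
  "elementary_embedding L M N h \<Longrightarrow> is_formula L \<phi> \<Longrightarrow> range e \<subseteq> univ M \<Longrightarrow>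
    sat M e \<phi> \<longleftrightarrow> sat N (h \<circ> e) \<phi>"
  unfolding elementary_embedding_def by blast

text \<open>Both models are read as elementary submodels of \<open>N\<close>, so \<open>D'\<close>
  can be inverted on the image of \<open>D\<close>.\<close>

lemma elementary_embedding_factor:
  assumes 1: "elementary_embedding L M N D" and 2: "elementary_embedding L M' N D'"
    and sub: "D ` univ M \<subseteq> D' ` univ M'"
  shows "\<exists>h. elementary_embedding L M M' h \<and> (\<forall>x\<in>univ M. D' (h x) = D x)"
proof -
  have "\<forall>x\<in>univ M. \<exists>y\<in>univ M'. D' y = D x" using sub by fastforce
  then obtain h where h: "\<And>x. x \<in> univ M \<Longrightarrow> h x \<in> univ M' \<and> D' (h x) = D x" by metis
  have "elementary_embedding L M M' h"
    unfolding elementary_embedding_def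
  proof (intro conjI allI impI)
    show "h ` univ M \<subseteq> univ M'" using h by auto
    fix \<phi> and e :: "nat \<Rightarrow> _" assume a: "is_formula L \<phi> \<and> range e \<subseteq> univ M"
    have r: "range (h \<circ> e) \<subseteq> univ M'" using a h by auto
    have "D' \<circ> (h \<circ> e) = D \<circ> e" using a h by (intro ext) auto
    then show "sat M e \<phi> = sat M' (h \<circ> e) \<phi>"
      using elementary_embeddingD[OF 1, of \<phi> e] elementary_embeddingD[OF 2, of \<phi> "h \<circ> e"] a r
      by simp
  qed
  then show ?thesis using h by blast
qed

text \<open>NIP of T speaks of models whose elements are formulas and of extensions of the same
  type. So a small \<open>M\<close> containing all the \<open>A i\<close> is fixed, and for each
  pattern a small \<open>M'\<close> is taken inside \<open>N\<close> that contains both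
  \<open>M\<close> and the realisation.\<close>

lemma shattered_imp_not_NIP:
  fixes N :: "('f, 'r, 'v) struct"
  assumes N: "is_model L T N" and T: "is_theory L T" and \<psi>: "is_formula L \<psi>"
    and sh: "shattered N \<psi> J A"
  shows "\<not> NIP TYPE(('f, 'r) fm) L T"
proof -
  have Ns: "is_structure L N" using N unfolding is_model_def by blast
  have A: "range (A i) \<subseteq> univ N" for i using sh unfolding shattered_def by blast
  define X where "X k = (case prod_decode k of (i, l) \<Rightarrow> A i l)" for k
  have X: "range X \<subseteq> univ N" using A by (fastforce simp: X_def split: prod.splits)
  have XA: "A i l = X (prod_encode (i, l))" for i l by (simp add: X_def)
  have X0: "range (\<lambda>_ :: ('f, 'r) fm. X 0) \<subseteq> univ N" using X by auto
  obtain M :: "('f, 'r, ('f, 'r) fm) struct" and D where M: "is_structure L M"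
    "elementary_embedding L M N D" and "range X \<subseteq> D ` univ M"
    using downward_loewenheim_skolem[OF Ns X X0] by (elim exE conjE) (rule that)
  then have "\<forall>i l. \<exists>a\<in>univ M. D a = A i l" unfolding XA by (metis image_iff rangeI subsetD)
  then obtain a where a: "\<And>i l. a i l \<in> univ M" "\<And>i l. D (a i l) = A i l" by metis
  have MT: "is_model L T M" using elementary_embedding_model_iff[OF M(2,1) Ns T] N by blast
  \<comment> \<open>\<open>has_IP\<close> expects x and y on consecutive initial variables: the free
    variables outside \<open>J\<close> are numbered first, those in \<open>J\<close> next.\<close>
  define V where "V = free_vars \<psi>"
  define xs where "xs = sorted_list_of_set (V - J)"
  define ys where "ys = sorted_list_of_set (V \<inter> J)"
  define m where "m = length xs"
  define n where "n = length ys"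
  have zs: "distinct (xs @ ys)" "set (xs @ ys) = V" "set xs = V - J" "set ys = V \<inter> J"
    by (auto simp: xs_def ys_def V_def)
  have "\<exists>\<rho>. inj \<rho> \<and> (\<forall>k < m + n. \<rho> ((xs @ ys) ! k) = k)"
  proof -
    define pos where "pos v = (THE k. k < m + n \<and> (xs @ ys) ! k = v)" for v
    have pos: "pos ((xs @ ys) ! k) = k" if "k < m + n" for k
      unfolding pos_def using that zs(1) by (intro the_equality) (auto simp: nth_eq_iff_index_eq m_def n_def)
    \<comment> \<open>All other variables are shifted past the numbers in use, which keeps
      \<open>\<rho>\<close> injective.\<close>
    define \<rho> where "\<rho> v = (if v \<in> V then pos v else v + m + n)" for v
    have ex: "\<exists>k<m+n. (xs @ ys) ! k = v" if "v \<in> V" for v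
      using that zs(2) unfolding m_def n_def by (metis in_set_conv_nth length_append)
    have "inj \<rho>"
    proof (rule injI)
      fix u v assume eq: "\<rho> u = \<rho> v"
      have lt: "\<rho> w < m + n \<longleftrightarrow> w \<in> V" for w
        using ex[of w] pos by (auto simp: \<rho>_def)
      show "u = v"
      proof (cases "u \<in> V")
        case True
        then have "v \<in> V" using lt eq by metis
        then show ?thesis using ex[OF True] ex[of v] pos eq True unfolding \<rho>_def by (metis (full_types))
      next
        case False
        then have "v \<notin> V" using lt eq by metis
        then show ?thesis using False eq by (simp add: \<rho>_def)
      qed
    qed
    moreover have "\<rho> ((xs @ ys) ! k) = k" if "k < m + n" for k
    proof -
      have "(xs @ ys) ! k \<in> V" using that zs(2) unfolding m_def n_def by (metis length_append nth_mem)
      then show ?thesis using pos[OF that] by (simp add: \<rho>_def)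
    qed
    ultimately show ?thesis by blast
  qed
  then obtain \<rho> where \<rho>: "inj \<rho>" "\<And>k. k < m + n \<Longrightarrow> \<rho> ((xs @ ys) ! k) = k" by blast
  define \<phi> where "\<phi> = ren \<rho> \<psi>"
  have idx: "\<exists>k<m+n. v = (xs @ ys) ! k \<and> \<rho> v = k" if "v \<in> V" for v
    using that zs(2) \<rho>(2) unfolding m_def n_def by (metis in_set_conv_nth length_append)
  have fv: "free_vars \<phi> \<subseteq> {..<m + n}"
    using idx unfolding \<phi>_def free_vars_ren[OF \<rho>(1)] V_def[symmetric] by fastforce
  have val: "sat Q (nth (map f xs @ map g ys)) \<phi> \<longleftrightarrow> sat Q (mix J f g) \<psi>"
    for Q :: "('f, 'r, ('f, 'r) fm) struct" and f g
  proof -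
    have "(nth (map f xs @ map g ys) \<circ> \<rho>) v = mix J f g v" if "v \<in> V" for v
    proof -
      obtain k where k: "k < m + n" "v = (xs @ ys) ! k" "\<rho> v = k" using idx[OF \<open>v \<in> V\<close>] by blast
      show ?thesis
      proof (cases "k < m")
        case True
        then have "v = xs ! k" "v \<in> set xs" using k by (auto simp: nth_append m_def)
        then show ?thesis using True k(3) zs(3) by (simp add: nth_append m_def mix_def)
      next
        case False
        then have "v = ys ! (k - m)" "v \<in> set ys" using k by (auto simp: nth_append m_def n_def)
        then show ?thesis using False k(1,3) zs(4) by (simp add: nth_append m_def n_def mix_def)
      qed
    qed
    then have "sat Q (nth (map f xs @ map g ys) \<circ> \<rho>) \<psi> \<longleftrightarrow> sat Q (mix J f g) \<psi>"
      by (intro sat_cong) (simp add: V_def)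
    then show ?thesis unfolding \<phi>_def sat_ren[OF \<rho>(1)] .
  qed
  have "consistent_over L M n ({(\<phi>, map (a i) xs) | i. i \<in> S} \<union> {(Neg \<phi>, map (a i) xs) | i. i \<notin> S})" for S
  proof -
    obtain B where B: "range B \<subseteq> univ N" "\<And>i. sat N (mix J (A i) B) \<psi> \<longleftrightarrow> i \<in> S"
      using sh unfolding shattered_def by blast
    obtain x0 where x0: "x0 \<in> univ M" using M(1) unfolding is_structure_def by auto
    \<comment> \<open>Lists the elements of \<open>M\<close> within \<open>N\<close>, with
      \<open>x0\<close> as padding at formulas that are not elements of \<open>M\<close>.\<close>
    define Y where "Y x = D (if x \<in> univ M then x else x0)" for x
    have Y: "range Y \<subseteq> univ N" using M(2) x0 unfolding elementary_embedding_def Y_def by auto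
    obtain M' :: "('f, 'r, ('f, 'r) fm) struct" and D' where M': "is_structure L M'"
      "elementary_embedding L M' N D'" "range B \<subseteq> D' ` univ M'" "range Y \<subseteq> D' ` univ M'"
      using downward_loewenheim_skolem[OF Ns B(1) Y] by (elim exE conjE) (rule that)
    have "D ` univ M \<subseteq> range Y" unfolding Y_def by auto
    then obtain h where h: "elementary_embedding L M M' h" "\<And>x. x \<in> univ M \<Longrightarrow> D' (h x) = D x"
      using elementary_embedding_factor[OF M(2) M'(2)] M'(4) by blast
    have "\<forall>k. \<exists>b\<in>univ M'. D' b = B k" using M'(3) by (metis image_iff rangeI subsetD)
    then obtain b where b: "\<And>k. b k \<in> univ M'" "\<And>k. D' (b k) = B k" by metis
    have sat: "sat M' (nth (map h (map (a i) xs) @ map b ys)) \<phi> \<longleftrightarrow> i \<in> S" for i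
    proof -
      have "map h (map (a i) xs) = map (h \<circ> a i) xs" by simp
      then have "sat M' (nth (map h (map (a i) xs) @ map b ys)) \<phi> \<longleftrightarrow> sat M' (mix J (h \<circ> a i) b) \<psi>"
        using val by presburger
      also have "\<dots> \<longleftrightarrow> sat N (D' \<circ> mix J (h \<circ> a i) b) \<psi>"
      proof (rule elementary_embeddingD[OF M'(2) \<psi>], rule mix_range)
        show "range (h \<circ> a i) \<subseteq> univ M'" using h(1) a(1) unfolding elementary_embedding_def by auto
      qed (use b in auto)
      also have "D' \<circ> mix J (h \<circ> a i) b = mix J (A i) B"
        using h(2) a b by (auto simp: mix_def)
      finally show ?thesis using B(2) by simp
    qed
    show ?thesis
      unfolding consistent_over_def
    proof (intro exI conjI)
      show "is_structure L M'" "elementary_embedding L M M' h" by fact+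
      show "length (map b ys) = n" by (simp add: n_def)
      show "set (map b ys) \<subseteq> univ M'" using b by auto
      show "\<forall>(\<phi>, a) \<in> {(\<phi>, map (a i) xs) | i. i \<in> S} \<union> {(Neg \<phi>, map (a i) xs) | i. i \<notin> S}.
         sat M' (nth (map h a @ map b ys)) \<phi>"
        using sat by auto
    qed
  qed
  moreover have "length (map (a i) xs) = m \<and> set (map (a i) xs) \<subseteq> univ M" for i
    using a(1) by (auto simp: m_def)
  ultimately have "has_IP TYPE(('f, 'r) fm) L T m n \<phi>"
    unfolding has_IP_def using MT by (intro exI[of _ M] exI[of _ "\<lambda>i. map (a i) xs"]) blast
  moreover have "is_formula L \<phi>" using \<psi> by (simp add: \<phi>_def)
  ultimately show ?thesis using fv unfolding NIP_def by blast
qed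

section \<open>Relations over a subring and pseudo-division\<close>

context domain
begin

lemma finsum_induct:
  assumes "finite A" "\<And>a. a \<in> A \<Longrightarrow> f a \<in> carrier R \<and> Q (f a)" "Q \<zero>"
    and "\<And>x y. x \<in> carrier R \<Longrightarrow> y \<in> carrier R \<Longrightarrow> Q x \<Longrightarrow> Q y \<Longrightarrow> Q (x \<oplus> y)"
  shows "Q (\<Oplus>a\<in>A. f a)"
  using assms(1,2)
proof (induction A)
  case (insert a A)
  then have "(\<Oplus>a\<in>insert a A. f a) = f a \<oplus> (\<Oplus>a\<in>A. f a)" by (intro finsum_insert) auto
  moreover have "(\<Oplus>a\<in>A. f a) \<in> carrier R" using insert by (intro finsum_closed) auto
  ultimately show ?case using insert assms(4) by simp
qed (simp add: assms(3))

text \<open>Fraction-free elimination of one vector at a time. If a nonzero multiple of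
  \<open>v x\<close> is a combination of the others over A, substituting it reduces every relation
  to one on \<open>W\<close>; otherwise the coefficient of \<open>v x\<close> must vanish, which one
  more column expresses. A is only a ring, since it will be P as well as the ring generated by P and
  all the tuples \<open>A j\<close>.\<close>

lemma kernel_matrix:
  assumes A: "A \<subseteq> carrier R" "\<zero> \<in> A" "\<one> \<in> A"
      "\<And>x y. x \<in> A \<Longrightarrow> y \<in> A \<Longrightarrow> x \<oplus> y \<in> A" "\<And>x y. x \<in> A \<Longrightarrow> y \<in> A \<Longrightarrow> x \<otimes> y \<in> A"
      "\<And>x. x \<in> A \<Longrightarrow> \<ominus> x \<in> A"
    and W: "finite W" and v: "\<And>w. w \<in> W \<Longrightarrow> v w \<in> carrier R"
  shows "\<exists>c. (\<forall>w u. c w u \<in> A) \<and> (\<forall>g. (\<forall>w. g w \<in> A) \<longrightarrow>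
    ((\<Oplus>w\<in>W. g w \<otimes> v w) = \<zero> \<longleftrightarrow> (\<forall>u\<in>W. (\<Oplus>w\<in>W. g w \<otimes> c w u) = \<zero>)))"
  using W v
proof (induction W)
  case empty
  then show ?case using A(2) by (intro exI[of _ "\<lambda>_ _. \<zero>"]) auto
next
  case (insert x W)
  then obtain c where c: "\<And>w u. c w u \<in> A"
    and ker: "\<And>g. (\<And>w. g w \<in> A) \<Longrightarrow>
      (\<Oplus>w\<in>W. g w \<otimes> v w) = \<zero> \<longleftrightarrow> (\<forall>u\<in>W. (\<Oplus>w\<in>W. g w \<otimes> c w u) = \<zero>)"
    by auto
  have AC: "a \<in> carrier R" if "a \<in> A" for a using that A(1) by blast
  have cC: "c w u \<in> carrier R" for w u using c AC by blast
  have vx: "v x \<in> carrier R" and vW: "w \<in> W \<Longrightarrow> v w \<in> carrier R" for w using insert by auto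
  have ins: "(\<Oplus>w\<in>insert x W. f w) = f x \<oplus> (\<Oplus>w\<in>W. f w)"
    if "\<And>w. w \<in> insert x W \<Longrightarrow> f w \<in> carrier R" for f
    using that insert by (intro finsum_insert) auto
  have cong: "(\<Oplus>w\<in>W. f w) = (\<Oplus>w\<in>W. f' w)"
    if "\<And>w. w \<in> W \<Longrightarrow> f w = f' w" "\<And>w. w \<in> W \<Longrightarrow> f' w \<in> carrier R" for f f'
    using that by (intro finsum_cong') auto
  have sumC: "(\<Oplus>w\<in>W. f w) \<in> carrier R" if "\<And>w. w \<in> W \<Longrightarrow> f w \<in> carrier R" for f
    using that by (intro finsum_closed) auto
  have sumA: "(\<Oplus>w\<in>W. f w) \<in> A" if "\<And>w. w \<in> W \<Longrightarrow> f w \<in> A" for f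
    using that A insert(1) AC by (intro finsum_induct[where Q = "\<lambda>z. z \<in> A"]) auto
  have lin_comb: "(\<Oplus>w\<in>W. (s \<otimes> g w \<oplus> t \<otimes> r w) \<otimes> f w) = s \<otimes> (\<Oplus>w\<in>W. g w \<otimes> f w) \<oplus> t \<otimes> (\<Oplus>w\<in>W. r w \<otimes> f w)"
    if "s \<in> carrier R" "t \<in> carrier R" "\<And>w. w \<in> W \<Longrightarrow> g w \<in> carrier R"
      "\<And>w. w \<in> W \<Longrightarrow> r w \<in> carrier R" "\<And>w. w \<in> W \<Longrightarrow> f w \<in> carrier R" for s t g r f
  proof -
    have "(\<Oplus>w\<in>W. (s \<otimes> g w \<oplus> t \<otimes> r w) \<otimes> f w) = (\<Oplus>w\<in>W. s \<otimes> (g w \<otimes> f w) \<oplus> t \<otimes> (r w \<otimes> f w))"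
      using that by (intro cong) (auto simp: l_distr m_assoc)
    also have "\<dots> = (\<Oplus>w\<in>W. s \<otimes> (g w \<otimes> f w)) \<oplus> (\<Oplus>w\<in>W. t \<otimes> (r w \<otimes> f w))"
      using that by (intro finsum_addf) auto
    also have "(\<Oplus>w\<in>W. s \<otimes> (g w \<otimes> f w)) = s \<otimes> (\<Oplus>w\<in>W. g w \<otimes> f w)"
      using that insert(1) by (intro finsum_rdistr[symmetric]) auto
    also have "(\<Oplus>w\<in>W. t \<otimes> (r w \<otimes> f w)) = t \<otimes> (\<Oplus>w\<in>W. r w \<otimes> f w)"
      using that insert(1) by (intro finsum_rdistr[symmetric]) auto
    finally show ?thesis .
  qed
  show ?case
  proof (cases "\<exists>r0 r. r0 \<in> A \<and> r0 \<noteq> \<zero> \<and> (\<forall>w. r w \<in> A) \<and> r0 \<otimes> v x = (\<Oplus>w\<in>W. r w \<otimes> v w)")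
    case True
    then obtain r0 r where r0: "r0 \<in> A" "r0 \<noteq> \<zero>" and r: "\<And>w. r w \<in> A"
      and rel: "r0 \<otimes> v x = (\<Oplus>w\<in>W. r w \<otimes> v w)" by blast
    \<comment> \<open>Row x comes from the relation for \<open>v x\<close>, the other rows are
      multiplied by \<open>r0\<close>; column x is filled with zeros.\<close>
    define c' where "c' w u = (if u = x then \<zero> else if w = x then (\<Oplus>w\<in>W. r w \<otimes> c w u)
      else r0 \<otimes> c w u)" for w u
    have c'A: "c' w u \<in> A" for w u
      unfolding c'_def using A c r r0 by (auto intro!: sumA)
    have "(\<Oplus>w\<in>insert x W. g w \<otimes> v w) = \<zero> \<longleftrightarrow> (\<forall>u\<in>insert x W. (\<Oplus>w\<in>insert x W. g w \<otimes> c' w u) = \<zero>)"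
      if g: "\<forall>w. g w \<in> A" for g
    proof -
      have gC: "g w \<in> carrier R" for w using g AC by blast
      have rC: "r w \<in> carrier R" for w using r AC by blast
      have r0C: "r0 \<in> carrier R" using r0 AC by blast
      \<comment> \<open>The coefficients of \<open>r0\<close> times the given combination once
        \<open>v x\<close> has been substituted.\<close>
      define G where "G w = r0 \<otimes> g w \<oplus> g x \<otimes> r w" for w
      have GA: "G w \<in> A" for w unfolding G_def using A g r r0 by auto
      have 1: "r0 \<otimes> (\<Oplus>w\<in>insert x W. g w \<otimes> v w) = (\<Oplus>w\<in>W. G w \<otimes> v w)"
      proof -
        have "r0 \<otimes> (\<Oplus>w\<in>insert x W. g w \<otimes> v w) = r0 \<otimes> (g x \<otimes> v x \<oplus> (\<Oplus>w\<in>W. g w \<otimes> v w))"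
          using insert.prems gC by (subst ins) auto
        also have "\<dots> = g x \<otimes> (r0 \<otimes> v x) \<oplus> r0 \<otimes> (\<Oplus>w\<in>W. g w \<otimes> v w)"
          using gC vx vW r0C sumC[of "\<lambda>w. g w \<otimes> v w"] by (simp add: r_distr m_lcomm)
        also have "\<dots> = r0 \<otimes> (\<Oplus>w\<in>W. g w \<otimes> v w) \<oplus> g x \<otimes> (\<Oplus>w\<in>W. r w \<otimes> v w)"
          unfolding rel using gC rC vW r0C sumC[of "\<lambda>w. g w \<otimes> v w"] sumC[of "\<lambda>w. r w \<otimes> v w"]
          by (simp add: a_comm)
        also have "\<dots> = (\<Oplus>w\<in>W. G w \<otimes> v w)" unfolding G_def
          using gC rC vW r0C by (intro lin_comb[symmetric]) auto
        finally show ?thesis .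
      qed
      have 2: "(\<Oplus>w\<in>insert x W. g w \<otimes> c' w u) = (\<Oplus>w\<in>W. G w \<otimes> c w u)" if u: "u \<in> W" for u
      proof -
        have ux: "u \<noteq> x" using u insert by auto
        have "(\<Oplus>w\<in>insert x W. g w \<otimes> c' w u) = g x \<otimes> c' x u \<oplus> (\<Oplus>w\<in>W. g w \<otimes> c' w u)"
          using gC c'A AC by (intro ins) auto
        also have "(\<Oplus>w\<in>W. g w \<otimes> c' w u) = (\<Oplus>w\<in>W. r0 \<otimes> (g w \<otimes> c w u))"
          using insert(2) gC cC r0C ux by (intro cong) (auto simp: c'_def m_lcomm)
        also have "\<dots> = r0 \<otimes> (\<Oplus>w\<in>W. g w \<otimes> c w u)"
          using gC cC r0C insert(1) by (intro finsum_rdistr[symmetric]) auto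
        also have "g x \<otimes> c' x u = g x \<otimes> (\<Oplus>w\<in>W. r w \<otimes> c w u)" using ux by (simp add: c'_def)
        also have "g x \<otimes> (\<Oplus>w\<in>W. r w \<otimes> c w u) \<oplus> r0 \<otimes> (\<Oplus>w\<in>W. g w \<otimes> c w u)
            = r0 \<otimes> (\<Oplus>w\<in>W. g w \<otimes> c w u) \<oplus> g x \<otimes> (\<Oplus>w\<in>W. r w \<otimes> c w u)"
          using gC cC rC r0C by (intro a_comm m_closed sumC) auto
        also have "\<dots> = (\<Oplus>w\<in>W. G w \<otimes> c w u)" unfolding G_def
          using gC rC cC r0C by (intro lin_comb[symmetric]) auto
        finally show ?thesis .
      qed
      have 3: "(\<Oplus>w\<in>insert x W. g w \<otimes> c' w x) = \<zero>"
        using gC by (subst ins) (auto simp: c'_def)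
      have "(\<Oplus>w\<in>insert x W. g w \<otimes> v w) \<in> carrier R"
        using insert.prems gC by (intro finsum_closed) auto
      then have "(\<Oplus>w\<in>insert x W. g w \<otimes> v w) = \<zero> \<longleftrightarrow> (\<Oplus>w\<in>W. G w \<otimes> v w) = \<zero>"
        unfolding 1[symmetric] using r0 r0C integral_iff by auto
      then show ?thesis using ker[of G] GA 2 3 by auto
    qed
    then show ?thesis using c'A by blast
  next
    case False
    \<comment> \<open>Row x and column x meet in the entry 1 and vanish elsewhere, so column x tests
      \<open>g x\<close> alone.\<close>
    define c' where "c' w u = (if u = x then (if w = x then \<one> else \<zero>)
       else if w = x then \<zero> else c w u)" for w u
    have c'A: "c' w u \<in> A" for w u
      unfolding c'_def using A c by auto
    have "(\<Oplus>w\<in>insert x W. g w \<otimes> v w) = \<zero> \<longleftrightarrow> (\<forall>u\<in>insert x W. (\<Oplus>w\<in>insert x W. g w \<otimes> c' w u) = \<zero>)"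
      if g: "\<forall>w. g w \<in> A" for g
    proof -
      have gC: "g w \<in> carrier R" for w using g AC by blast
      have SC: "(\<Oplus>w\<in>W. g w \<otimes> v w) \<in> carrier R" using gC vW by (intro sumC) auto
      have 1: "(\<Oplus>w\<in>insert x W. g w \<otimes> v w) = g x \<otimes> v x \<oplus> (\<Oplus>w\<in>W. g w \<otimes> v w)"
        using insert.prems gC by (intro ins) auto
      have 2: "(\<Oplus>w\<in>insert x W. g w \<otimes> c' w u) = (\<Oplus>w\<in>W. g w \<otimes> c w u)" if u: "u \<in> W" for u
      proof -
        have ux: "u \<noteq> x" using u insert by auto
        have "(\<Oplus>w\<in>insert x W. g w \<otimes> c' w u) = g x \<otimes> c' x u \<oplus> (\<Oplus>w\<in>W. g w \<otimes> c' w u)"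
          using gC c'A AC by (intro ins) auto
        also have "(\<Oplus>w\<in>W. g w \<otimes> c' w u) = (\<Oplus>w\<in>W. g w \<otimes> c w u)"
          using insert(2) gC cC ux by (intro cong) (auto simp: c'_def)
        finally show ?thesis using ux gC cC sumC[of "\<lambda>w. g w \<otimes> c w u"] by (simp add: c'_def)
      qed
      have 3: "(\<Oplus>w\<in>insert x W. g w \<otimes> c' w x) = g x"
      proof -
        have "(\<Oplus>w\<in>insert x W. g w \<otimes> c' w x) = g x \<otimes> c' x x \<oplus> (\<Oplus>w\<in>W. g w \<otimes> c' w x)"
          using gC c'A AC by (intro ins) auto
        also have "(\<Oplus>w\<in>W. g w \<otimes> c' w x) = (\<Oplus>w\<in>W. \<zero>)"
          using insert(2) gC by (intro cong) (auto simp: c'_def)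
        finally show ?thesis using gC by (simp add: c'_def)
      qed
      have 4: "g x = \<zero>" if "g x \<otimes> v x \<oplus> (\<Oplus>w\<in>W. g w \<otimes> v w) = \<zero>"
      proof (rule ccontr)
        \<comment> \<open>Otherwise \<open>g x\<close> could play the part of \<open>r0\<close> in
          the first case.\<close>
        assume nz: "g x \<noteq> \<zero>"
        have "g x \<otimes> v x = \<ominus> (\<Oplus>w\<in>W. g w \<otimes> v w)"
          using that gC vx SC by (simp add: minus_equality)
        also have "\<dots> = (\<ominus> \<one>) \<otimes> (\<Oplus>w\<in>W. g w \<otimes> v w)" using SC by (simp add: l_minus)
        also have "\<dots> = (\<Oplus>w\<in>W. (\<ominus> \<one>) \<otimes> (g w \<otimes> v w))"
          using gC vW insert(1) by (intro finsum_rdistr) auto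
        also have "\<dots> = (\<Oplus>w\<in>W. (\<ominus> g w) \<otimes> v w)"
          using gC vW by (intro cong) (auto simp: l_minus)
        finally have "\<exists>r. (\<forall>w. r w \<in> A) \<and> g x \<otimes> v x = (\<Oplus>w\<in>W. r w \<otimes> v w)"
          using g A(6) by (intro exI[of _ "\<lambda>w. \<ominus> g w"]) auto
        then show False using False nz g by blast
      qed
      show ?thesis unfolding 1 using 2 3 4 ker[of g] g SC vx by auto
    qed
    then show ?thesis using c'A by blast
  qed
qed

section \<open>Polynomials as coefficient functions, and pseudo-division\<close>

definition ev :: "nat \<Rightarrow> (nat \<Rightarrow> 'a) \<Rightarrow> 'a \<Rightarrow> 'a" where
  "ev n a y = (\<Oplus>j\<in>{..<n}. a j \<otimes> y [^] j)"

lemma ev_0 [simp]: "ev 0 a y = \<zero>"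
  by (simp add: ev_def)

lemma ev_Suc:
  assumes "\<And>j. a j \<in> carrier R" "y \<in> carrier R"
  shows "ev (Suc n) a y = a n \<otimes> y [^] n \<oplus> ev n a y"
  unfolding ev_def lessThan_Suc using assms by (intro finsum_insert) auto

lemma ev_closed [simp, intro]:
  "(\<And>j. a j \<in> carrier R) \<Longrightarrow> y \<in> carrier R \<Longrightarrow> ev n a y \<in> carrier R"
  unfolding ev_def by (intro finsum_closed) auto

lemma ev_cong:
  "(\<And>j. j < n \<Longrightarrow> a j = b j) \<Longrightarrow> (\<And>j. b j \<in> carrier R) \<Longrightarrow> y \<in> carrier R \<Longrightarrow> ev n a y = ev n b y"
  unfolding ev_def by (intro finsum_cong') auto

lemma ev_zero: "(\<And>j. j < n \<Longrightarrow> a j = \<zero>) \<Longrightarrow> y \<in> carrier R \<Longrightarrow> ev n a y = \<zero>"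
  unfolding ev_def by (intro add.finprod_one_eqI) simp

lemma ev_truncate:
  assumes "\<And>j. a j \<in> carrier R" "y \<in> carrier R" "k \<le> n" "\<And>j. k \<le> j \<Longrightarrow> j < n \<Longrightarrow> a j = \<zero>"
  shows "ev n a y = ev k a y"
  using assms(3,4)
proof (induction n rule: dec_induct)
  case (step n)
  then have "ev n a y = ev k a y" "a n = \<zero>" by auto
  then show ?case using assms(1,2) by (simp add: ev_Suc)
qed simp

lemma ev_linear:
  assumes "\<And>j. a j \<in> carrier R" "\<And>j. b j \<in> carrier R" "y \<in> carrier R" "c \<in> carrier R"
  shows "ev n (\<lambda>j. c \<otimes> a j \<ominus> b j) y = c \<otimes> ev n a y \<ominus> ev n b y"
proof (induction n)
  case (Suc n)
  have "ev n a y \<in> carrier R" "ev n b y \<in> carrier R" "y [^] n \<in> carrier R" using assms by auto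
  then have "(c \<otimes> a n \<ominus> b n) \<otimes> y [^] n \<oplus> (c \<otimes> ev n a y \<ominus> ev n b y) =
      c \<otimes> (a n \<otimes> y [^] n \<oplus> ev n a y) \<ominus> (b n \<otimes> y [^] n \<oplus> ev n b y)"
    using assms by algebra
  then show ?case using assms Suc by (simp add: ev_Suc)
qed (use assms in \<open>simp add: minus_eq\<close>)

lemma ev_shift:
  assumes "\<And>j. m j \<in> carrier R" "y \<in> carrier R" "b \<in> carrier R"
  shows "ev (s + k) (\<lambda>j. if s \<le> j then b \<otimes> m (j - s) else \<zero>) y = b \<otimes> y [^] s \<otimes> ev k m y"
proof (induction k)
  case 0
  then show ?case using assms by (simp add: ev_zero)
next
  case (Suc k)
  let ?a = "\<lambda>j. if s \<le> j then b \<otimes> m (j - s) else \<zero>"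
  have c: "ev k m y \<in> carrier R" "y [^] s \<in> carrier R" "y [^] k \<in> carrier R" using assms by auto
  have "ev (s + Suc k) ?a y = b \<otimes> m k \<otimes> y [^] (s + k) \<oplus> ev (s + k) ?a y"
    using assms by (simp add: ev_Suc)
  also have "\<dots> = b \<otimes> m k \<otimes> (y [^] s \<otimes> y [^] k) \<oplus> b \<otimes> y [^] s \<otimes> ev k m y"
    using Suc assms by (simp add: nat_pow_mult)
  also have "\<dots> = b \<otimes> y [^] s \<otimes> (m k \<otimes> y [^] k \<oplus> ev k m y)"
  proof -
    have "m k \<in> carrier R" using assms by blast
    then show ?thesis using assms(2,3) c by algebra
  qed
  finally show ?case using assms by (simp add: ev_Suc)
qed

text \<open>Cancels the coefficient at n after multiplication by the leading coefficient
  \<open>m d\<close>; without division the result stays polynomial in the coefficients of both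
  polynomials.\<close>

definition red_step :: "(nat \<Rightarrow> 'a) \<Rightarrow> nat \<Rightarrow> nat \<Rightarrow> (nat \<Rightarrow> 'a) \<Rightarrow> nat \<Rightarrow> 'a" where
  "red_step m d n a j = m d \<otimes> a j \<ominus> (if n - d \<le> j then a n \<otimes> m (j - (n - d)) else \<zero>)"

text \<open>The step at \<open>d + k\<close> is carried out even where the coefficient is zero
  already: with a fixed number of steps the remainder is a fixed polynomial expression in all
  coefficients.\<close>

primrec pseudo_rem :: "(nat \<Rightarrow> 'a) \<Rightarrow> nat \<Rightarrow> nat \<Rightarrow> (nat \<Rightarrow> 'a) \<Rightarrow> nat \<Rightarrow> 'a" where
  "pseudo_rem m d 0 a = a"
| "pseudo_rem m d (Suc k) a = pseudo_rem m d k (red_step m d (d + k) a)"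

lemma red_step_closed:
  "(\<And>j. m j \<in> carrier R) \<Longrightarrow> (\<And>j. a j \<in> carrier R) \<Longrightarrow> red_step m d n a j \<in> carrier R"
  by (simp add: red_step_def)

lemma ev_red_step:
  assumes m: "\<And>j. m j \<in> carrier R" and a: "\<And>j. a j \<in> carrier R" and y: "y \<in> carrier R" and "d \<le> n"
  shows "ev n (red_step m d n a) y = m d \<otimes> ev (Suc n) a y \<ominus> a n \<otimes> y [^] (n - d) \<otimes> ev (Suc d) m y"
proof -
  have "red_step m d n a n = \<zero>"
    using m a assms(4) by (simp add: red_step_def m_comm minus_eq r_neg)
  then have "ev n (red_step m d n a) y = ev (Suc n) (red_step m d n a) y"
    using ev_Suc[of "red_step m d n a" y n] red_step_closed[OF m a] y by simp
  also have "\<dots> = m d \<otimes> ev (Suc n) a y \<ominus> ev (Suc n) (\<lambda>j. if n - d \<le> j then a n \<otimes> m (j - (n - d)) else \<zero>) y"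
    unfolding red_step_def using m a y by (intro ev_linear) auto
  also have "ev (Suc n) (\<lambda>j. if n - d \<le> j then a n \<otimes> m (j - (n - d)) else \<zero>) y =
      a n \<otimes> y [^] (n - d) \<otimes> ev (Suc d) m y"
    using ev_shift[OF m y a, of "n - d" "Suc d" n] assms(4) by simp
  finally show ?thesis .
qed

end

section \<open>Pairs of a field and a subring\<close>

lemma (in domain) nat_pow_nonzero:
  "x \<in> carrier R \<Longrightarrow> x \<noteq> \<zero> \<Longrightarrow> x [^] (n :: nat) \<noteq> \<zero>"
  by (induction n) (auto simp: integral_iff)

type_synonym word = "(nat + nat) list"

definition letters :: "nat \<Rightarrow> (nat + nat) set" where
  "letters D = Inl ` {..D} \<union> Inr ` {..D}"

definition words :: "nat \<Rightarrow> word set" where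
  "words D = {w. set w \<subseteq> letters D \<and> length w = D}"

lemma finite_words [simp]: "finite (words D)"
  unfolding words_def letters_def by (rule finite_lists_length_eq) simp

lemma letters_mono: "A \<le> B \<Longrightarrow> letters A \<subseteq> letters B"
  by (auto simp: letters_def)

lemma words_append: "u \<in> words A \<Longrightarrow> v \<in> words B \<Longrightarrow> u @ v \<in> words (A + B)"
  using letters_mono[of A "A + B"] letters_mono[of B "A + B"] by (auto simp: words_def)

lemma words_replicate: "replicate D (Inl 0) \<in> words D"
  by (auto simp: words_def letters_def)

text \<open>Words stand for monomials: the letter \<open>Inr k\<close> is the variable \<open>k\<close>, the letter \<open>Inl i\<close> the
  parameter \<open>\<kappa> i\<close>. Since \<open>\<kappa> 0 = 1\<close>, the words of length \<open>D\<close> give all monomials of degree at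
  most \<open>D\<close>.\<close>

locale field_pair = field K for K :: "'u ring" (structure) +
  fixes P :: "'u set" and \<kappa> :: "nat \<Rightarrow> 'u"
  assumes P_carrier: "P \<subseteq> carrier K" and P_zero [simp]: "\<zero> \<in> P" and P_one [simp]: "\<one> \<in> P"
    and P_add [intro, simp]: "x \<in> P \<Longrightarrow> y \<in> P \<Longrightarrow> x \<oplus> y \<in> P"
    and P_mult [intro, simp]: "x \<in> P \<Longrightarrow> y \<in> P \<Longrightarrow> x \<otimes> y \<in> P"
    and P_neg [intro, simp]: "x \<in> P \<Longrightarrow> \<ominus> x \<in> P"
    and \<kappa>_closed [intro, simp]: "\<kappa> i \<in> carrier K" and \<kappa>_0 [simp]: "\<kappa> 0 = \<one>"
    and root_exists: "1 \<le> n \<Longrightarrow> (\<And>i. c i \<in> carrier K) \<Longrightarrow> \<exists>y\<in>carrier K. ev n c y \<oplus> y [^] n = \<zero>"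
begin

lemma P_in_carrier [intro, simp]: "x \<in> P \<Longrightarrow> x \<in> carrier K"
  using P_carrier by blast

definition letter_val :: "(nat \<Rightarrow> 'u) \<Rightarrow> nat + nat \<Rightarrow> 'u" where
  "letter_val e l = (case l of Inl i \<Rightarrow> \<kappa> i | Inr k \<Rightarrow> e k)"

definition mono_val :: "(nat \<Rightarrow> 'u) \<Rightarrow> word \<Rightarrow> 'u" where
  "mono_val e w = foldr (\<lambda>l x. letter_val e l \<otimes> x) w \<one>"

definition lin_comb :: "(nat \<Rightarrow> 'u) \<Rightarrow> nat \<Rightarrow> (word \<Rightarrow> 'u) \<Rightarrow> 'u" where
  "lin_comb e D g = (\<Oplus>w\<in>words D. g w \<otimes> mono_val e w)"

text \<open>The filtration by degree of the ring generated over P by the parameters and e. A level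
  bounds the indices of the letters too, hence has finitely many generators.\<close>

definition mono_span :: "(nat \<Rightarrow> 'u) \<Rightarrow> nat \<Rightarrow> 'u set" where
  "mono_span e D = {lin_comb e D g | g. \<forall>w. g w \<in> P}"

lemma mono_val_Nil [simp]: "mono_val e [] = \<one>"
  and mono_val_Cons [simp]: "mono_val e (l # w) = letter_val e l \<otimes> mono_val e w"
  by (simp_all add: mono_val_def)

section \<open>Calculus of the spans of monomials\<close>

context
  fixes e :: "nat \<Rightarrow> 'u" assumes e: "range e \<subseteq> carrier K"
begin

lemma letter_val_closed [simp]: "letter_val e l \<in> carrier K"
  using e by (auto simp: letter_val_def split: sum.splits)

lemma mono_val_closed [simp]: "mono_val e w \<in> carrier K"
  by (induction w) auto

lemma mono_val_append: "mono_val e (u @ v) = mono_val e u \<otimes> mono_val e v"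
  by (induction u) (auto simp: m_assoc)

lemma mono_val_replicate: "mono_val e (replicate n (Inl 0)) = \<one>"
  by (induction n) (auto simp: letter_val_def)

lemma lin_comb_closed: "(\<And>w. g w \<in> carrier K) \<Longrightarrow> lin_comb e D g \<in> carrier K"
  unfolding lin_comb_def by (intro finsum_closed) auto

lemma lin_comb_add:
  "(\<And>w. g w \<in> carrier K) \<Longrightarrow> (\<And>w. h w \<in> carrier K) \<Longrightarrow>
    lin_comb e D (\<lambda>w. g w \<oplus> h w) = lin_comb e D g \<oplus> lin_comb e D h"
  unfolding lin_comb_def
  by (subst finsum_addf[symmetric]) (auto intro!: finsum_cong' simp: l_distr)

lemma lin_comb_smult:
  "p \<in> carrier K \<Longrightarrow> (\<And>w. g w \<in> carrier K) \<Longrightarrow> lin_comb e D (\<lambda>w. p \<otimes> g w) = p \<otimes> lin_comb e D g"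
  unfolding lin_comb_def
  by (subst finsum_rdistr) (auto intro!: finsum_cong' simp: m_assoc)

lemma lin_comb_single:
  assumes "w0 \<in> words D" "p \<in> carrier K"
  shows "lin_comb e D (\<lambda>w. if w = w0 then p else \<zero>) = p \<otimes> mono_val e w0"
proof -
  have "lin_comb e D (\<lambda>w. if w = w0 then p else \<zero>) =
      (\<Oplus>w\<in>words D. if w0 = w then p \<otimes> mono_val e w else \<zero>)"
    unfolding lin_comb_def using assms by (intro finsum_cong') auto
  also have "\<dots> = p \<otimes> mono_val e w0" using assms by (intro finsum_singleton) auto
  finally show ?thesis .
qed

lemma lin_comb_zero: "lin_comb e D (\<lambda>w. \<zero>) = \<zero>"
  unfolding lin_comb_def by (intro add.finprod_one_eqI) simp

lemma mono_span_carrier: "x \<in> mono_span e D \<Longrightarrow> x \<in> carrier K"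
  unfolding mono_span_def using lin_comb_closed P_in_carrier by auto

lemma mono_span_lin_comb: "(\<And>w. g w \<in> P) \<Longrightarrow> lin_comb e D g \<in> mono_span e D"
  unfolding mono_span_def by auto

lemma mono_span_add [intro]:
  assumes "x \<in> mono_span e D" "y \<in> mono_span e D" shows "x \<oplus> y \<in> mono_span e D"
proof -
  obtain g h where "x = lin_comb e D g" "\<forall>w. g w \<in> P" "y = lin_comb e D h" "\<forall>w. h w \<in> P"
    using assms unfolding mono_span_def by blast
  then show ?thesis using lin_comb_add[of g h D] mono_span_lin_comb[where D = D and g = "\<lambda>w. g w \<oplus> h w"] by auto
qed

lemma mono_span_smult:
  assumes "p \<in> P" "x \<in> mono_span e D" shows "p \<otimes> x \<in> mono_span e D"
proof -
  obtain g where "x = lin_comb e D g" "\<forall>w. g w \<in> P" using assms unfolding mono_span_def by blast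
  then show ?thesis using lin_comb_smult[of p g D] mono_span_lin_comb[where D = D and g = "\<lambda>w. p \<otimes> g w"] assms by auto
qed

lemma mono_span_zero [simp]: "\<zero> \<in> mono_span e D"
  using mono_span_lin_comb[of "\<lambda>w. \<zero>"] lin_comb_zero by simp

lemma mono_span_neg [intro]:
  assumes "x \<in> mono_span e D" shows "\<ominus> x \<in> mono_span e D"
  using mono_span_smult[OF _ assms, of "\<ominus> \<one>"] mono_span_carrier[OF assms] by (simp add: l_minus)

lemma mono_span_mono_val: "w \<in> words D \<Longrightarrow> p \<in> P \<Longrightarrow> p \<otimes> mono_val e w \<in> mono_span e D"
  using lin_comb_single[of w D p] mono_span_lin_comb[where D = D and g = "\<lambda>u. if u = w then p else \<zero>"]
  by (auto split: if_splits)

lemma mono_span_induct: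
  assumes "x \<in> mono_span e D" "Q \<zero>" "\<And>p w. p \<in> P \<Longrightarrow> w \<in> words D \<Longrightarrow> Q (p \<otimes> mono_val e w)"
    "\<And>x y. x \<in> carrier K \<Longrightarrow> y \<in> carrier K \<Longrightarrow> Q x \<Longrightarrow> Q y \<Longrightarrow> Q (x \<oplus> y)"
  shows "Q x"
proof -
  obtain g where g: "x = lin_comb e D g" "\<And>w. g w \<in> P" using assms(1) unfolding mono_span_def by blast
  show ?thesis unfolding g lin_comb_def
    by (rule finsum_induct) (use g assms in auto)
qed

lemma mono_span_mult [intro]:
  assumes x: "x \<in> mono_span e A" and y: "y \<in> mono_span e B" shows "x \<otimes> y \<in> mono_span e (A + B)"
proof (rule mono_span_induct[OF x])
  show "\<zero> \<otimes> y \<in> mono_span e (A + B)" using mono_span_carrier[OF y] by simp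
next
  fix a b assume "a \<in> carrier K" "b \<in> carrier K" "a \<otimes> y \<in> mono_span e (A + B)" "b \<otimes> y \<in> mono_span e (A + B)"
  then show "(a \<oplus> b) \<otimes> y \<in> mono_span e (A + B)" using mono_span_carrier[OF y] by (auto simp: l_distr)
next
  fix p u assume p: "p \<in> P" and u: "u \<in> words A"
  show "p \<otimes> mono_val e u \<otimes> y \<in> mono_span e (A + B)"
  proof (rule mono_span_induct[OF y])
    show "p \<otimes> mono_val e u \<otimes> \<zero> \<in> mono_span e (A + B)" using p by simp
  next
    fix a b assume "a \<in> carrier K" "b \<in> carrier K"
      "p \<otimes> mono_val e u \<otimes> a \<in> mono_span e (A + B)" "p \<otimes> mono_val e u \<otimes> b \<in> mono_span e (A + B)"
    then show "p \<otimes> mono_val e u \<otimes> (a \<oplus> b) \<in> mono_span e (A + B)" using p by (auto simp: r_distr)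
  next
    fix q v assume q: "q \<in> P" and v: "v \<in> words B"
    have "p \<in> carrier K" "q \<in> carrier K" using p q by auto
    then have "p \<otimes> mono_val e u \<otimes> (q \<otimes> mono_val e v) = (p \<otimes> q) \<otimes> mono_val e (u @ v)"
      by (simp add: mono_val_append m_ac)
    then show "p \<otimes> mono_val e u \<otimes> (q \<otimes> mono_val e v) \<in> mono_span e (A + B)"
      using mono_span_mono_val[OF words_append[OF u v], of "p \<otimes> q"] p q by simp
  qed
qed

lemma mono_span_P: "p \<in> P \<Longrightarrow> p \<in> mono_span e D"
  using mono_span_mono_val[OF words_replicate[of D], of p] mono_val_replicate[of D] by simp

lemma mono_span_mono: "x \<in> mono_span e A \<Longrightarrow> A \<le> B \<Longrightarrow> x \<in> mono_span e B"
  using mono_span_mult[OF mono_span_P[OF P_one, of "B - A"], of x A] mono_span_carrier by simp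

lemma mono_span_pow: "x \<in> mono_span e A \<Longrightarrow> x [^] (n :: nat) \<in> mono_span e (n * A)"
proof (induction n)
  case (Suc n)
  then show ?case using mono_span_mult[of "x [^] n" "n * A" x A] by (simp add: add.commute)
qed (simp add: mono_span_P)

lemma mono_span_letter: "l \<in> letters D \<Longrightarrow> D > 0 \<Longrightarrow> letter_val e l \<in> mono_span e D"
proof -
  assume l: "l \<in> letters D" and D: "D > 0"
  have "l # replicate (D - 1) (Inl 0) \<in> words D"
    using l D by (auto simp: words_def letters_def)
  from mono_span_mono_val[OF this P_one] show ?thesis using mono_val_replicate by simp
qed

lemma mono_span_finsum:
  "finite A \<Longrightarrow> (\<And>a. a \<in> A \<Longrightarrow> f a \<in> mono_span e D) \<Longrightarrow> (\<Oplus>a\<in>A. f a) \<in> mono_span e D"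
  by (rule finsum_induct[where Q = "\<lambda>x. x \<in> mono_span e D"]) (auto intro: mono_span_carrier)

lemma red_step_mono_span:
  assumes "\<And>j. a j \<in> mono_span e A" "\<And>j. m j \<in> mono_span e B"
  shows "red_step m d n a j \<in> mono_span e (A + B)"
proof -
  have 1: "m d \<otimes> a j \<in> mono_span e (A + B)" "a n \<otimes> m i \<in> mono_span e (A + B)" for i
    using mono_span_mult[OF assms(2,1), of d j] mono_span_mult[OF assms, of n i] by (simp_all add: add.commute)
  then show ?thesis unfolding red_step_def minus_eq by auto
qed

text \<open>Every step multiplies once by a coefficient of m, at the cost of B levels.\<close>

lemma pseudo_rem_mono_span:
  assumes "\<And>j. m j \<in> mono_span e B"
  shows "(\<And>j. a j \<in> mono_span e A) \<Longrightarrow> pseudo_rem m d k a j \<in> mono_span e (A + k * B)"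
proof (induction k arbitrary: a A)
  case (Suc k)
  then have "pseudo_rem m d k (red_step m d (d + k) a) j \<in> mono_span e (A + B + k * B)"
    by (intro Suc.IH red_step_mono_span assms)
  then show ?case by (simp add: add.assoc)
qed simp

text \<open>The top coefficient of the quotient is recorded as well: in
  \<open>minimal_relation\<close> it certifies that a quotient vanishing at y is a relation of the
  exact degree.\<close>

lemma pseudo_rem_ev:
  assumes m: "\<And>j. m j \<in> mono_span e B"
  shows "(\<And>j. a j \<in> mono_span e A) \<Longrightarrow> \<exists>q. (\<forall>j. q j \<in> mono_span e (A + k * B)) \<and>
    (k > 0 \<longrightarrow> q (k - 1) = m d [^] (k - 1) \<otimes> a (d + k - 1)) \<and>
    (\<forall>y\<in>carrier K. m d [^] k \<otimes> ev (d + k) a y = ev k q y \<otimes> ev (Suc d) m y \<oplus> ev d (pseudo_rem m d k a) y)"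
proof (induction k arbitrary: a A)
  case 0
  have "a j \<in> carrier K" "m j \<in> carrier K" for j using mono_span_carrier[OF 0] mono_span_carrier[OF m] by blast+
  then show ?case by (intro exI[of _ "\<lambda>_. \<zero>"]) auto
next
  case (Suc k)
  let ?r = "red_step m d (d + k) a"
  have aC: "a j \<in> carrier K" and mC: "m j \<in> carrier K" for j
    using mono_span_carrier[OF Suc.prems] mono_span_carrier[OF m] by blast+
  obtain q where q: "\<And>j. q j \<in> mono_span e (A + B + k * B)"
    "\<And>y. y \<in> carrier K \<Longrightarrow> m d [^] k \<otimes> ev (d + k) ?r y = ev k q y \<otimes> ev (Suc d) m y \<oplus> ev d (pseudo_rem m d k ?r) y"
    using Suc.IH[of ?r "A + B", OF red_step_mono_span[OF Suc.prems m]] by blast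
  have qC: "q j \<in> carrier K" for j using mono_span_carrier[OF q(1)] .
  have rC: "pseudo_rem m d k ?r j \<in> carrier K" for j
    by (rule mono_span_carrier[OF pseudo_rem_mono_span[OF m red_step_mono_span[OF Suc.prems m]]])
  \<comment> \<open>The step at \<open>d + k\<close> contributes this top coefficient;
    \<open>m d [^] k\<close> is the factor it collects in the k steps that remain.\<close>
  define q' where "q' j = (if j = k then m d [^] k \<otimes> a (d + k) else q j)" for j
  have q'C: "q' j \<in> carrier K" for j using aC mC qC by (auto simp: q'_def)
  have "m d [^] k \<otimes> a (d + k) \<in> mono_span e (k * B + A)" by (intro mono_span_mult mono_span_pow m Suc.prems)
  then have "m d [^] k \<otimes> a (d + k) \<in> mono_span e (A + Suc k * B)"
    by (rule mono_span_mono) simp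
  then have q'A: "q' j \<in> mono_span e (A + Suc k * B)" for j
    using q(1)[of j] by (auto simp: q'_def add.assoc)
  have "m d [^] Suc k \<otimes> ev (d + Suc k) a y =
      ev (Suc k) q' y \<otimes> ev (Suc d) m y \<oplus> ev d (pseudo_rem m d (Suc k) a) y" if y: "y \<in> carrier K" for y
  proof -
    define E where "E = ev (Suc (d + k)) a y"
    define V where "V = ev (Suc d) m y"
    define Z where "Z = ev d (pseudo_rem m d k ?r) y"
    define Y where "Y = ev k q y"
    define M where "M = m d [^] k"
    define y' where "y' = y [^] k"
    define b where "b = a (d + k)"
    define c where "c = m d"
    have cl: "E \<in> carrier K" "V \<in> carrier K" "Z \<in> carrier K" "Y \<in> carrier K" "M \<in> carrier K"
      "y' \<in> carrier K" "b \<in> carrier K" "c \<in> carrier K"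
      unfolding E_def V_def Z_def Y_def M_def y'_def b_def c_def using y aC mC qC rC by auto
    have "ev k q' y = Y" unfolding q'_def Y_def using y qC by (intro ev_cong) auto
    then have l: "ev (Suc k) q' y = M \<otimes> b \<otimes> y' \<oplus> Y"
    proof -
      have "q' k = M \<otimes> b" by (simp add: q'_def M_def b_def)
      then show ?thesis using ev_Suc[of q' y k] q'C y \<open>ev k q' y = Y\<close> by (simp add: y'_def)
    qed
    have r: "ev (d + k) ?r y = c \<otimes> E \<ominus> b \<otimes> y' \<otimes> V"
      using ev_red_step[OF mC aC y, of d "d + k"] by (simp add: E_def V_def y'_def b_def c_def)
    have "M \<otimes> (c \<otimes> E \<ominus> b \<otimes> y' \<otimes> V) = Y \<otimes> V \<oplus> Z"
      using q(2)[OF y] unfolding r M_def Y_def V_def Z_def .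
    moreover have "M \<otimes> c \<otimes> E = M \<otimes> (c \<otimes> E \<ominus> b \<otimes> y' \<otimes> V) \<oplus> M \<otimes> b \<otimes> y' \<otimes> V"
      using cl by algebra
    ultimately have "M \<otimes> c \<otimes> E = Y \<otimes> V \<oplus> Z \<oplus> M \<otimes> b \<otimes> y' \<otimes> V" by simp
    also have "\<dots> = (M \<otimes> b \<otimes> y' \<oplus> Y) \<otimes> V \<oplus> Z" using cl by algebra
    finally show ?thesis unfolding l by (simp add: M_def c_def E_def V_def Z_def)
  qed
  moreover have "q' (Suc k - 1) = m d [^] (Suc k - 1) \<otimes> a (d + Suc k - 1)" by (simp add: q'_def)
  ultimately show ?case using q'A by (intro exI[of _ q'] conjI allI impI ballI)
qed


section \<open>Algebraic relations of an element over the monomials\<close>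

definition has_relation :: "nat \<Rightarrow> nat \<Rightarrow> 'u \<Rightarrow> bool" where
  "has_relation D d y \<longleftrightarrow> (\<exists>m. (\<forall>j. m j \<in> mono_span e D) \<and> m d \<noteq> \<zero> \<and> ev (Suc d) m y = \<zero>)"

text \<open>Irreducibility with a bound: no polynomial of smaller positive degree over level D
  divides m, up to a power of its own leading coefficient. \<open>Suc d - d'\<close> steps bring a
  polynomial of degree d, which has length \<open>Suc d\<close>, down to length
  \<open>d'\<close>.\<close>

definition irred_upto :: "nat \<Rightarrow> nat \<Rightarrow> (nat \<Rightarrow> 'u) \<Rightarrow> bool" where
  "irred_upto D d m \<longleftrightarrow> (\<forall>d' n. 1 \<le> d' \<and> d' < d \<and> (\<forall>j. n j \<in> mono_span e D) \<and> n d' \<noteq> \<zero> \<longrightarrow>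
     (\<exists>j<d'. pseudo_rem n d' (Suc d - d') m j \<noteq> \<zero>))"

text \<open>Transcendence with a bound: the powers of y up to N are independent over level
  N.\<close>

definition generic :: "nat \<Rightarrow> 'u \<Rightarrow> bool" where
  "generic N y \<longleftrightarrow> (\<forall>a. (\<forall>j. a j \<in> mono_span e N) \<and> ev (Suc N) a y = \<zero> \<longrightarrow> (\<forall>j\<le>N. a j = \<zero>))"

lemma has_relation_mono: "has_relation A d y \<Longrightarrow> A \<le> B \<Longrightarrow> has_relation B d y"
  unfolding has_relation_def using mono_span_mono by blast

lemma not_has_relation_0:
  assumes "y \<in> carrier K"
  shows "\<not> has_relation D 0 y"
proof
  assume "has_relation D 0 y"
  then obtain m where m: "\<And>j. m j \<in> mono_span e D" "m 0 \<noteq> \<zero>" "ev (Suc 0) m y = \<zero>"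
    unfolding has_relation_def by blast
  have "m j \<in> carrier K" for j by (rule mono_span_carrier[OF m(1)])
  then show False using m(2,3) assms by (simp add: ev_Suc)
qed

text \<open>The topmost nonzero coefficient would lead a relation of its own degree. The bound may
  vary with this degree, as \<open>bnd_B\<close> and \<open>bnd_C\<close> do.\<close>

lemma no_relation:
  assumes no: "\<And>d'. d' < d \<Longrightarrow> \<not> has_relation (D d') d' y" and le: "\<And>d'. d' < d \<Longrightarrow> E \<le> D d'"
    and a: "\<And>j. a j \<in> mono_span e E" and y: "y \<in> carrier K" and z: "ev d a y = \<zero>"
  shows "\<forall>j<d. a j = \<zero>"
proof (rule ccontr)
  assume "\<not> (\<forall>j<d. a j = \<zero>)"
  then have ne: "{j. j < d \<and> a j \<noteq> \<zero>} \<noteq> {}" by auto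
  define d' where "d' = Max {j. j < d \<and> a j \<noteq> \<zero>}"
  have d': "d' < d" "a d' \<noteq> \<zero>" using Max_in[OF _ ne] unfolding d'_def by auto
  have "a j = \<zero>" if "Suc d' \<le> j" "j < d" for j
  proof (rule ccontr)
    assume "a j \<noteq> \<zero>"
    then have "j \<le> d'" unfolding d'_def using that by (intro Max_ge) auto
    then show False using that by simp
  qed
  moreover have "a j \<in> carrier K" for j by (rule mono_span_carrier[OF a])
  ultimately have "ev d a y = ev (Suc d') a y" using y d' by (intro ev_truncate) auto
  then have "has_relation E d' y" using z d' a unfolding has_relation_def by auto
  then show False using has_relation_mono le no d' by blast
qed

text \<open>At a root y of m, pseudo-division turns the value of a into that of its remainder, up to
  a power of the nonzero \<open>m d\<close>. The remainder has length d and level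
  \<open>A + (Suc N - d) * B\<close>, and there y has no relation left.\<close>

lemma relation_iff_pseudo_rem:
  assumes m: "\<And>j. m j \<in> mono_span e B" and nz: "m d \<noteq> \<zero>" and my: "ev (Suc d) m y = \<zero>"
    and d: "d \<le> N" and y: "y \<in> carrier K"
    and no: "\<And>d'. d' < d \<Longrightarrow> \<not> has_relation (D d') d' y"
    and le: "\<And>d'. d' < d \<Longrightarrow> A + (Suc N - d) * B \<le> D d'"
    and a: "\<And>j. a j \<in> mono_span e A"
  shows "ev (Suc N) a y = \<zero> \<longleftrightarrow> (\<forall>j<d. pseudo_rem m d (Suc N - d) a j = \<zero>)"
proof -
  let ?k = "Suc N - d"
  have pr: "pseudo_rem m d ?k a j \<in> mono_span e (A + ?k * B)" for j by (rule pseudo_rem_mono_span[OF m a])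
  have aC: "a j \<in> carrier K" and mC: "m j \<in> carrier K" and prC: "pseudo_rem m d ?k a j \<in> carrier K" for j
    using mono_span_carrier[OF a] mono_span_carrier[OF m] mono_span_carrier[OF pr] by blast+
  obtain q where q': "\<forall>j. q j \<in> mono_span e (A + ?k * B)"
    "\<forall>y\<in>carrier K. m d [^] ?k \<otimes> ev (d + ?k) a y =
      ev ?k q y \<otimes> ev (Suc d) m y \<oplus> ev d (pseudo_rem m d ?k a) y"
    using pseudo_rem_ev[where m = m and a = a and A = A and B = B and k = "?k" and d = d, OF m a]
    by (elim exE conjE) (rule that)
  have q: "\<And>j. q j \<in> mono_span e (A + ?k * B)"
    "m d [^] ?k \<otimes> ev (d + ?k) a y = ev ?k q y \<otimes> ev (Suc d) m y \<oplus> ev d (pseudo_rem m d ?k a) y"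
    using q' y by simp_all
  have qC: "q j \<in> carrier K" for j by (rule mono_span_carrier[OF q(1)])
  have "m d [^] ?k \<noteq> \<zero>" using mC nz nat_pow_nonzero by blast
  moreover have "m d [^] ?k \<otimes> ev (Suc N) a y = ev d (pseudo_rem m d ?k a) y"
    using q(2) my d qC prC y by simp
  ultimately have "ev (Suc N) a y = \<zero> \<longleftrightarrow> ev d (pseudo_rem m d ?k a) y = \<zero>"
    using integral_iff[of "m d [^] ?k" "ev (Suc N) a y"] aC mC y by auto
  also have "\<dots> \<longleftrightarrow> (\<forall>j<d. pseudo_rem m d ?k a j = \<zero>)"
  proof
    show "\<forall>j<d. pseudo_rem m d ?k a j = \<zero>" if "ev d (pseudo_rem m d ?k a) y = \<zero>"
      using no le pr y that by (rule no_relation)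
    show "ev d (pseudo_rem m d ?k a) y = \<zero>" if "\<forall>j<d. pseudo_rem m d ?k a j = \<zero>"
      using that y by (intro ev_zero) auto
  qed
  finally show ?thesis .
qed

end

text \<open>The coefficient bounds of the elimination step: \<open>bnd_B N d\<close> for the minimal relation, of
  degree \<open>d\<close>, of an element over the monomials, and \<open>bnd_C N d d'\<close> for the relations of degree
  \<open>d' < d\<close> that it has to be compared with.\<close>

definition bnd_h :: "nat \<Rightarrow> nat \<Rightarrow> nat" where
  "bnd_h N t = (N + 2) * t + N"

definition bnd_B :: "nat \<Rightarrow> nat \<Rightarrow> nat" where
  "bnd_B N d = (bnd_h N ^^ ((N + 1) * (N - d))) N"

definition bnd_C :: "nat \<Rightarrow> nat \<Rightarrow> nat \<Rightarrow> nat" where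
  "bnd_C N d d' = (bnd_h N ^^ (d - d')) (bnd_B N d)"

lemma bnd_h_iter_mono:
  assumes "i \<le> j" shows "(bnd_h N ^^ i) t \<le> (bnd_h N ^^ j) t"
  using assms
proof (induction j rule: dec_induct)
  case (step j)
  have "(bnd_h N ^^ j) t \<le> (bnd_h N ^^ Suc j) t" by (simp add: bnd_h_def)
  with step show ?case by simp
qed simp

lemma bnd_B_ge: "N \<le> bnd_B N d"
  unfolding bnd_B_def using bnd_h_iter_mono[of 0 _ N N] by simp

lemma bnd_C_antimono: "d' \<le> d'' \<Longrightarrow> bnd_C N d d'' \<le> bnd_C N d d'"
  unfolding bnd_C_def by (intro bnd_h_iter_mono) auto

lemma bnd_C_ge: "bnd_B N d \<le> bnd_C N d d'"
  unfolding bnd_C_def using bnd_h_iter_mono[of 0 _ N "bnd_B N d"] by simp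

lemma bnd_C_step:
  assumes "1 \<le> d'" "d' \<le> d" shows "bnd_h N (bnd_C N d d') = bnd_C N d (d' - 1)"
proof -
  have "d - (d' - 1) = Suc (d - d')" using assms by simp
  then show ?thesis by (simp add: bnd_C_def)
qed

lemma bnd_C_self: "bnd_C N d d = bnd_B N d"
  by (simp add: bnd_C_def)

text \<open>Reason for the exponent in \<open>bnd_B\<close>: passing to a smaller degree grants at
  least N + 1 further applications of \<open>bnd_h\<close>, enough for the d steps of
  \<open>bnd_C\<close> and one more pseudo-division.\<close>

lemma bnd_C_le_B:
  assumes "1 \<le> d" "d \<le> N" "d' < d"
  shows "bnd_h N (bnd_C N d 0) \<le> bnd_B N d'"
proof -
  have "bnd_h N (bnd_C N d 0) = (bnd_h N ^^ (d + 1 + (N + 1) * (N - d))) N"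
    by (simp add: bnd_C_def bnd_B_def funpow_add)
  also have "\<dots> \<le> bnd_B N d'"
  proof -
    have "d + 1 + (N + 1) * (N - d) \<le> (N + 1) + (N + 1) * (N - d)" using assms by simp
    also have "\<dots> = (N + 1) * Suc (N - d)" by simp
    also have "\<dots> \<le> (N + 1) * (N - d')" using assms by (intro mult_le_mono) auto
    finally show ?thesis unfolding bnd_B_def by (rule bnd_h_iter_mono)
  qed
  finally show ?thesis .
qed

lemma bnd_h_mono: "s \<le> t \<Longrightarrow> bnd_h N s \<le> bnd_h N t"
  unfolding bnd_h_def by (intro add_mono mult_le_mono2) auto

text \<open>Reason for the shape of \<open>bnd_h\<close>: a pseudo-division takes at most N + 1
  steps that add level t each, and it starts from a level of at most t or from N.\<close>

lemma bnd_h_ge: "k \<le> N + 1 \<Longrightarrow> s \<le> t \<Longrightarrow> s + k * t \<le> bnd_h N t"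
  "k \<le> N + 1 \<Longrightarrow> N + k * t \<le> bnd_h N t"
proof -
  assume k: "k \<le> N + 1"
  have "k * t \<le> (N + 1) * t" using k by (rule mult_le_mono1)
  then show "s \<le> t \<Longrightarrow> s + k * t \<le> bnd_h N t" "N + k * t \<le> bnd_h N t" by (simp_all add: bnd_h_def)
qed

section \<open>Bounded minimal polynomials of non-generic elements\<close>

context
  fixes e :: "nat \<Rightarrow> 'u" assumes e: "range e \<subseteq> carrier K"
begin

text \<open>Take the least d with a relation of level \<open>bnd_B N d\<close>. As
  \<open>bnd_B\<close> is much larger for smaller degrees, minimality excludes whatever
  pseudo-division can produce: if a bounded factor of m existed, it or the quotient would vanish at
  y, and either is a relation of smaller degree.\<close>

lemma minimal_relation:
  assumes y: "y \<in> carrier K" and ng: "\<not> generic e N y"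
  shows "\<exists>d m. 1 \<le> d \<and> d \<le> N \<and> (\<forall>j. m j \<in> mono_span e (bnd_B N d)) \<and> m d \<noteq> \<zero> \<and>
    irred_upto e (bnd_C N d 0) d m \<and>
    (\<forall>a. (\<forall>j. a j \<in> mono_span e N) \<longrightarrow>
      (ev (Suc N) a y = \<zero> \<longleftrightarrow> (\<forall>j<d. pseudo_rem m d (Suc N - d) a j = \<zero>)))"
proof -
  obtain a where a: "\<And>j. a j \<in> mono_span e N" "ev (Suc N) a y = \<zero>" "\<not> (\<forall>j<Suc N. a j = \<zero>)"
    using ng unfolding generic_def[OF e] by (auto simp: less_Suc_eq_le)
  \<comment> \<open>The polynomial that contradicts genericity has level N, which is below every
    \<open>bnd_B N d\<close>.\<close>
  have "\<exists>d<Suc N. has_relation e (bnd_B N d) d y"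
    using no_relation[OF e, where d = "Suc N" and D = "bnd_B N" and y = y and E = N and a = a] bnd_B_ge a y by blast
  then obtain d0 where "d0 \<le> N" "has_relation e (bnd_B N d0) d0 y" by (auto simp: less_Suc_eq_le)
  define d where "d = (LEAST d. has_relation e (bnd_B N d) d y)"
  have rd: "has_relation e (bnd_B N d) d y" unfolding d_def by (rule LeastI) fact
  have no: "\<not> has_relation e (bnd_B N d') d' y" if "d' < d" for d'
    using that not_less_Least unfolding d_def by blast
  have "d \<le> d0" unfolding d_def by (rule Least_le) fact
  then have dN: "d \<le> N" using \<open>d0 \<le> N\<close> by simp
  have d1: "1 \<le> d" using rd not_has_relation_0[OF e y] by (cases d) auto
  obtain m where m: "\<And>j. m j \<in> mono_span e (bnd_B N d)" "m d \<noteq> \<zero>" "ev (Suc d) m y = \<zero>"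
    using rd unfolding has_relation_def[OF e] by blast
  have mC: "m j \<in> carrier K" for j by (rule mono_span_carrier[OF e m(1)])
  have "irred_upto e (bnd_C N d 0) d m"
    unfolding irred_upto_def[OF e]
  proof (intro allI impI)
    fix d' n assume n: "1 \<le> d' \<and> d' < d \<and> (\<forall>j. n j \<in> mono_span e (bnd_C N d 0)) \<and> n d' \<noteq> \<zero>"
    let ?k = "Suc d - d'"
    show "\<exists>j<d'. pseudo_rem n d' ?k m j \<noteq> \<zero>"
    proof (rule ccontr)
      assume "\<not> (\<exists>j<d'. pseudo_rem n d' ?k m j \<noteq> \<zero>)"
      then have pz: "ev d' (pseudo_rem n d' ?k m) y = \<zero>" using y by (intro ev_zero) auto
      have nS: "n j \<in> mono_span e (bnd_C N d 0)" for j using n by blast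
      have nC: "n j \<in> carrier K" for j by (rule mono_span_carrier[OF e nS])
      obtain q where q': "\<forall>j. q j \<in> mono_span e (bnd_B N d + ?k * bnd_C N d 0)"
        "?k > 0 \<longrightarrow> q (?k - 1) = n d' [^] (?k - 1) \<otimes> m (d' + ?k - 1)"
        "\<forall>y\<in>carrier K. n d' [^] ?k \<otimes> ev (d' + ?k) m y =
          ev ?k q y \<otimes> ev (Suc d') n y \<oplus> ev d' (pseudo_rem n d' ?k m) y"
        using pseudo_rem_ev[OF e, where m = n and a = m and A = "bnd_B N d" and B = "bnd_C N d 0"
            and k = "?k" and d = d', OF nS m(1)]
        by (elim exE conjE) (rule that)
      have q: "\<And>j. q j \<in> mono_span e (bnd_B N d + ?k * bnd_C N d 0)"
        "q (?k - 1) = n d' [^] (?k - 1) \<otimes> m (d' + ?k - 1)"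
        "n d' [^] ?k \<otimes> ev (d' + ?k) m y = ev ?k q y \<otimes> ev (Suc d') n y \<oplus> ev d' (pseudo_rem n d' ?k m) y"
        using q' y n by simp_all
      have qC: "q j \<in> carrier K" for j by (rule mono_span_carrier[OF e q(1)])
      have eC: "ev ?k q y \<in> carrier K" "ev (Suc d') n y \<in> carrier K" using qC nC y by auto
      \<comment> \<open>The remainder vanishes, so at y the product of the divisor and the quotient
        is zero.\<close>
      have "d' + ?k = Suc d" using n by simp
      then have "ev ?k q y \<otimes> ev (Suc d') n y = \<zero>"
        using q(3) pz m(3) eC nC by simp
      then have "ev ?k q y = \<zero> \<or> ev (Suc d') n y = \<zero>" using eC integral by blast
      then show False
      proof
        assume "ev (Suc d') n y = \<zero>"
        then have "has_relation e (bnd_C N d 0) d' y" using n unfolding has_relation_def[OF e] by blast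
        moreover have "bnd_C N d 0 \<le> bnd_B N d'"
          using bnd_C_le_B[OF d1 dN, of d'] n by (simp add: bnd_h_def)
        ultimately show False using has_relation_mono[OF e] no n by blast
      next
        assume ez: "ev ?k q y = \<zero>"
        \<comment> \<open>The quotient has top index \<open>d - d'\<close>, below d since
          \<open>d'\<close> is at least 1, and its top coefficient is a product of nonzero
          elements.\<close>
        have k: "?k = Suc (d - d')" "d' + ?k - 1 = d" using n by auto
        have "n d' [^] (d - d') \<noteq> \<zero>" using nC n nat_pow_nonzero by blast
        then have "q (d - d') \<noteq> \<zero>" using q(2) k nC mC m(2) integral_iff by auto
        then have "has_relation e (bnd_B N d + ?k * bnd_C N d 0) (d - d') y"
          using ez q(1) unfolding has_relation_def[OF e] k by blast
        moreover have "bnd_B N d + ?k * bnd_C N d 0 \<le> bnd_h N (bnd_C N d 0)"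
          using dN n by (intro bnd_h_ge bnd_C_ge) auto
        moreover have "bnd_h N (bnd_C N d 0) \<le> bnd_B N (d - d')"
          using n by (intro bnd_C_le_B[OF d1 dN]) auto
        ultimately show False using has_relation_mono[OF e] no[of "d - d'"] n by auto
      qed
    qed
  qed
  moreover have "ev (Suc N) b y = \<zero> \<longleftrightarrow> (\<forall>j<d. pseudo_rem m d (Suc N - d) b j = \<zero>)"
    if "\<forall>j. b j \<in> mono_span e N" for b
  proof (rule relation_iff_pseudo_rem[OF e m dN y no])
    show "N + (Suc N - d) * bnd_B N d \<le> bnd_B N d'" if "d' < d" for d'
    proof -
      have "N + (Suc N - d) * bnd_B N d \<le> bnd_h N (bnd_B N d)" by (rule bnd_h_ge) simp
      also have "\<dots> \<le> bnd_h N (bnd_C N d 0)" using bnd_C_ge[of N d 0]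
        by (intro bnd_h_mono)
      also have "\<dots> \<le> bnd_B N d'" by (rule bnd_C_le_B[OF d1 dN that])
      finally show ?thesis .
    qed
  qed (use that in auto)
  ultimately show ?thesis using d1 dN m by blast
qed

text \<open>Any root of m will do. Going up in \<open>d'\<close>, a first relation of degree
  \<open>d'\<close> would pseudo-divide m and contradict \<open>irred_upto\<close>. To see this, the
  smaller degrees must be excluded up to the level of the remainder, which is why
  \<open>bnd_C\<close> increases as \<open>d'\<close> decreases.\<close>

lemma root_of_irreducible:
  assumes d1: "1 \<le> d" and dN: "d \<le> N" and m: "\<And>j. m j \<in> mono_span e (bnd_B N d)" "m d \<noteq> \<zero>"
    and irred_upto: "irred_upto e (bnd_C N d 0) d m"
  shows "\<exists>y\<in>carrier K. \<forall>a. (\<forall>j. a j \<in> mono_span e N) \<longrightarrow>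
      (ev (Suc N) a y = \<zero> \<longleftrightarrow> (\<forall>j<d. pseudo_rem m d (Suc N - d) a j = \<zero>))"
proof -
  have mC: "m j \<in> carrier K" for j by (rule mono_span_carrier[OF e m(1)])
  have u: "m d \<in> Units K" using mC m(2) by (simp add: field_Units)
  \<comment> \<open>\<open>root_exists\<close> is about monic polynomials.\<close>
  define c where "c i = inv (m d) \<otimes> m i" for i
  have cC: "c i \<in> carrier K" for i using mC u by (simp add: c_def)
  obtain y where y: "y \<in> carrier K" "ev d c y \<oplus> y [^] d = \<zero>" using root_exists[where c = c, OF d1 cC] by (elim bexE) (rule that)
  have mc: "m i = m d \<otimes> c i \<ominus> \<zero>" for i
  proof -
    have "m d \<otimes> c i = (m d \<otimes> inv (m d)) \<otimes> m i"
      unfolding c_def using mC u by (intro m_assoc[symmetric]) auto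
    then show ?thesis using mC u by (simp add: minus_eq)
  qed
  have "ev d m y = ev d (\<lambda>i. m d \<otimes> c i \<ominus> \<zero>) y" by (intro ev_cong mc) (use mC cC y in auto)
  also have "\<dots> = m d \<otimes> ev d c y \<ominus> ev d (\<lambda>_. \<zero>) y" using mC cC y by (intro ev_linear) auto
  also have "ev d (\<lambda>_. \<zero>) y = \<zero>" using y by (intro ev_zero) auto
  finally have "ev (Suc d) m y = m d \<otimes> y [^] d \<oplus> m d \<otimes> ev d c y"
    using mC cC y by (simp add: ev_Suc minus_eq)
  also have "\<dots> = m d \<otimes> (y [^] d \<oplus> ev d c y)" using mC cC y by (intro r_distr[symmetric]) auto
  also have "y [^] d \<oplus> ev d c y = \<zero>" using y cC by (simp add: a_comm)
  finally have my: "ev (Suc d) m y = \<zero>" using mC by simp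
  have no: "\<not> has_relation e (bnd_C N d d') d' y" if "d' < d" for d'
    using that
  proof (induction d' rule: less_induct)
    case (less d')
    show ?case
    proof
      assume r: "has_relation e (bnd_C N d d') d' y"
      then obtain n where n: "\<And>j. n j \<in> mono_span e (bnd_C N d d')" "n d' \<noteq> \<zero>" "ev (Suc d') n y = \<zero>"
        unfolding has_relation_def[OF e] by blast
      have d'1: "1 \<le> d'" using r not_has_relation_0[OF e y(1)] by (cases d') auto
      \<comment> \<open>The remainder criterion is applied to m itself, with the supposed relation n
        as divisor.\<close>
      have "ev (Suc d) m y = \<zero> \<longleftrightarrow> (\<forall>j<d'. pseudo_rem n d' (Suc d - d') m j = \<zero>)"
      proof (rule relation_iff_pseudo_rem[OF e n _ y(1)])
        show "\<not> has_relation e (bnd_C N d d'') d'' y" if "d'' < d'" for d''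
          using less that by simp
        show "bnd_B N d + (Suc d - d') * bnd_C N d d' \<le> bnd_C N d d''" if "d'' < d'" for d''
        proof -
          have "bnd_B N d + (Suc d - d') * bnd_C N d d' \<le> bnd_h N (bnd_C N d d')"
            using dN d'1 by (intro bnd_h_ge bnd_C_ge) auto
          also have "\<dots> = bnd_C N d (d' - 1)" using d'1 less.prems by (intro bnd_C_step) auto
          also have "\<dots> \<le> bnd_C N d d''" using that by (intro bnd_C_antimono) auto
          finally show ?thesis .
        qed
      qed (use less.prems m in auto)
      then have "\<forall>j<d'. pseudo_rem n d' (Suc d - d') m j = \<zero>" using my by blast
      moreover have "n j \<in> mono_span e (bnd_C N d 0)" for j
        using mono_span_mono[OF e n(1)] bnd_C_antimono by blast
      ultimately show False using irred_upto d'1 less.prems n(2) unfolding irred_upto_def[OF e] by blast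
    qed
  qed
  have "ev (Suc N) a y = \<zero> \<longleftrightarrow> (\<forall>j<d. pseudo_rem m d (Suc N - d) a j = \<zero>)"
    if "\<forall>j. a j \<in> mono_span e N" for a
  proof (rule relation_iff_pseudo_rem[OF e m my dN y(1) no])
    show "N + (Suc N - d) * bnd_B N d \<le> bnd_C N d d'" if "d' < d" for d'
    proof -
      have "N + (Suc N - d) * bnd_B N d \<le> bnd_h N (bnd_C N d d)"
        unfolding bnd_C_self by (rule bnd_h_ge) simp
      also have "\<dots> = bnd_C N d (d - 1)" using d1 by (intro bnd_C_step) auto
      also have "\<dots> \<le> bnd_C N d d'" using that by (intro bnd_C_antimono) auto
      finally show ?thesis .
    qed
  qed (use that in auto)
  then show ?thesis using y(1) by blast
qed

end

end

section \<open>Polynomial functions and relation matrices\<close>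

context field_pair
begin

text \<open>Integer polynomials with constants from C, taken as functions: \<open>polyf_cong\<close>
  identifies those that agree on K, so ring identities may be applied freely. With C empty such a
  function preserves P and, on P, is given by a term.\<close>

inductive polyf :: "'u set \<Rightarrow> (('j \<Rightarrow> 'u) \<Rightarrow> 'u) \<Rightarrow> bool" for C :: "'u set" where
  polyf_zero [intro, simp]: "polyf C (\<lambda>z. \<zero>)"
| polyf_one [intro, simp]: "polyf C (\<lambda>z. \<one>)"
| polyf_const: "x \<in> C \<Longrightarrow> polyf C (\<lambda>z. x)"
| polyf_var [intro, simp]: "polyf C (\<lambda>z. z j)"
| polyf_add [intro]: "polyf C F \<Longrightarrow> polyf C G \<Longrightarrow> polyf C (\<lambda>z. F z \<oplus> G z)"
| polyf_mult [intro]: "polyf C F \<Longrightarrow> polyf C G \<Longrightarrow> polyf C (\<lambda>z. F z \<otimes> G z)"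
| polyf_neg [intro]: "polyf C F \<Longrightarrow> polyf C (\<lambda>z. \<ominus> F z)"
| polyf_cong: "polyf C F \<Longrightarrow> (\<And>z. range z \<subseteq> carrier K \<Longrightarrow> F z = G z) \<Longrightarrow> polyf C G"

lemma polyf_closed:
  "polyf C F \<Longrightarrow> C \<subseteq> carrier K \<Longrightarrow> range z \<subseteq> carrier K \<Longrightarrow> F z \<in> carrier K"
  by (induction rule: polyf.induct) (auto simp: image_subset_iff)

lemma polyf_P: "polyf {} F \<Longrightarrow> range z \<subseteq> P \<Longrightarrow> F z \<in> P"
proof (induction rule: polyf.induct)
  case (polyf_cong F G)
  then have "range z \<subseteq> carrier K" using P_carrier by blast
  then show ?case using polyf_cong by metis
qed (auto simp: image_subset_iff)

lemma polyf_minus [intro]: "polyf C F \<Longrightarrow> polyf C G \<Longrightarrow> polyf C (\<lambda>z. F z \<ominus> G z)"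
  unfolding minus_eq by (intro polyf_add polyf_neg)

lemma polyf_if [intro]: "(b \<Longrightarrow> polyf C F) \<Longrightarrow> (\<not> b \<Longrightarrow> polyf C G) \<Longrightarrow> polyf C (\<lambda>z. if b then F z else G z)"
  by (cases b) auto

lemma polyf_finsum:
  fixes F :: "'a \<Rightarrow> ('j \<Rightarrow> 'u) \<Rightarrow> 'u"
  assumes "finite A" "C \<subseteq> carrier K" "\<And>a. a \<in> A \<Longrightarrow> polyf C (F a)"
  shows "polyf C (\<lambda>z. \<Oplus>a\<in>A. F a z)"
  using assms(1,3)
proof (induction A)
  case (insert a A)
  then have "polyf C (\<lambda>z. F a z \<oplus> (\<Oplus>a\<in>A. F a z))" by auto
  then show ?case
  proof (rule polyf_cong)
    fix z :: "'j \<Rightarrow> 'u" assume z: "range z \<subseteq> carrier K"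
    have "F b z \<in> carrier K" if "b \<in> insert a A" for b
      using insert.prems[OF that] assms(2) z by (rule polyf_closed)
    then show "F a z \<oplus> (\<Oplus>a\<in>A. F a z) = (\<Oplus>a\<in>insert a A. F a z)"
      using insert.hyps by (intro finsum_insert[symmetric]) auto
  qed
qed simp

lemma polyf_comp:
  fixes G :: "'j \<Rightarrow> ('i \<Rightarrow> 'u) \<Rightarrow> 'u"
  assumes F: "polyf C F" and C: "C \<subseteq> carrier K" and G: "\<And>j. polyf C (G j)"
  shows "polyf C (\<lambda>z. F (\<lambda>j. G j z))"
  using F
proof (induction rule: polyf.induct)
  case (polyf_cong F F')
  show ?case
  proof (rule polyf.polyf_cong[OF polyf_cong.IH])
    fix z :: "'i \<Rightarrow> 'u" assume z: "range z \<subseteq> carrier K"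
    have "range (\<lambda>j. G j z) \<subseteq> carrier K" using polyf_closed[OF G C z] by auto
    then show "F (\<lambda>j. G j z) = F' (\<lambda>j. G j z)" by (rule polyf_cong.hyps)
  qed
qed (use G in \<open>auto intro: polyf.intros(1-7)\<close>)

lemma polyf_mono_val:
  assumes "range \<kappa> \<subseteq> C" "\<And>k. polyf C (\<lambda>z. E z k)"
  shows "polyf C (\<lambda>z. mono_val (E z) w)"
proof (induction w)
  case (Cons l w)
  have "polyf C (\<lambda>z. letter_val (E z) l)"
    using assms by (cases l) (auto simp: letter_val_def intro: polyf_const)
  then show ?case using Cons by auto
qed simp

lemma polyf_lin_comb:
  assumes "range \<kappa> \<subseteq> C" "C \<subseteq> carrier K" "\<And>k. polyf C (\<lambda>z. E z k)" "\<And>w. polyf C (\<lambda>z. g z w)"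
  shows "polyf C (\<lambda>z. lin_comb (E z) D (g z))"
  unfolding lin_comb_def using assms by (intro polyf_finsum polyf_mult polyf_mono_val) auto

lemma polyf_pseudo_rem:
  assumes m: "\<And>j. polyf C (\<lambda>z. m z j)"
  shows "(\<And>j. polyf C (\<lambda>z. a z j)) \<Longrightarrow> polyf C (\<lambda>z. pseudo_rem (m z) d k (a z) j)"
proof (induction k arbitrary: a)
  case (Suc k)
  have "polyf C (\<lambda>z. red_step (m z) d (d + k) (a z) j)" for j
    unfolding red_step_def
    by (intro polyf_minus polyf_mult polyf_if polyf_zero m Suc.prems)
  from Suc.IH[OF this] show ?case by simp
qed simp

text \<open>A presentation of the relations, not a canonical one: whatever is read off from c must
  have the same value for every such matrix.\<close>

definition relation_matrix :: "(nat \<Rightarrow> 'u) \<Rightarrow> nat \<Rightarrow> (word \<times> word \<Rightarrow> 'u) \<Rightarrow> bool" where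
  "relation_matrix e N c \<longleftrightarrow> (\<forall>g. range g \<subseteq> P \<longrightarrow>
     (lin_comb e N g = \<zero> \<longleftrightarrow> (\<forall>u\<in>words N. (\<Oplus>w\<in>words N. g w \<otimes> c (w, u)) = \<zero>)))"

lemma relation_matrix_exists:
  assumes "range e \<subseteq> carrier K"
  shows "\<exists>c. range c \<subseteq> P \<and> relation_matrix e N c"
proof -
  have "\<exists>c. (\<forall>w u. c w u \<in> P) \<and> (\<forall>g. (\<forall>w. g w \<in> P) \<longrightarrow>
    ((\<Oplus>w\<in>words N. g w \<otimes> mono_val e w) = \<zero> \<longleftrightarrow> (\<forall>u\<in>words N. (\<Oplus>w\<in>words N. g w \<otimes> c w u) = \<zero>)))"
    by (rule kernel_matrix) (use P_carrier mono_val_closed[OF assms] in auto)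
  then obtain c where "\<forall>w u. c w u \<in> P" "\<forall>g. (\<forall>w. g w \<in> P) \<longrightarrow>
    ((\<Oplus>w\<in>words N. g w \<otimes> mono_val e w) = \<zero> \<longleftrightarrow> (\<forall>u\<in>words N. (\<Oplus>w\<in>words N. g w \<otimes> c w u) = \<zero>))"
    by blast
  then show ?thesis
    by (intro exI[of _ "\<lambda>(w, u). c w u"]) (auto simp: relation_matrix_def lin_comb_def image_subset_iff)
qed

text \<open>Indices \<open>Inl\<close> are entries of the tuple from K, indices \<open>Inr\<close>
  are variables for P. Sorted by monomials in the former, F has coefficients that are integer
  polynomials in the latter; their values lie in P, so a zero of F is a P-linear relation.\<close>

definition word_form :: "nat \<Rightarrow> ((nat + 'i \<Rightarrow> 'u) \<Rightarrow> 'u) \<Rightarrow> bool" where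
  "word_form N F \<longleftrightarrow> (\<exists>\<tau>. (\<forall>w. polyf {} (\<tau> w)) \<and>
     (\<forall>z. range z \<subseteq> carrier K \<longrightarrow> F z = lin_comb (z \<circ> Inl) N (\<lambda>w. \<tau> w (z \<circ> Inr))))"

lemma word_form_cong:
  "word_form N F \<Longrightarrow> (\<And>z. range z \<subseteq> carrier K \<Longrightarrow> F z = G z) \<Longrightarrow> word_form N G"
proof -
  assume F: "word_form N F" and eq: "\<And>z. range z \<subseteq> carrier K \<Longrightarrow> F z = G z"
  obtain \<tau> where "\<And>w. polyf {} (\<tau> w)"
    "\<And>z. range z \<subseteq> carrier K \<Longrightarrow> F z = lin_comb (z \<circ> Inl) N (\<lambda>w. \<tau> w (z \<circ> Inr))"
    using F unfolding word_form_def by blast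
  then show ?thesis unfolding word_form_def using eq by (intro exI[of _ \<tau>]) simp
qed

lemma word_form_single:
  assumes "polyf {} t" "w \<in> words N"
  shows "word_form N (\<lambda>z. t (z \<circ> Inr) \<otimes> mono_val (z \<circ> Inl) w)"
  unfolding word_form_def
proof (intro exI[of _ "\<lambda>u q. if u = w then t q else \<zero>"] conjI allI impI)
  fix z :: "nat + 'a \<Rightarrow> 'u" assume z: "range z \<subseteq> carrier K"
  have 1: "range (z \<circ> Inl) \<subseteq> carrier K" and 2: "range (z \<circ> Inr) \<subseteq> carrier K" using z by auto
  have "t (z \<circ> Inr) \<in> carrier K" using polyf_closed[OF assms(1) _ 2] by simp
  then show "t (z \<circ> Inr) \<otimes> mono_val (z \<circ> Inl) w =
      lin_comb (z \<circ> Inl) N (\<lambda>u. if u = w then t (z \<circ> Inr) else \<zero>)"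
    using lin_comb_single[OF 1 assms(2)] by simp
qed (use assms in auto)

lemma word_form_zero: "word_form N (\<lambda>z. \<zero>)"
  unfolding word_form_def by (intro exI[of _ "\<lambda>w q. \<zero>"]) (auto simp: lin_comb_zero image_subset_iff)

lemma word_form_add:
  assumes "word_form N F" "word_form N G"
  shows "word_form N (\<lambda>z. F z \<oplus> G z)"
proof -
  obtain \<tau> \<sigma> where \<tau>: "\<And>w. polyf {} (\<tau> w)"
      "\<And>z. range z \<subseteq> carrier K \<Longrightarrow> F z = lin_comb (z \<circ> Inl) N (\<lambda>w. \<tau> w (z \<circ> Inr))"
    and \<sigma>: "\<And>w. polyf {} (\<sigma> w)"
      "\<And>z. range z \<subseteq> carrier K \<Longrightarrow> G z = lin_comb (z \<circ> Inl) N (\<lambda>w. \<sigma> w (z \<circ> Inr))"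
    using assms unfolding word_form_def by blast
  have "F z \<oplus> G z = lin_comb (z \<circ> Inl) N (\<lambda>w. \<tau> w (z \<circ> Inr) \<oplus> \<sigma> w (z \<circ> Inr))"
    if z: "range z \<subseteq> carrier K" for z
  proof -
    have 1: "range (z \<circ> Inl) \<subseteq> carrier K" and 2: "range (z \<circ> Inr) \<subseteq> carrier K" using z by auto
    have "\<tau> w (z \<circ> Inr) \<in> carrier K" "\<sigma> w (z \<circ> Inr) \<in> carrier K" for w
      using polyf_closed[OF \<tau>(1) _ 2] polyf_closed[OF \<sigma>(1) _ 2] by auto
    then show ?thesis using lin_comb_add[OF 1] \<tau>(2)[OF z] \<sigma>(2)[OF z] by simp
  qed
  then show ?thesis unfolding word_form_def
    by (intro exI[of _ "\<lambda>w q. \<tau> w q \<oplus> \<sigma> w q"]) (use \<tau> \<sigma> in auto)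
qed

lemma word_form_closed:
  assumes "word_form N F" "range z \<subseteq> carrier K" shows "F z \<in> carrier K"
proof -
  obtain \<tau> where \<tau>: "\<And>w. polyf {} (\<tau> w)"
      "\<And>z. range z \<subseteq> carrier K \<Longrightarrow> F z = lin_comb (z \<circ> Inl) N (\<lambda>w. \<tau> w (z \<circ> Inr))"
    using assms(1) unfolding word_form_def by blast
  have 1: "range (z \<circ> Inl) \<subseteq> carrier K" and 2: "range (z \<circ> Inr) \<subseteq> carrier K" using assms(2) by auto
  show ?thesis unfolding \<tau>(2)[OF assms(2)]
    using polyf_closed[OF \<tau>(1) _ 2] by (intro lin_comb_closed[OF 1]) auto
qed

lemma word_form_finsum:
  fixes F :: "'a \<Rightarrow> (nat + 'i \<Rightarrow> 'u) \<Rightarrow> 'u"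
  assumes "finite A" "\<And>a. a \<in> A \<Longrightarrow> word_form N (F a)"
  shows "word_form N (\<lambda>z. \<Oplus>a\<in>A. F a z)"
  using assms
proof (induction A)
  case (insert a A)
  then have "word_form N (\<lambda>z. F a z \<oplus> (\<Oplus>a\<in>A. F a z))" by (intro word_form_add) auto
  then show ?case
  proof (rule word_form_cong)
    fix z :: "nat + 'i \<Rightarrow> 'u" assume "range z \<subseteq> carrier K"
    then have "F b z \<in> carrier K" if "b \<in> insert a A" for b
      using insert.prems[OF that] word_form_closed by blast
    then show "F a z \<oplus> (\<Oplus>a\<in>A. F a z) = (\<Oplus>a\<in>insert a A. F a z)"
      using insert.hyps by (intro finsum_insert[symmetric]) auto
  qed
qed (simp add: word_form_zero)

lemma word_form_mult:
  assumes "word_form A F" "word_form B G"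
  shows "word_form (A + B) (\<lambda>z. F z \<otimes> G z)"
proof -
  obtain \<tau> \<sigma> where \<tau>: "\<And>w. polyf {} (\<tau> w)"
      "\<And>z. range z \<subseteq> carrier K \<Longrightarrow> F z = lin_comb (z \<circ> Inl) A (\<lambda>w. \<tau> w (z \<circ> Inr))"
    and \<sigma>: "\<And>w. polyf {} (\<sigma> w)"
      "\<And>z. range z \<subseteq> carrier K \<Longrightarrow> G z = lin_comb (z \<circ> Inl) B (\<lambda>w. \<sigma> w (z \<circ> Inr))"
    using assms unfolding word_form_def by blast
  have ts: "polyf {} (\<lambda>q. \<tau> w q \<otimes> \<sigma> u q)" for w u by (intro polyf_mult \<tau> \<sigma>)
  have "word_form (A + B) (\<lambda>z. \<Oplus>w\<in>words A. \<Oplus>u\<in>words B.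
      \<tau> w (z \<circ> Inr) \<otimes> \<sigma> u (z \<circ> Inr) \<otimes> mono_val (z \<circ> Inl) (w @ u))"
    by (intro word_form_finsum finite_words word_form_single[OF ts] words_append)
  then show ?thesis
  proof (rule word_form_cong)
    fix z :: "nat + 'a \<Rightarrow> 'u" assume z: "range z \<subseteq> carrier K"
    have 1: "range (z \<circ> Inl) \<subseteq> carrier K" and 2: "range (z \<circ> Inr) \<subseteq> carrier K" using z by auto
    have c: "\<tau> w (z \<circ> Inr) \<in> carrier K" "\<sigma> w (z \<circ> Inr) \<in> carrier K" for w
      using polyf_closed[OF \<tau>(1) _ 2] polyf_closed[OF \<sigma>(1) _ 2] by auto
    have m: "mono_val (z \<circ> Inl) w \<in> carrier K" for w by (rule mono_val_closed[OF 1])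
    have "F z \<otimes> G z = (\<Oplus>w\<in>words A. \<tau> w (z \<circ> Inr) \<otimes> mono_val (z \<circ> Inl) w) \<otimes> G z"
      using \<tau>(2)[OF z] by (simp add: lin_comb_def)
    also have "\<dots> = (\<Oplus>w\<in>words A. \<tau> w (z \<circ> Inr) \<otimes> mono_val (z \<circ> Inl) w \<otimes> G z)"
      using c m word_form_closed[OF assms(2) z] by (intro finsum_ldistr) auto
    also have "\<dots> = (\<Oplus>w\<in>words A. \<Oplus>u\<in>words B.
      \<tau> w (z \<circ> Inr) \<otimes> \<sigma> u (z \<circ> Inr) \<otimes> mono_val (z \<circ> Inl) (w @ u))"
    proof (rule finsum_cong')
      fix w assume "w \<in> words A"
      have "\<tau> w (z \<circ> Inr) \<otimes> mono_val (z \<circ> Inl) w \<otimes> G z =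
        (\<Oplus>u\<in>words B. \<tau> w (z \<circ> Inr) \<otimes> mono_val (z \<circ> Inl) w \<otimes> (\<sigma> u (z \<circ> Inr) \<otimes> mono_val (z \<circ> Inl) u))"
        unfolding \<sigma>(2)[OF z] lin_comb_def using c m by (intro finsum_rdistr) auto
      also have "\<dots> = (\<Oplus>u\<in>words B. \<tau> w (z \<circ> Inr) \<otimes> \<sigma> u (z \<circ> Inr) \<otimes> mono_val (z \<circ> Inl) (w @ u))"
        using c m by (intro finsum_cong') (auto simp: mono_val_append[OF 1] m_ac)
      finally show "\<tau> w (z \<circ> Inr) \<otimes> mono_val (z \<circ> Inl) w \<otimes> G z =
        (\<Oplus>u\<in>words B. \<tau> w (z \<circ> Inr) \<otimes> \<sigma> u (z \<circ> Inr) \<otimes> mono_val (z \<circ> Inl) (w @ u))" .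
    qed (use c m in \<open>auto intro!: finsum_closed\<close>)
    finally show "(\<Oplus>w\<in>words A. \<Oplus>u\<in>words B.
      \<tau> w (z \<circ> Inr) \<otimes> \<sigma> u (z \<circ> Inr) \<otimes> mono_val (z \<circ> Inl) (w @ u)) = F z \<otimes> G z" by simp
  qed
qed

lemma word_form_poly_Inr:
  assumes "polyf {} t" shows "word_form N (\<lambda>z. t (z \<circ> Inr))"
proof (rule word_form_cong[OF word_form_single[OF assms words_replicate]])
  fix z :: "nat + 'a \<Rightarrow> 'u" assume z: "range z \<subseteq> carrier K"
  have 1: "range (z \<circ> Inl) \<subseteq> carrier K" and 2: "range (z \<circ> Inr) \<subseteq> carrier K" using z by auto
  show "t (z \<circ> Inr) \<otimes> mono_val (z \<circ> Inl) (replicate N (Inl 0)) = t (z \<circ> Inr)"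
    using mono_val_replicate[OF 1] polyf_closed[OF assms _ 2] by simp
qed

lemma word_form_mono:
  assumes "word_form A F" "A \<le> B" shows "word_form B F"
proof -
  have "word_form (A + (B - A)) (\<lambda>z. F z \<otimes> \<one>)"
    using word_form_poly_Inr[of "\<lambda>_. \<one>"] by (intro word_form_mult assms) auto
  then have "word_form B (\<lambda>z. F z \<otimes> \<one>)" using assms(2) by simp
  then show ?thesis by (rule word_form_cong) (simp add: word_form_closed[OF assms(1)])
qed

lemma word_form_letter:
  assumes "l \<in> letters N" "N > 0"
  shows "word_form N (\<lambda>z. letter_val (z \<circ> Inl) l)"
proof -
  have w: "l # replicate (N - 1) (Inl 0) \<in> words N"
    using assms by (auto simp: words_def letters_def)
  show ?thesis
  proof (rule word_form_cong[OF word_form_single[OF polyf_one w]])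
    fix z :: "nat + 'a \<Rightarrow> 'u" assume z: "range z \<subseteq> carrier K"
    have 1: "range (z \<circ> Inl) \<subseteq> carrier K" using z by auto
    show "\<one> \<otimes> mono_val (z \<circ> Inl) (l # replicate (N - 1) (Inl 0)) = letter_val (z \<circ> Inl) l"
      using mono_val_replicate[OF 1] letter_val_closed[OF 1] by simp
  qed
qed

text \<open>A parameter or variable of index i is available from level \<open>Suc i\<close> on, and
  multiplication by 1 raises levels; one level therefore yields all larger ones.\<close>

lemma polyf_word_form:
  assumes "polyf (range \<kappa>) F"
  shows "\<exists>N0. \<forall>N\<ge>N0. word_form N F"
proof -
  have "\<exists>N. word_form N F" using assms
  proof (induction rule: polyf.induct)
    case polyf_zero show ?case by (rule exI[of _ 0]) (rule word_form_zero)
  next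
    case polyf_one
    show ?case by (rule exI[of _ 0]) (rule word_form_poly_Inr[of "\<lambda>_. \<one>", OF polyf.polyf_one])
  next
    case (polyf_const x)
    then obtain i where "x = \<kappa> i" by auto
    then show ?case using word_form_letter[of "Inl i" "Suc i"]
      by (intro exI[of _ "Suc i"]) (simp add: letters_def letter_val_def)
  next
    case (polyf_var j)
    show ?case
    proof (cases j)
      case (Inl k)
      then show ?thesis using word_form_letter[of "Inr k" "Suc k"]
        by (intro exI[of _ "Suc k"]) (simp add: letters_def letter_val_def o_def)
    next
      case (Inr i)
      have "word_form 0 (\<lambda>z :: nat + 'a \<Rightarrow> 'u. (z \<circ> Inr) i)" by (rule word_form_poly_Inr) simp
      then show ?thesis using Inr by (auto simp: o_def)
    qed
  next
    case (polyf_add F G)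
    then obtain A B where AB: "word_form A F" "word_form B G" by blast
    then have "word_form (max A B) (\<lambda>z. F z \<oplus> G z)"
      by (intro word_form_add) (rule word_form_mono, assumption, simp)+
    then show ?case by blast
  next
    case (polyf_mult F G) then show ?case using word_form_mult by blast
  next
    case (polyf_neg F)
    then obtain A where A: "word_form A F" by blast
    have "word_form (0 + A) (\<lambda>z :: nat + 'a \<Rightarrow> 'u. (\<lambda>_. \<ominus> \<one>) (z \<circ> Inr) \<otimes> F z)"
      by (intro word_form_mult A word_form_poly_Inr polyf.polyf_neg) simp
    then have "word_form A (\<lambda>z. \<ominus> \<one> \<otimes> F z)" by simp
    then have "word_form A (\<lambda>z. \<ominus> F z)"
      by (rule word_form_cong) (simp add: word_form_closed[OF A] l_minus)
    then show ?case by blast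
  next
    case (polyf_cong F G)
    then obtain A where A: "word_form A F" by blast
    then have "word_form A G" by (rule word_form_cong) (rule polyf_cong.hyps)
    then show ?case by blast
  qed
  then show ?thesis using word_form_mono by blast
qed

end

section \<open>Definability in the pair\<close>

lemma (in domain) minus_zero_iff:
  assumes "a \<in> carrier R" "b \<in> carrier R"
  shows "a \<ominus> b = \<zero> \<longleftrightarrow> a = b"
proof -
  have "a = (a \<ominus> b) \<oplus> b" using assms by algebra
  moreover have "b \<ominus> b = \<zero>" using assms by algebra
  ultimately show ?thesis using assms(2) l_zero by metis
qed

lemma fun_ar_L_P [simp]: "fun_ar (L_P L) = fun_ar L"
  by (simp add: L_P_def)

lemma rel_ar_L_P [simp]: "rel_ar (L_P L) Pred_P = Some 1" "rel_ar (L_P L) (Old R) = rel_ar L R"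
  by (simp_all add: L_P_def)

lemma fun_ar_ring_sym:
  assumes "L_rings \<subseteq>\<^sub>L (L :: ('f ring_sym, 'r) language)"
  shows "fun_ar L Zero = Some 0" "fun_ar L One = Some 0" "fun_ar L Plus = Some 2"
    "fun_ar L Times = Some 2" "fun_ar L Minus = Some 1"
  using assms by (auto simp: sublanguage_def L_rings_def map_le_def)

lemma is_term_L_P [simp]: "is_term (L_P L) t = is_term L t"
  by (induction t) (auto simp: list_all_iff)

locale pair_formulas = field_pair K P \<kappa> for K :: "'u ring" (structure) and P \<kappa> +
  fixes L :: "('f ring_sym, 'r) language" and PM :: "('f ring_sym, 'r, 'u) struct"
  assumes L_ring: "L_rings \<subseteq>\<^sub>L L" and PM_structure: "is_structure L PM" and PM_univ: "univ PM = P"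
    and PM_Zero [simp]: "fun_int PM Zero [] = \<zero>" and PM_One [simp]: "fun_int PM One [] = \<one>"
    and PM_Plus [simp]: "fun_int PM Plus [x, y] = x \<oplus> y"
    and PM_Times [simp]: "fun_int PM Times [x, y] = x \<otimes> y"
    and PM_Minus [simp]: "x \<in> carrier K \<Longrightarrow> fun_int PM Minus [x] = \<ominus> x"
begin

lemmas fun_ar_ring [simp] = fun_ar_ring_sym[OF L_ring]

text \<open>Index types take the place of variable numbers, to which they are tied by some injection
  \<open>\<iota>\<close>; matrices, coefficients and tuples are thus kept apart without arithmetic.
  Only families in P are constrained.\<close>

definition definable :: "(('i \<Rightarrow> 'u) \<Rightarrow> bool) \<Rightarrow> bool" where
  "definable X \<longleftrightarrow> (\<exists>\<psi> \<iota>. is_formula L \<psi> \<and> inj \<iota> \<and>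
     (\<forall>E :: nat \<Rightarrow> 'u. range E \<subseteq> P \<longrightarrow> (X (E \<circ> \<iota>) \<longleftrightarrow> sat PM E \<psi>)))"

lemma extend_inj:
  fixes \<iota> :: "'i \<Rightarrow> nat"
  assumes "inj \<iota>" "range q \<subseteq> P"
  shows "\<exists>E. range E \<subseteq> P \<and> q = E \<circ> \<iota>"
proof (intro exI conjI)
  let ?E = "\<lambda>k. if k \<in> range \<iota> then q (inv_into UNIV \<iota> k) else \<zero>"
  show "range ?E \<subseteq> P" using assms(2) by auto
  show "q = ?E \<circ> \<iota>" using assms(1) by auto
qed

lemma definable_cong:
  assumes "definable X" "\<And>q. range q \<subseteq> P \<Longrightarrow> X q \<longleftrightarrow> Y q"
  shows "definable Y"
proof -
  obtain \<psi> \<iota> where \<psi>: "is_formula L \<psi>" "inj \<iota>"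
    "\<And>E. range E \<subseteq> P \<Longrightarrow> X (E \<circ> \<iota>) \<longleftrightarrow> sat PM E \<psi>"
    using assms(1) unfolding definable_def by blast
  have "Y (E \<circ> \<iota>) \<longleftrightarrow> sat PM E \<psi>" if E: "range E \<subseteq> P" for E
    using \<psi>(3)[OF E] assms(2)[of "E \<circ> \<iota>"] E by auto
  then show ?thesis unfolding definable_def using \<psi> by blast
qed

text \<open>Any coding by even numbers can be prescribed: the remaining variables of the formula,
  bound ones included, move to odd numbers. Two conditions thus receive a common coding before they
  are combined.\<close>

lemma definable_code:
  assumes "definable X" and \<iota>': "inj \<iota>'" "\<And>i. even (\<iota>' i)"
  shows "\<exists>\<psi>. is_formula L \<psi> \<and> (\<forall>E. range E \<subseteq> P \<longrightarrow> (X (E \<circ> \<iota>') \<longleftrightarrow> sat PM E \<psi>))"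
proof -
  obtain \<psi> \<iota> where \<psi>: "is_formula L \<psi>" "inj \<iota>"
    "\<And>E. range E \<subseteq> P \<Longrightarrow> X (E \<circ> \<iota>) \<longleftrightarrow> sat PM E \<psi>"
    using assms(1) unfolding definable_def by blast
  define \<rho> where "\<rho> k = (if k \<in> range \<iota> then \<iota>' (inv_into UNIV \<iota> k) else 2 * k + 1)" for k
  have odd: "\<iota>' i \<noteq> Suc (2 * n)" "Suc (2 * n) \<noteq> \<iota>' i" for i n
  proof -
    have "odd (Suc (2 * n))" by simp
    then show "\<iota>' i \<noteq> Suc (2 * n)" "Suc (2 * n) \<noteq> \<iota>' i" using \<iota>'(2)[of i] by metis+
  qed
  have "inj \<rho>"
    by (rule injI) (use \<psi>(2) \<iota>'(1) odd in \<open>auto simp: \<rho>_def inj_eq split: if_splits\<close>)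
  have \<rho>: "\<rho> \<circ> \<iota> = \<iota>'" using \<psi>(2) by (auto simp: \<rho>_def)
  have "X (E \<circ> \<iota>') \<longleftrightarrow> sat PM E (ren \<rho> \<psi>)" if E: "range E \<subseteq> P" for E
  proof -
    have "range (E \<circ> \<rho>) \<subseteq> P" using E by auto
    from \<psi>(3)[OF this] show ?thesis unfolding sat_ren[OF \<open>inj \<rho>\<close>] comp_assoc \<rho> .
  qed
  then show ?thesis using \<psi>(1) by (intro exI[of _ "ren \<rho> \<psi>"]) simp
qed

lemma inj_even_code: "inj (\<lambda>i. 2 * to_nat (i :: 'i :: countable))"
  by (rule injI) simp

lemma definable_codeE:
  fixes X :: "('i :: countable \<Rightarrow> 'u) \<Rightarrow> bool"
  assumes "definable X"
  obtains \<psi> where "is_formula L \<psi>"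
    "\<And>E. range E \<subseteq> P \<Longrightarrow> X (E \<circ> (\<lambda>i. 2 * to_nat i)) \<longleftrightarrow> sat PM E \<psi>"
  using definable_code[OF assms inj_even_code] by auto

lemma definable_neg: "definable X \<Longrightarrow> definable (\<lambda>q. \<not> X q)"
  unfolding definable_def by (metis is_formula.simps(3) sat.simps(3))

lemma definable_conj:
  fixes X Y :: "('i :: countable \<Rightarrow> 'u) \<Rightarrow> bool"
  assumes "definable X" "definable Y"
  shows "definable (\<lambda>q. X q \<and> Y q)"
proof -
  obtain \<psi> where \<psi>: "is_formula L \<psi>"
    "\<And>E. range E \<subseteq> P \<Longrightarrow> X (E \<circ> (\<lambda>i. 2 * to_nat i)) \<longleftrightarrow> sat PM E \<psi>"
    using definable_codeE[OF assms(1)] by blast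
  obtain \<phi> where \<phi>: "is_formula L \<phi>"
    "\<And>E. range E \<subseteq> P \<Longrightarrow> Y (E \<circ> (\<lambda>i. 2 * to_nat i)) \<longleftrightarrow> sat PM E \<phi>"
    using definable_codeE[OF assms(2)] by blast
  show ?thesis unfolding definable_def using \<psi> \<phi> inj_even_code
    by (intro exI[of _ "Conj \<psi> \<phi>"] exI[of _ "\<lambda>i. 2 * to_nat i"]) simp
qed

lemma definable_const: "definable (\<lambda>q :: 'i :: countable \<Rightarrow> 'u. b)"
proof -
  have "definable (\<lambda>q :: 'i \<Rightarrow> 'u. True)"
    unfolding definable_def
    by (intro exI[of _ "Eq (Var 0) (Var 0)"] exI[of _ to_nat]) simp
  then show ?thesis using definable_neg[of "\<lambda>q :: 'i \<Rightarrow> 'u. True"] by (cases b) simp_all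
qed

lemma definable_ball:
  fixes X :: "'a \<Rightarrow> ('i :: countable \<Rightarrow> 'u) \<Rightarrow> bool"
  assumes "finite A" "\<And>a. a \<in> A \<Longrightarrow> definable (X a)"
  shows "definable (\<lambda>q. \<forall>a\<in>A. X a q)"
  using assms by (induction A) (auto intro!: definable_conj definable_const)

lemma definable_sat: "is_formula L \<psi> \<Longrightarrow> definable (\<lambda>q. sat PM q \<psi>)"
  unfolding definable_def by (intro exI[of _ \<psi>] exI[of _ id]) simp

lemma definable_poly:
  fixes F :: "('i :: countable \<Rightarrow> 'u) \<Rightarrow> 'u"
  assumes "polyf {} F"
  shows "definable (\<lambda>q. F q = \<zero>)"
proof -
  have "\<exists>t. is_term L t \<and> (\<forall>E. range E \<subseteq> P \<longrightarrow> tm_val PM E t = F (E \<circ> to_nat))"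
    using assms
  proof (induction rule: polyf.induct)
    case polyf_zero show ?case by (intro exI[of _ tzero]) simp
  next
    case polyf_one show ?case by (intro exI[of _ tone]) simp
  next
    case (polyf_var j) show ?case by (intro exI[of _ "Var (to_nat j)"]) simp
  next
    case (polyf_add F G)
    then obtain s t where "is_term L s \<and> (\<forall>E. range E \<subseteq> P \<longrightarrow> tm_val PM E s = F (E \<circ> to_nat))"
      "is_term L t \<and> (\<forall>E. range E \<subseteq> P \<longrightarrow> tm_val PM E t = G (E \<circ> to_nat))" by blast
    then show ?case by (intro exI[of _ "tplus s t"]) (simp add: o_def)
  next
    case (polyf_mult F G)
    then obtain s t where "is_term L s \<and> (\<forall>E. range E \<subseteq> P \<longrightarrow> tm_val PM E s = F (E \<circ> to_nat))"
      "is_term L t \<and> (\<forall>E. range E \<subseteq> P \<longrightarrow> tm_val PM E t = G (E \<circ> to_nat))" by blast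
    then show ?case by (intro exI[of _ "ttimes s t"]) (simp add: o_def)
  next
    case (polyf_neg F)
    then obtain t where t: "is_term L t \<and> (\<forall>E. range E \<subseteq> P \<longrightarrow> tm_val PM E t = F (E \<circ> to_nat))"
      by blast
    have "F (E \<circ> to_nat) \<in> carrier K" if "range E \<subseteq> P" for E
    proof -
      have "range (E \<circ> (to_nat :: 'i \<Rightarrow> nat)) \<subseteq> P" using that by auto
      then show ?thesis using polyf_P[OF polyf_neg.hyps] by blast
    qed
    then show ?case using t by (intro exI[of _ "tminus t"]) (simp add: o_def)
  next
    case (polyf_cong F G)
    then obtain t where t: "is_term L t \<and> (\<forall>E. range E \<subseteq> P \<longrightarrow> tm_val PM E t = F (E \<circ> to_nat))"
      by blast
    have "F (E \<circ> to_nat) = G (E \<circ> to_nat)" if "range E \<subseteq> P" for E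
      by (rule polyf_cong.hyps) (use that P_carrier in auto)
    then show ?case using t by (intro exI[of _ t]) (simp add: o_def)
  qed simp
  then obtain t where t: "is_term L t" "\<And>E. range E \<subseteq> P \<Longrightarrow> tm_val PM E t = F (E \<circ> to_nat)"
    by blast
  show ?thesis unfolding definable_def
    using t by (intro exI[of _ "Eq t tzero"] exI[of _ to_nat]) (simp add: o_def)
qed

lemma definable_reindex:
  fixes X :: "('i \<Rightarrow> 'u) \<Rightarrow> bool" and f :: "'i \<Rightarrow> 'j :: countable"
  assumes "definable X" "inj f"
  shows "definable (\<lambda>q. X (q \<circ> f))"
proof -
  let ?\<iota> = "\<lambda>j :: 'j. 2 * to_nat j"
  have i: "inj (?\<iota> \<circ> f)" using inj_even_code assms(2) by (rule inj_compose)
  have "even ((?\<iota> \<circ> f) i)" for i by simp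
  then obtain \<psi> where \<psi>: "is_formula L \<psi>"
    "\<forall>E. range E \<subseteq> P \<longrightarrow> (X (E \<circ> (?\<iota> \<circ> f)) \<longleftrightarrow> sat PM E \<psi>)"
    using definable_code[OF assms(1) i] by blast
  show ?thesis unfolding definable_def
    using \<psi> inj_even_code by (intro exI[of _ \<psi>] exI[of _ ?\<iota>]) (simp add: comp_assoc)
qed

text \<open>The family \<open>r\<close> may be infinite, but the formula mentions finitely many of
  its entries, and these alone are quantified.\<close>

lemma definable_ex:
  fixes X :: "('i + 'j \<Rightarrow> 'u) \<Rightarrow> bool"
  assumes "definable X"
  shows "definable (\<lambda>q. \<exists>r. range r \<subseteq> P \<and> X (case_sum q r))"
proof -
  obtain \<psi> \<iota> where \<psi>: "is_formula L \<psi>" "inj \<iota>"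
    "\<And>E. range E \<subseteq> P \<Longrightarrow> X (E \<circ> \<iota>) \<longleftrightarrow> sat PM E \<psi>"
    using assms(1) unfolding definable_def by blast
  define xs where "xs = sorted_list_of_set (free_vars \<psi> \<inter> range (\<iota> \<circ> Inr))"
  have xs: "set xs = free_vars \<psi> \<inter> range (\<iota> \<circ> Inr)" unfolding xs_def by simp
  have "(\<exists>r. range r \<subseteq> P \<and> X (case_sum (E \<circ> (\<iota> \<circ> Inl)) r)) \<longleftrightarrow> sat PM E (foldr Ex xs \<psi>)"
    if E: "range E \<subseteq> P" for E
  proof
    assume "\<exists>r. range r \<subseteq> P \<and> X (case_sum (E \<circ> (\<iota> \<circ> Inl)) r)"
    then obtain r where r: "range r \<subseteq> P" "X (case_sum (E \<circ> (\<iota> \<circ> Inl)) r)" by blast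
    define E' where "E' k = (if k \<in> range (\<iota> \<circ> Inr) then r (inv_into UNIV (\<iota> \<circ> Inr) k) else E k)" for k
    have ii: "inj (\<iota> \<circ> Inr)" using \<psi>(2) by (simp add: inj_compose)
    have E': "range E' \<subseteq> P" using r(1) E by (auto simp: E'_def)
    have eq: "E' \<circ> \<iota> = case_sum (E \<circ> (\<iota> \<circ> Inl)) r"
    proof
      fix x show "(E' \<circ> \<iota>) x = case_sum (E \<circ> (\<iota> \<circ> Inl)) r x"
      proof (cases x)
        case (Inl i)
        have "\<iota> (Inl i) \<notin> range (\<iota> \<circ> Inr)" using \<psi>(2) by (auto simp: inj_eq)
        then show ?thesis using Inl by (simp add: E'_def)
      next
        case (Inr j)
        have "\<iota> (Inr j) \<in> range (\<iota> \<circ> Inr)" by auto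
        then show ?thesis using Inr inv_f_f[OF ii, of j] by (simp add: E'_def)
      qed
    qed
    have s: "sat PM E' \<psi>" using \<psi>(3)[OF E'] r(2) unfolding eq by simp
    \<comment> \<open>Entries of \<open>r\<close> outside \<open>xs\<close> are reset, since
      \<open>sat_Exs\<close> permits changes on \<open>xs\<close> only; the formula does not see the
      difference.\<close>
    define E'' where "E'' k = (if k \<in> set xs then E' k else E k)" for k
    have "sat PM E'' \<psi> = sat PM E' \<psi>"
      by (rule sat_cong) (auto simp: E''_def E'_def xs)
    moreover have "range E'' \<subseteq> univ PM" using E E' by (auto simp: E''_def PM_univ)
    ultimately have "range E'' \<subseteq> univ PM \<and> (\<forall>k. k \<notin> set xs \<longrightarrow> E'' k = E k) \<and> sat PM E'' \<psi>"
      using s by (simp add: E''_def)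
    then show "sat PM E (foldr Ex xs \<psi>)"
      using E by (subst sat_Exs) (auto simp: PM_univ)
  next
    assume "sat PM E (foldr Ex xs \<psi>)"
    then obtain E' where E': "range E' \<subseteq> P" "\<And>k. k \<notin> set xs \<Longrightarrow> E' k = E k" "sat PM E' \<psi>"
      using E sat_Exs[of E PM xs \<psi>] by (auto simp: PM_univ)
    have "case_sum (E \<circ> (\<iota> \<circ> Inl)) (E' \<circ> \<iota> \<circ> Inr) = E' \<circ> \<iota>"
    proof
      fix x show "case_sum (E \<circ> (\<iota> \<circ> Inl)) (E' \<circ> \<iota> \<circ> Inr) x = (E' \<circ> \<iota>) x"
      proof (cases x)
        case (Inl i)
        have "\<iota> (Inl i) \<notin> set xs" using \<psi>(2) by (auto simp: inj_eq xs)
        then show ?thesis using Inl E'(2) by simp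
      qed simp
    qed
    moreover have "X (E' \<circ> \<iota>)" using \<psi>(3)[OF E'(1)] E'(3) by simp
    moreover have "range (E' \<circ> \<iota> \<circ> Inr) \<subseteq> P" using E'(1) by auto
    ultimately show "\<exists>r. range r \<subseteq> P \<and> X (case_sum (E \<circ> (\<iota> \<circ> Inl)) r)"
      by (intro exI[of _ "E' \<circ> \<iota> \<circ> Inr"]) simp
  qed
  moreover have "inj (\<iota> \<circ> Inl)" using \<psi>(2) by (simp add: inj_compose)
  ultimately show ?thesis unfolding definable_def using \<psi>(1)
    by (intro exI[of _ "foldr Ex xs \<psi>"] exI[of _ "\<iota> \<circ> Inl"]) simp
qed

lemma definable_finite_support:
  assumes "definable X"
  shows "\<exists>I. finite I \<and> (\<forall>q q'. range q \<subseteq> P \<and> range q' \<subseteq> P \<and> (\<forall>i\<in>I. q i = q' i) \<longrightarrow> X q = X q')"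
proof -
  obtain \<psi> \<iota> where \<psi>: "is_formula L \<psi>" "inj \<iota>"
    "\<And>E. range E \<subseteq> P \<Longrightarrow> X (E \<circ> \<iota>) \<longleftrightarrow> sat PM E \<psi>"
    using assms(1) unfolding definable_def by blast
  have "X q = X q'" if q: "range q \<subseteq> P" "range q' \<subseteq> P" "\<forall>i\<in>\<iota> -` free_vars \<psi>. q i = q' i" for q q'
  proof -
    let ?E = "\<lambda>q k. if k \<in> range \<iota> then q (inv_into UNIV \<iota> k) else \<zero>"
    have E: "?E q \<circ> \<iota> = q" "range (?E q) \<subseteq> P" if "range q \<subseteq> P" for q
      using that \<psi>(2) by auto
    have "sat PM (?E q) \<psi> = sat PM (?E q') \<psi>"
      by (rule sat_cong) (use q \<psi>(2) in auto)
    then show ?thesis using \<psi>(3)[OF E(2)[OF q(1)]] \<psi>(3)[OF E(2)[OF q(2)]] E(1)[OF q(1)] E(1)[OF q(2)]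
      by simp
  qed
  moreover have "finite (\<iota> -` free_vars \<psi>)" using \<psi>(2) by (intro finite_vimageI) auto
  ultimately show ?thesis by (intro exI[of _ "\<iota> -` free_vars \<psi>"] conjI allI impI) simp_all
qed

text \<open>The values of F are introduced by a quantifier over P together with their defining
  equations, of which finitely many suffice because X has finite support.\<close>

lemma definable_subst:
  fixes X :: "('i :: countable \<Rightarrow> 'u) \<Rightarrow> bool" and F :: "'i \<Rightarrow> ('j :: countable \<Rightarrow> 'u) \<Rightarrow> 'u"
  assumes X: "definable X" and F: "\<And>i. polyf {} (F i)"
  shows "definable (\<lambda>q. X (\<lambda>i. F i q))"
proof -
  obtain I where I': "finite I"
    "\<forall>q q'. range q \<subseteq> P \<and> range q' \<subseteq> P \<and> (\<forall>i\<in>I. q i = q' i) \<longrightarrow> X q = X q'"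
    using definable_finite_support[OF X] by (elim exE conjE) (rule that)
  have I: "finite I"
    "\<And>q q'. range q \<subseteq> P \<Longrightarrow> range q' \<subseteq> P \<Longrightarrow> \<forall>i\<in>I. q i = q' i \<Longrightarrow> X q = X q'"
    using I' by simp_all
  have pc: "polyf {} (\<lambda>z :: 'j + 'i \<Rightarrow> 'u. F i (z \<circ> Inl) \<ominus> z (Inr i))" for i
  proof (intro polyf_minus)
    show "polyf {} (\<lambda>z :: 'j + 'i \<Rightarrow> 'u. F i (z \<circ> Inl))"
      using polyf_comp[OF F, of "\<lambda>j (z :: 'j + 'i \<Rightarrow> 'u). z (Inl j)" i] by (simp add: o_def)
  qed simp
  have "definable (\<lambda>z :: 'j + 'i \<Rightarrow> 'u. X (z \<circ> Inr) \<and> (\<forall>i\<in>I. F i (z \<circ> Inl) \<ominus> z (Inr i) = \<zero>))"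
    using I by (intro definable_conj definable_ball definable_poly pc definable_reindex[OF X]) auto
  then have "definable (\<lambda>q. \<exists>r. range r \<subseteq> P \<and> (X (case_sum q r \<circ> Inr) \<and>
      (\<forall>i\<in>I. F i (case_sum q r \<circ> Inl) \<ominus> case_sum q r (Inr i) = \<zero>)))" by (rule definable_ex)
  then show ?thesis
  proof (rule definable_cong)
    fix q :: "'j \<Rightarrow> 'u" assume q: "range q \<subseteq> P"
    have FP: "F i q \<in> P" for i by (rule polyf_P[OF F q])
    have eq: "case_sum q r \<circ> Inr = r" "case_sum q r \<circ> Inl = q" for r :: "'i \<Rightarrow> 'u" by auto
    show "(\<exists>r. range r \<subseteq> P \<and> (X (case_sum q r \<circ> Inr) \<and>
      (\<forall>i\<in>I. F i (case_sum q r \<circ> Inl) \<ominus> case_sum q r (Inr i) = \<zero>))) = X (\<lambda>i. F i q)" (is "?A = ?B")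
    proof
      assume ?A
      then obtain r where r: "range r \<subseteq> P" "X r" "\<forall>i\<in>I. F i q \<ominus> r i = \<zero>" unfolding eq by auto
      have "F i q = r i" if "i \<in> I" for i
      proof -
        have "r i \<in> P" using r(1) by (simp add: image_subset_iff)
        then have "F i q \<in> carrier K" "r i \<in> carrier K" using FP by auto
        then show ?thesis using r(3) that minus_zero_iff[of "F i q" "r i"] by blast
      qed
      then have "X r = X (\<lambda>i. F i q)" using r(1) FP by (intro I(2)) auto
      then show ?B using r by blast
    next
      assume ?B
      then show ?A unfolding eq using FP by (intro exI[of _ "\<lambda>i. F i q"]) (auto simp: minus_zero_iff)
    qed
  qed
qed

end

lemma range_case_sum: "range (case_sum f g) = range f \<union> range g"
  by (auto simp: image_iff split: sum.splits) (metis sum.case)+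

section \<open>Conditions on tuples of K expressed over P\<close>

context pair_formulas
begin

text \<open>The normal form of the formulas of the pair: the tuple \<open>e\<close> of the field enters only through the
  relations over \<open>P\<close> among its monomials of sufficiently large degree.\<close>

definition P_definable :: "((nat \<Rightarrow> 'u) \<Rightarrow> ('i :: countable \<Rightarrow> 'u) \<Rightarrow> bool) \<Rightarrow> bool" where
  "P_definable \<Theta> \<longleftrightarrow> (\<exists>N0. \<forall>N\<ge>N0. \<exists>\<chi> :: ((word \<times> word) + 'i \<Rightarrow> 'u) \<Rightarrow> bool. definable \<chi> \<and>
     (\<forall>e c q. range e \<subseteq> carrier K \<and> range c \<subseteq> P \<and> range q \<subseteq> P \<and> relation_matrix e N c \<longrightarrow>
        (\<Theta> e q \<longleftrightarrow> \<chi> (case_sum c q))))"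

lemma P_definableE:
  assumes "P_definable \<Theta>"
  obtains N0 \<chi> where "\<And>N. N \<ge> N0 \<Longrightarrow> definable (\<chi> N)"
    "\<And>N e c q. N \<ge> N0 \<Longrightarrow> range e \<subseteq> carrier K \<Longrightarrow> range c \<subseteq> P \<Longrightarrow> range q \<subseteq> P \<Longrightarrow> relation_matrix e N c \<Longrightarrow>
      \<Theta> e q \<longleftrightarrow> \<chi> N (case_sum c q)"
proof -
  obtain N0 where "\<forall>N\<ge>N0. \<exists>\<chi> :: ((word \<times> word) + 'a \<Rightarrow> 'u) \<Rightarrow> bool. definable \<chi> \<and>
     (\<forall>e c q. range e \<subseteq> carrier K \<and> range c \<subseteq> P \<and> range q \<subseteq> P \<and> relation_matrix e N c \<longrightarrow>
        (\<Theta> e q \<longleftrightarrow> \<chi> (case_sum c q)))" using assms unfolding P_definable_def by (rule exE)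
  then obtain \<chi> :: "nat \<Rightarrow> ((word \<times> word) + 'a \<Rightarrow> 'u) \<Rightarrow> bool" where
    "\<forall>N\<ge>N0. definable (\<chi> N) \<and>
     (\<forall>e c q. range e \<subseteq> carrier K \<and> range c \<subseteq> P \<and> range q \<subseteq> P \<and> relation_matrix e N c \<longrightarrow>
        (\<Theta> e q \<longleftrightarrow> \<chi> N (case_sum c q)))" by metis
  then show ?thesis by (intro that[of N0 \<chi>]) simp_all
qed

lemma P_definableI:
  fixes \<Theta> :: "(nat \<Rightarrow> 'u) \<Rightarrow> ('i :: countable \<Rightarrow> 'u) \<Rightarrow> bool"
  assumes "\<And>N. N \<ge> N0 \<Longrightarrow> definable (\<chi> N)"
    "\<And>N e c q. N \<ge> N0 \<Longrightarrow> range e \<subseteq> carrier K \<Longrightarrow> range c \<subseteq> P \<Longrightarrow> range q \<subseteq> P \<Longrightarrow> relation_matrix e N c \<Longrightarrow>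
      \<Theta> e q \<longleftrightarrow> \<chi> N (case_sum c q)"
  shows "P_definable \<Theta>"
  unfolding P_definable_def
proof (intro exI[of _ N0] allI impI)
  fix N assume N: "N0 \<le> N"
  show "\<exists>\<chi> :: ((word \<times> word) + 'i \<Rightarrow> 'u) \<Rightarrow> bool. definable \<chi> \<and>
     (\<forall>e c q. range e \<subseteq> carrier K \<and> range c \<subseteq> P \<and> range q \<subseteq> P \<and> relation_matrix e N c \<longrightarrow>
        (\<Theta> e q \<longleftrightarrow> \<chi> (case_sum c q)))"
    using assms[OF N] by (intro exI[of _ "\<chi> N"]) simp
qed

lemma P_definable_cong:
  assumes "P_definable \<Theta>" "\<And>e q. range e \<subseteq> carrier K \<Longrightarrow> range q \<subseteq> P \<Longrightarrow> \<Theta> e q \<longleftrightarrow> \<Theta>' e q"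
  shows "P_definable \<Theta>'"
proof -
  obtain N0 \<chi> where \<chi>: "\<And>N. N \<ge> N0 \<Longrightarrow> definable (\<chi> N)"
    "\<And>N e c q. N \<ge> N0 \<Longrightarrow> range e \<subseteq> carrier K \<Longrightarrow> range c \<subseteq> P \<Longrightarrow> range q \<subseteq> P \<Longrightarrow> relation_matrix e N c \<Longrightarrow>
      \<Theta> e q \<longleftrightarrow> \<chi> N (case_sum c q)" using P_definableE[OF assms(1)] by blast
  show ?thesis by (rule P_definableI[of N0 \<chi>]) (simp_all add: \<chi> assms(2)[symmetric])
qed

lemma P_definable_neg:
  assumes "P_definable \<Theta>" shows "P_definable (\<lambda>e q. \<not> \<Theta> e q)"
proof -
  obtain N0 \<chi> where \<chi>: "\<And>N. N \<ge> N0 \<Longrightarrow> definable (\<chi> N)"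
    "\<And>N e c q. N \<ge> N0 \<Longrightarrow> range e \<subseteq> carrier K \<Longrightarrow> range c \<subseteq> P \<Longrightarrow> range q \<subseteq> P \<Longrightarrow> relation_matrix e N c \<Longrightarrow>
      \<Theta> e q \<longleftrightarrow> \<chi> N (case_sum c q)" using P_definableE[OF assms(1)] by blast
  show ?thesis by (rule P_definableI[of N0 "\<lambda>N z. \<not> \<chi> N z"]) (simp_all add: \<chi> definable_neg)
qed

lemma P_definable_conj:
  assumes "P_definable \<Theta>" "P_definable \<Theta>'" shows "P_definable (\<lambda>e q. \<Theta> e q \<and> \<Theta>' e q)"
proof -
  obtain N0 \<chi> where \<chi>: "\<And>N. N \<ge> N0 \<Longrightarrow> definable (\<chi> N)"
    "\<And>N e c q. N \<ge> N0 \<Longrightarrow> range e \<subseteq> carrier K \<Longrightarrow> range c \<subseteq> P \<Longrightarrow> range q \<subseteq> P \<Longrightarrow> relation_matrix e N c \<Longrightarrow>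
      \<Theta> e q \<longleftrightarrow> \<chi> N (case_sum c q)" using P_definableE[OF assms(1)] by blast
  obtain N1 \<chi>' where \<chi>': "\<And>N. N \<ge> N1 \<Longrightarrow> definable (\<chi>' N)"
    "\<And>N e c q. N \<ge> N1 \<Longrightarrow> range e \<subseteq> carrier K \<Longrightarrow> range c \<subseteq> P \<Longrightarrow> range q \<subseteq> P \<Longrightarrow> relation_matrix e N c \<Longrightarrow>
      \<Theta>' e q \<longleftrightarrow> \<chi>' N (case_sum c q)" using P_definableE[OF assms(2)] by blast
  show ?thesis
  proof (rule P_definableI[of "max N0 N1" "\<lambda>N z. \<chi> N z \<and> \<chi>' N z"])
    fix N assume N: "max N0 N1 \<le> N"
    then show "definable (\<lambda>z. \<chi> N z \<and> \<chi>' N z)" by (intro definable_conj \<chi>(1) \<chi>'(1)) auto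
    fix e c and q :: "'a \<Rightarrow> 'u"
    assume a: "range e \<subseteq> carrier K" "range c \<subseteq> P" "range q \<subseteq> P" "relation_matrix e N c"
    show "(\<Theta> e q \<and> \<Theta>' e q) = (\<chi> N (case_sum c q) \<and> \<chi>' N (case_sum c q))"
      using \<chi>(2)[OF _ a] \<chi>'(2)[OF _ a] N by simp
  qed
qed

lemma P_definable_disj:
  assumes "P_definable \<Theta>" "P_definable \<Theta>'" shows "P_definable (\<lambda>e q. \<Theta> e q \<or> \<Theta>' e q)"
  using P_definable_neg[OF P_definable_conj[OF assms[THEN P_definable_neg]]] by simp

lemma P_definable_imp:
  assumes "P_definable \<Theta>" "P_definable \<Theta>'" shows "P_definable (\<lambda>e q. \<Theta> e q \<longrightarrow> \<Theta>' e q)"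
  using P_definable_neg[OF P_definable_conj[OF assms(1) assms(2)[THEN P_definable_neg]]] by simp

lemma P_definable_iff:
  assumes "P_definable \<Theta>" "P_definable \<Theta>'" shows "P_definable (\<lambda>e q. \<Theta> e q \<longleftrightarrow> \<Theta>' e q)"
  using P_definable_conj[OF P_definable_imp[OF assms] P_definable_imp[OF assms(2,1)]] by (rule P_definable_cong) blast

lemma P_definable_definable:
  fixes X :: "('i :: countable \<Rightarrow> 'u) \<Rightarrow> bool"
  assumes "definable X" shows "P_definable (\<lambda>e q. X q)"
proof (rule P_definableI[of 0 "\<lambda>N z. X (z \<circ> Inr)"])
  show "definable (\<lambda>z :: (word \<times> word) + 'i \<Rightarrow> 'u. X (z \<circ> Inr))" by (rule definable_reindex[OF assms]) simp
  show "X q \<longleftrightarrow> X (case_sum c q \<circ> Inr)" for q and c :: "word \<times> word \<Rightarrow> 'u" by (simp add: o_def)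
qed

lemma P_definable_const: "P_definable (\<lambda>e q. b)"
  by (rule P_definable_definable) (rule definable_const)

lemma P_definable_ball:
  assumes "finite A" "\<And>a. a \<in> A \<Longrightarrow> P_definable (\<Theta> a)"
  shows "P_definable (\<lambda>e q. \<forall>a\<in>A. \<Theta> a e q)"
  using assms by (induction A) (auto intro!: P_definable_conj P_definable_const)

lemma P_definable_bex:
  assumes "finite A" "\<And>a. a \<in> A \<Longrightarrow> P_definable (\<Theta> a)"
  shows "P_definable (\<lambda>e q. \<exists>a\<in>A. \<Theta> a e q)"
  using assms by (induction A) (auto intro!: P_definable_disj P_definable_const)

lemma P_definable_reindex:
  fixes \<Theta> :: "(nat \<Rightarrow> 'u) \<Rightarrow> ('i :: countable \<Rightarrow> 'u) \<Rightarrow> bool" and f :: "'i \<Rightarrow> 'j :: countable"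
  assumes "P_definable \<Theta>" shows "P_definable (\<lambda>e q. \<Theta> e (\<lambda>i. q (f i)))"
proof -
  obtain N0 \<chi> where \<chi>: "\<And>N. N \<ge> N0 \<Longrightarrow> definable (\<chi> N)"
    "\<And>N e c q. N \<ge> N0 \<Longrightarrow> range e \<subseteq> carrier K \<Longrightarrow> range c \<subseteq> P \<Longrightarrow> range q \<subseteq> P \<Longrightarrow> relation_matrix e N c \<Longrightarrow>
      \<Theta> e q \<longleftrightarrow> \<chi> N (case_sum c q)" using P_definableE[OF assms(1)] by blast
  let ?g = "map_sum id f :: (word \<times> word) + 'i \<Rightarrow> (word \<times> word) + 'j"
  show ?thesis
  proof (rule P_definableI[of N0 "\<lambda>N z. \<chi> N (\<lambda>x. z (?g x))"])
    fix N assume "N \<ge> N0"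
    then show "definable (\<lambda>z. \<chi> N (\<lambda>x. z (?g x)))" by (intro definable_subst[where F = "\<lambda>x z. z (?g x)", OF \<chi>(1)] polyf_var)
    fix e c and q :: "'j \<Rightarrow> 'u"
    assume a: "range e \<subseteq> carrier K" "range c \<subseteq> P" "range q \<subseteq> P" "relation_matrix e N c"
    have "(\<lambda>x. case_sum c q (?g x)) = case_sum c (\<lambda>i. q (f i))"
      by (rule ext) (simp split: sum.splits)
    moreover have "range (\<lambda>i. q (f i)) \<subseteq> P" using a(3) by auto
    ultimately show "\<Theta> e (\<lambda>i. q (f i)) \<longleftrightarrow> \<chi> N (\<lambda>x. case_sum c q (?g x))"
      using \<chi>(2)[OF \<open>N \<ge> N0\<close> a(1,2) _ a(4)] by simp
  qed
qed

text \<open>The relation matrix belongs to e alone, so a quantifier over P can be moved past it into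
  \<open>\<chi>\<close>.\<close>

lemma P_definable_ex:
  fixes \<Theta> :: "(nat \<Rightarrow> 'u) \<Rightarrow> ('i :: countable \<Rightarrow> 'u) \<Rightarrow> ('j :: countable \<Rightarrow> 'u) \<Rightarrow> bool"
  assumes "P_definable (\<lambda>e z. \<Theta> e (\<lambda>i. z (Inl i)) (\<lambda>j. z (Inr j)))"
  shows "P_definable (\<lambda>e q. \<exists>r. range r \<subseteq> P \<and> \<Theta> e q r)"
proof -
  obtain N0 \<chi> where \<chi>: "\<And>N. N \<ge> N0 \<Longrightarrow> definable (\<chi> N)"
    "\<And>N e c z. N \<ge> N0 \<Longrightarrow> range e \<subseteq> carrier K \<Longrightarrow> range c \<subseteq> P \<Longrightarrow> range z \<subseteq> P \<Longrightarrow> relation_matrix e N c \<Longrightarrow>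
      \<Theta> e (\<lambda>i. z (Inl i)) (\<lambda>j. z (Inr j)) \<longleftrightarrow> \<chi> N (case_sum c z)" using P_definableE[OF assms(1)] by blast
  \<comment> \<open>Regroups the indices: the matrix and q stay free, r gets quantified.\<close>
  define f :: "(word \<times> word) + ('i + 'j) \<Rightarrow> ((word \<times> word) + 'i) + 'j" where
    "f = case_sum (Inl \<circ> Inl) (case_sum (Inl \<circ> Inr) Inr)"
  have f: "inj f" by (rule injI) (auto simp: f_def split: sum.splits)
  show ?thesis
  proof (rule P_definableI[of N0 "\<lambda>N y. \<exists>r. range r \<subseteq> P \<and> \<chi> N (case_sum y r \<circ> f)"])
    fix N assume N: "N \<ge> N0"
    show "definable (\<lambda>y. \<exists>r. range r \<subseteq> P \<and> \<chi> N (case_sum y r \<circ> f))"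
      by (rule definable_ex[OF definable_reindex[OF \<chi>(1)[OF N] f]])
    fix e c and q :: "'i \<Rightarrow> 'u"
    assume a: "range e \<subseteq> carrier K" "range c \<subseteq> P" "range q \<subseteq> P" "relation_matrix e N c"
    have "\<Theta> e q r \<longleftrightarrow> \<chi> N (case_sum (case_sum c q) r \<circ> f)" if r: "range r \<subseteq> P" for r
    proof -
      have "range (case_sum q r) \<subseteq> P" using a(3) r unfolding range_case_sum by blast
      from \<chi>(2)[OF N a(1,2) this a(4)]
      have "\<Theta> e q r \<longleftrightarrow> \<chi> N (case_sum c (case_sum q r))" by simp
      moreover have "case_sum (case_sum c q) r \<circ> f = case_sum c (case_sum q r)"
        by (rule ext) (simp add: f_def split: sum.splits)
      ultimately show ?thesis by simp
    qed
    then show "(\<exists>r. range r \<subseteq> P \<and> \<Theta> e q r) \<longleftrightarrow>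
        (\<exists>r. range r \<subseteq> P \<and> \<chi> N (case_sum (case_sum c q) r \<circ> f))" by blast
  qed
qed

lemma P_definable_all:
  fixes \<Theta> :: "(nat \<Rightarrow> 'u) \<Rightarrow> ('i :: countable \<Rightarrow> 'u) \<Rightarrow> ('j :: countable \<Rightarrow> 'u) \<Rightarrow> bool"
  assumes "P_definable (\<lambda>e z. \<Theta> e (\<lambda>i. z (Inl i)) (\<lambda>j. z (Inr j)))"
  shows "P_definable (\<lambda>e q. \<forall>r. range r \<subseteq> P \<longrightarrow> \<Theta> e q r)"
  using P_definable_neg[OF P_definable_ex[OF P_definable_neg[OF assms]]] by simp

text \<open>In word form, F vanishes exactly if its coefficients form a relation of the monomials,
  and this the matrix decides.\<close>

lemma P_definable_poly:
  fixes F :: "(nat \<Rightarrow> 'u) \<Rightarrow> ('i :: countable \<Rightarrow> 'u) \<Rightarrow> 'u"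
  assumes "polyf (range \<kappa>) (\<lambda>z. F (\<lambda>k. z (Inl k)) (\<lambda>i. z (Inr i)))"
  shows "P_definable (\<lambda>e q. F e q = \<zero>)"
proof -
  obtain N0 where "\<forall>N\<ge>N0. word_form N (\<lambda>z. F (\<lambda>k. z (Inl k)) (\<lambda>i. z (Inr i)))"
    using polyf_word_form[OF assms] by blast
  then obtain \<tau> where \<tau>: "\<And>N w. N \<ge> N0 \<Longrightarrow> polyf {} (\<tau> N w)"
    "\<And>N z. N \<ge> N0 \<Longrightarrow> range z \<subseteq> carrier K \<Longrightarrow>
      F (\<lambda>k. z (Inl k)) (\<lambda>i. z (Inr i)) = lin_comb (z \<circ> Inl) N (\<lambda>w. \<tau> N w (z \<circ> Inr))"
    unfolding word_form_def by metis
  show ?thesis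
  proof (rule P_definableI[of N0 "\<lambda>N y. \<forall>u\<in>words N. (\<Oplus>w\<in>words N. \<tau> N w (y \<circ> Inr) \<otimes> y (Inl (w, u))) = \<zero>"])
    fix N assume N: "N \<ge> N0"
    have "polyf {} (\<lambda>y :: (word \<times> word) + 'i \<Rightarrow> 'u. \<tau> N w (y \<circ> Inr))" for w
      using polyf_comp[OF \<tau>(1)[OF N], of "\<lambda>i (y :: (word \<times> word) + 'i \<Rightarrow> 'u). y (Inr i)" w]
      by (simp add: o_def)
    then show "definable (\<lambda>y :: (word \<times> word) + 'i \<Rightarrow> 'u.
        \<forall>u\<in>words N. (\<Oplus>w\<in>words N. \<tau> N w (y \<circ> Inr) \<otimes> y (Inl (w, u))) = \<zero>)"
      by (intro definable_ball definable_poly polyf_finsum polyf_mult finite_words polyf_var) simp_all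
    fix e c and q :: "'i \<Rightarrow> 'u"
    assume a: "range e \<subseteq> carrier K" "range c \<subseteq> P" "range q \<subseteq> P" "relation_matrix e N c"
    have "range (case_sum e q) \<subseteq> carrier K" using a P_carrier unfolding range_case_sum by blast
    from \<tau>(2)[OF N this] have "F e q = lin_comb e N (\<lambda>w. \<tau> N w q)" by (simp add: o_def)
    moreover have "range (\<lambda>w. \<tau> N w q) \<subseteq> P" using polyf_P[OF \<tau>(1)[OF N] a(3)] by auto
    ultimately show "F e q = \<zero> \<longleftrightarrow> (\<forall>u\<in>words N.
        (\<Oplus>w\<in>words N. \<tau> N w (case_sum c q \<circ> Inr) \<otimes> case_sum c q (Inl (w, u))) = \<zero>)"
      using a(4) unfolding relation_matrix_def by (simp add: o_def)
  qed
qed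

lemma P_definable_poly_eq:
  fixes F G :: "(nat \<Rightarrow> 'u) \<Rightarrow> ('i :: countable \<Rightarrow> 'u) \<Rightarrow> 'u"
  assumes F: "polyf (range \<kappa>) (\<lambda>z. F (\<lambda>k. z (Inl k)) (\<lambda>i. z (Inr i)))"
    and G: "polyf (range \<kappa>) (\<lambda>z. G (\<lambda>k. z (Inl k)) (\<lambda>i. z (Inr i)))"
  shows "P_definable (\<lambda>e q. F e q = G e q)"
proof -
  have "P_definable (\<lambda>e q. F e q \<ominus> G e q = \<zero>)" by (intro P_definable_poly polyf_minus F G)
  then show ?thesis
  proof (rule P_definable_cong)
    fix e :: "nat \<Rightarrow> 'u" and q :: "'i \<Rightarrow> 'u" assume a: "range e \<subseteq> carrier K" "range q \<subseteq> P"
    have r: "range (case_sum e q) \<subseteq> carrier K" using a P_carrier unfolding range_case_sum by blast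
    have "F e q \<in> carrier K" "G e q \<in> carrier K"
      using polyf_closed[OF F _ r] polyf_closed[OF G _ r] by auto
    then show "F e q \<ominus> G e q = \<zero> \<longleftrightarrow> F e q = G e q" by (rule minus_zero_iff)
  qed
qed

end

section \<open>Elimination of a quantifier over the field\<close>

context field_pair
begin

text \<open>The letter is overwritten by the padding \<open>Inl 0\<close> of value 1 instead of
  being removed, so words keep their length and stay in \<open>words N\<close>.\<close>

definition delete_var :: "nat \<Rightarrow> word \<Rightarrow> word" where
  "delete_var k w = map (\<lambda>l. if l = Inr k then Inl 0 else l) w"

text \<open>A combination of monomials in \<open>e(k := y)\<close> is regarded as a polynomial in y
  over the monomials in e; this is its coefficient at the power j.\<close>

definition coeff_at :: "nat \<Rightarrow> nat \<Rightarrow> (nat \<Rightarrow> 'u) \<Rightarrow> (word \<Rightarrow> 'u) \<Rightarrow> nat \<Rightarrow> 'u" where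
  "coeff_at k N e g j = (\<Oplus>w\<in>words N. if count_list w (Inr k) = j then g w \<otimes> mono_val e (delete_var k w) else \<zero>)"

lemma delete_var_words: "w \<in> words N \<Longrightarrow> delete_var k w \<in> words N"
  by (auto simp: words_def delete_var_def letters_def)

lemma mono_val_upd:
  assumes e: "range e \<subseteq> carrier K" and y: "y \<in> carrier K"
  shows "mono_val (e(k := y)) w = mono_val e (delete_var k w) \<otimes> y [^] count_list w (Inr k)"
proof -
  define e' where "e' = e(k := y)"
  have c: "letter_val e l \<in> carrier K" "mono_val e w \<in> carrier K" for l w
    using letter_val_closed[OF e] mono_val_closed[OF e] by blast+
  have l: "letter_val e' l = (if l = Inr k then y else letter_val e l)" for l
    by (auto simp: letter_val_def e'_def split: sum.splits)
  have "mono_val e' w = mono_val e (delete_var k w) \<otimes> y [^] count_list w (Inr k)"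
  proof (induction w)
    case (Cons l' w)
    then show ?case
      using y c by (cases "l' = Inr k") (simp_all add: delete_var_def l letter_val_def[of e "Inl 0"] m_ac)
  qed (simp add: delete_var_def)
  then show ?thesis unfolding e'_def .
qed

lemma ev_add:
  assumes "\<And>j. a j \<in> carrier K" "\<And>j. b j \<in> carrier K" "y \<in> carrier K"
  shows "ev n (\<lambda>j. a j \<oplus> b j) y = ev n a y \<oplus> ev n b y"
  unfolding ev_def using assms
  by (subst finsum_addf[symmetric]) (auto intro!: finsum_cong' simp: l_distr)

lemma ev_single:
  assumes "c \<le> N" "x \<in> carrier K" "y \<in> carrier K"
  shows "ev (Suc N) (\<lambda>j. if c = j then x else \<zero>) y = x \<otimes> y [^] c"
proof -
  have "ev (Suc N) (\<lambda>j. if c = j then x else \<zero>) y =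
      (\<Oplus>j\<in>{..<Suc N}. if c = j then x \<otimes> y [^] j else \<zero>)"
    unfolding ev_def using assms by (intro finsum_cong') auto
  also have "\<dots> = x \<otimes> y [^] c" using assms by (intro finsum_singleton) auto
  finally show ?thesis .
qed

lemma lin_comb_upd:
  assumes e: "range e \<subseteq> carrier K" and y: "y \<in> carrier K" and g: "\<And>w. g w \<in> carrier K"
  shows "lin_comb (e(k := y)) N g = ev (Suc N) (coeff_at k N e g) y"
proof -
  define e' where "e' = e(k := y)"
  have m: "mono_val e w \<in> carrier K" for w by (rule mono_val_closed[OF e])
  have "range e' \<subseteq> carrier K" using e y by (auto simp: e'_def)
  then have m': "mono_val e' w \<in> carrier K" for w by (rule mono_val_closed)
  have mu: "mono_val e' w = mono_val e (delete_var k w) \<otimes> y [^] count_list w (Inr k)" for w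
    unfolding e'_def by (rule mono_val_upd[OF e y])
  have "(\<Oplus>w\<in>A. g w \<otimes> mono_val e' w) = ev (Suc N) (\<lambda>j. \<Oplus>w\<in>A.
      if count_list w (Inr k) = j then g w \<otimes> mono_val e (delete_var k w) else \<zero>) y" (is "?l A = ev _ (?r A) y")
    if "A \<subseteq> words N" for A
  proof -
    have "finite A" using that by (rule finite_subset) simp
    then show ?thesis using that
    proof (induction A)
      case empty
      show ?case using y by (simp add: ev_zero)
    next
      case (insert w A)
      let ?c = "count_list w (Inr k)" and ?x = "g w \<otimes> mono_val e (delete_var k w)"
      \<comment> \<open>A word of length N has degree at most N in y, whence \<open>Suc N\<close>
        coefficients.\<close>
      have "length w = N" using insert.prems by (auto simp: words_def)
      then have "?c \<le> N" using count_le_length[of w] by auto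
      have x: "?x \<in> carrier K" using g m by auto
      have rc: "?r B j \<in> carrier K" for B j using g m by (intro finsum_closed) auto
      have "?l (insert w A) = g w \<otimes> mono_val e' w \<oplus> ?l A"
        using insert.hyps g m' by (intro finsum_insert) auto
      also have "\<dots> = ?x \<otimes> y [^] ?c \<oplus> ev (Suc N) (?r A) y"
        using insert g m y by (simp add: mu m_assoc)
      also have "?x \<otimes> y [^] ?c = ev (Suc N) (\<lambda>j. if ?c = j then ?x else \<zero>) y"
        by (rule ev_single[symmetric]) fact+
      also have "ev (Suc N) (\<lambda>j. if ?c = j then ?x else \<zero>) y \<oplus> ev (Suc N) (?r A) y =
          ev (Suc N) (\<lambda>j. (if ?c = j then ?x else \<zero>) \<oplus> ?r A j) y"
        using x y rc by (intro ev_add[symmetric]) auto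
      also have "\<dots> = ev (Suc N) (?r (insert w A)) y"
      proof (rule ev_cong)
        show "(if ?c = j then ?x else \<zero>) \<oplus> ?r A j = ?r (insert w A) j" for j
          using insert.hyps g m by (intro finsum_insert[symmetric]) auto
      qed (use rc y in auto)
      finally show ?case .
    qed
  qed
  from this[OF order_refl] show ?thesis unfolding lin_comb_def coeff_at_def e'_def .
qed

lemma coeff_at_mono_span:
  assumes e: "range e \<subseteq> carrier K" and g: "range g \<subseteq> P"
  shows "coeff_at k N e g j \<in> mono_span e N"
  unfolding coeff_at_def using g delete_var_words
  by (intro mono_span_finsum[OF e]) (auto intro!: mono_span_mono_val[OF e] mono_span_zero[OF e])

lemma polyf_coeff_at:
  assumes "range \<kappa> \<subseteq> C" "C \<subseteq> carrier K" "\<And>k. polyf C (\<lambda>z. E z k)" "\<And>w. polyf C (\<lambda>z. g z w)"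
  shows "polyf C (\<lambda>z. coeff_at k N (E z) (g z) j)"
  unfolding coeff_at_def using assms
  by (intro polyf_finsum polyf_if polyf_mult polyf_mono_val polyf_zero) auto

end

context pair_formulas
begin

text \<open>The element \<open>y\<close> is generic, or a root of a polynomial that is irreducible up to the relevant
  degrees; in the latter case its relations are read off from pseudo-remainders. The first case
  does not depend on \<open>e\<close> by the dichotomy, the second is a condition on the coefficients in \<open>P\<close>.\<close>

lemma P_definable_relation_matrix_ex:
  assumes dich: "(\<forall>e. range e \<subseteq> carrier K \<longrightarrow> (\<exists>y\<in>carrier K. generic e N y)) \<or>
    (\<forall>e y. range e \<subseteq> carrier K \<and> y \<in> carrier K \<longrightarrow> \<not> generic e N y)"
  shows "P_definable (\<lambda>e c. \<exists>y\<in>carrier K. relation_matrix (e(k := y)) N c)"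
proof -
  \<comment> \<open>By \<open>dich\<close> a generic element for one e gives one for all, so
    existence enters the condition as a truth constant.\<close>
  define gen where "gen \<longleftrightarrow> (\<forall>e. range e \<subseteq> carrier K \<longrightarrow> (\<exists>y\<in>carrier K. generic e N y))"
  define B where "B d = bnd_B N d" for d
  define C where "C d = bnd_C N d 0" for d
  define k1 where "k1 d = Suc N - d" for d
  define k2 where "k2 d d' = Suc d - d'" for d d' :: nat
  \<comment> \<open>\<open>p\<close> holds the coefficients in P of the minimal polynomial,
    \<open>r\<close> those of the bounded candidates for a factor: one family over the words for
    each power of y. Quantifying over all powers at once is legitimate by finite support.\<close>
  define RHS where "RHS = (\<lambda>e (c :: word \<times> word \<Rightarrow> 'u).
    (gen \<and> (\<forall>g. range g \<subseteq> P \<longrightarrow> ((\<forall>u\<in>words N. (\<Oplus>w\<in>words N. g w \<otimes> c (w, u)) = \<zero>) \<longleftrightarrow>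
        (\<forall>j\<in>{..N}. coeff_at k N e g j = \<zero>)))) \<or>
    (\<exists>d\<in>{1..N}. \<exists>p :: nat \<times> word \<Rightarrow> 'u. range p \<subseteq> P \<and> lin_comb e (B d) (\<lambda>w. p (d, w)) \<noteq> \<zero> \<and>
      (\<forall>d'\<in>{1..<d}. \<forall>r :: nat \<times> word \<Rightarrow> 'u. range r \<subseteq> P \<longrightarrow> lin_comb e (C d) (\<lambda>w. r (d', w)) \<noteq> \<zero> \<longrightarrow>
        \<not> (\<forall>j\<in>{..<d'}. pseudo_rem (\<lambda>j. lin_comb e (C d) (\<lambda>w. r (j, w))) d' (k2 d d')
            (\<lambda>j. lin_comb e (B d) (\<lambda>w. p (j, w))) j = \<zero>)) \<and>
      (\<forall>g. range g \<subseteq> P \<longrightarrow> ((\<forall>u\<in>words N. (\<Oplus>w\<in>words N. g w \<otimes> c (w, u)) = \<zero>) \<longleftrightarrow>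
        (\<forall>j\<in>{..<d}. pseudo_rem (\<lambda>j. lin_comb e (B d) (\<lambda>w. p (j, w))) d (k1 d) (coeff_at k N e g) j = \<zero>)))))"
  have "P_definable RHS"
    unfolding RHS_def
    by (intro P_definable_disj P_definable_conj P_definable_const P_definable_all P_definable_iff P_definable_ball P_definable_bex P_definable_ex P_definable_neg P_definable_imp P_definable_poly
        polyf_finsum polyf_mult polyf_var polyf_lin_comb polyf_pseudo_rem polyf_coeff_at finite_words finite_atMost
        finite_lessThan finite_atLeastAtMost finite_atLeastLessThan) auto
  moreover have "RHS e c \<longleftrightarrow> (\<exists>y\<in>carrier K. relation_matrix (e(k := y)) N c)" if e: "range e \<subseteq> carrier K" for e c
  proof -
    \<comment> \<open>Being a relation matrix of the extended tuple means deciding, for every g,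
      whether the polynomial \<open>coeff_at k N e g\<close> vanishes at y.\<close>
    have rel: "relation_matrix (e(k := y)) N c \<longleftrightarrow> (\<forall>g. range g \<subseteq> P \<longrightarrow>
        (ev (Suc N) (coeff_at k N e g) y = \<zero> \<longleftrightarrow> (\<forall>u\<in>words N. (\<Oplus>w\<in>words N. g w \<otimes> c (w, u)) = \<zero>)))"
      if y: "y \<in> carrier K" for y
    proof -
      have "lin_comb (e(k := y)) N g = ev (Suc N) (coeff_at k N e g) y" if "range g \<subseteq> P" for g
        using that by (intro lin_comb_upd[OF e y]) (auto simp: image_subset_iff)
      then show ?thesis unfolding relation_matrix_def by auto
    qed
    have mono_span: "range p \<subseteq> P \<Longrightarrow> lin_comb e D (\<lambda>w. p (j, w)) \<in> mono_span e D" for p :: "nat \<times> word \<Rightarrow> 'u" and j D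
      by (intro mono_span_lin_comb[OF e]) auto
    \<comment> \<open>Polynomials over a level of the span are the same as families of coefficients
      in P, which quantifiers over P can reach.\<close>
    have lift: "\<exists>p :: nat \<times> word \<Rightarrow> 'u. range p \<subseteq> P \<and> m = (\<lambda>j. lin_comb e D (\<lambda>w. p (j, w)))"
      if "\<And>j. m j \<in> mono_span e D" for m D
    proof -
      have "\<forall>j. \<exists>g. m j = lin_comb e D g \<and> (\<forall>w. g w \<in> P)" using that unfolding mono_span_def by blast
      then obtain g where g: "\<And>j. m j = lin_comb e D (g j)" "\<And>j w. g j w \<in> P" by metis
      show ?thesis by (rule exI[of _ "\<lambda>(j, w). g j w"]) (use g in auto)
    qed
    have irred_upto_iff: "irred_upto e D d m \<longleftrightarrow> (\<forall>d'\<in>{1..<d}. \<forall>r :: nat \<times> word \<Rightarrow> 'u. range r \<subseteq> P \<longrightarrow>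
        lin_comb e D (\<lambda>w. r (d', w)) \<noteq> \<zero> \<longrightarrow>
        \<not> (\<forall>j\<in>{..<d'}. pseudo_rem (\<lambda>j. lin_comb e D (\<lambda>w. r (j, w))) d' (k2 d d') m j = \<zero>))" for D d m
    proof
      assume i: "irred_upto e D d m"
      show "\<forall>d'\<in>{1..<d}. \<forall>r :: nat \<times> word \<Rightarrow> 'u. range r \<subseteq> P \<longrightarrow>
        lin_comb e D (\<lambda>w. r (d', w)) \<noteq> \<zero> \<longrightarrow>
        \<not> (\<forall>j\<in>{..<d'}. pseudo_rem (\<lambda>j. lin_comb e D (\<lambda>w. r (j, w))) d' (k2 d d') m j = \<zero>)"
      proof (intro ballI allI impI notI)
        fix d' and r :: "nat \<times> word \<Rightarrow> 'u"
        assume d': "d' \<in> {1..<d}" and r: "range r \<subseteq> P" and nz: "lin_comb e D (\<lambda>w. r (d', w)) \<noteq> \<zero>"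
          and z: "\<forall>j\<in>{..<d'}. pseudo_rem (\<lambda>j. lin_comb e D (\<lambda>w. r (j, w))) d' (k2 d d') m j = \<zero>"
        have "1 \<le> d' \<and> d' < d \<and> (\<forall>j. lin_comb e D (\<lambda>w. r (j, w)) \<in> mono_span e D) \<and> lin_comb e D (\<lambda>w. r (d', w)) \<noteq> \<zero>"
          using d' nz mono_span[OF r] by auto
        then have "\<exists>j<d'. pseudo_rem (\<lambda>j. lin_comb e D (\<lambda>w. r (j, w))) d' (Suc d - d') m j \<noteq> \<zero>"
          using i[unfolded irred_upto_def[OF e], rule_format, of d' "\<lambda>j. lin_comb e D (\<lambda>w. r (j, w))"] by blast
        then show False using z unfolding k2_def by auto
      qed
    next
      assume r: "\<forall>d'\<in>{1..<d}. \<forall>r :: nat \<times> word \<Rightarrow> 'u. range r \<subseteq> P \<longrightarrow>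
        lin_comb e D (\<lambda>w. r (d', w)) \<noteq> \<zero> \<longrightarrow>
        \<not> (\<forall>j\<in>{..<d'}. pseudo_rem (\<lambda>j. lin_comb e D (\<lambda>w. r (j, w))) d' (k2 d d') m j = \<zero>)"
      show "irred_upto e D d m" unfolding irred_upto_def[OF e]
      proof (intro allI impI)
        fix d' n assume n: "1 \<le> d' \<and> d' < d \<and> (\<forall>j. n j \<in> mono_span e D) \<and> n d' \<noteq> \<zero>"
        then obtain q :: "nat \<times> word \<Rightarrow> 'u" where q: "range q \<subseteq> P" "n = (\<lambda>j. lin_comb e D (\<lambda>w. q (j, w)))"
          using lift[of n D] by auto
        have "d' \<in> {1..<d}" using n by simp
        then have "\<not> (\<forall>j\<in>{..<d'}. pseudo_rem n d' (k2 d d') m j = \<zero>)" using r q n by simp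
        then show "\<exists>j<d'. pseudo_rem n d' (Suc d - d') m j \<noteq> \<zero>" unfolding k2_def by auto
      qed
    qed
    show ?thesis
    proof
      assume "\<exists>y\<in>carrier K. relation_matrix (e(k := y)) N c"
      then obtain y where y: "y \<in> carrier K" and rm: "\<And>g. range g \<subseteq> P \<Longrightarrow>
        ev (Suc N) (coeff_at k N e g) y = \<zero> \<longleftrightarrow> (\<forall>u\<in>words N. (\<Oplus>w\<in>words N. g w \<otimes> c (w, u)) = \<zero>)"
        using rel by blast
      show "RHS e c"
      proof (cases "generic e N y")
        case True
        then have gen: gen using dich e y unfolding gen_def by blast
        have "(\<forall>u\<in>words N. (\<Oplus>w\<in>words N. g w \<otimes> c (w, u)) = \<zero>) \<longleftrightarrow> (\<forall>j\<in>{..N}. coeff_at k N e g j = \<zero>)"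
          if g: "range g \<subseteq> P" for g
        proof -
          have "ev (Suc N) (coeff_at k N e g) y = \<zero> \<longleftrightarrow> (\<forall>j\<in>{..N}. coeff_at k N e g j = \<zero>)"
          proof
            assume "ev (Suc N) (coeff_at k N e g) y = \<zero>"
            then show "\<forall>j\<in>{..N}. coeff_at k N e g j = \<zero>"
              using True coeff_at_mono_span[OF e g] unfolding generic_def[OF e] by blast
          next
            assume "\<forall>j\<in>{..N}. coeff_at k N e g j = \<zero>"
            then show "ev (Suc N) (coeff_at k N e g) y = \<zero>" using y by (intro ev_zero) auto
          qed
          then show ?thesis using rm[OF g] by blast
        qed
        then show ?thesis unfolding RHS_def using gen by blast
      next
        case False
        obtain d m where dm: "1 \<le> d" "d \<le> N" "\<And>j. m j \<in> mono_span e (bnd_B N d)" "m d \<noteq> \<zero>"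
          "irred_upto e (bnd_C N d 0) d m"
          "\<forall>a. (\<forall>j. a j \<in> mono_span e N) \<longrightarrow>
            (ev (Suc N) a y = \<zero> \<longleftrightarrow> (\<forall>j<d. pseudo_rem m d (Suc N - d) a j = \<zero>))"
          using minimal_relation[OF e y False] by blast
        obtain p :: "nat \<times> word \<Rightarrow> 'u" where p: "range p \<subseteq> P" "m = (\<lambda>j. lin_comb e (B d) (\<lambda>w. p (j, w)))"
          using lift[of m "B d"] dm(3) unfolding B_def by auto
        have irred_upto: "irred_upto e (C d) d m" using dm(5) unfolding C_def .
        have "(\<forall>u\<in>words N. (\<Oplus>w\<in>words N. g w \<otimes> c (w, u)) = \<zero>) \<longleftrightarrow>
            (\<forall>j\<in>{..<d}. pseudo_rem m d (k1 d) (coeff_at k N e g) j = \<zero>)" if g: "range g \<subseteq> P" for g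
          using rm[OF g] dm(6)[rule_format, of "coeff_at k N e g"] coeff_at_mono_span[OF e g] unfolding k1_def by auto
        then show ?thesis unfolding RHS_def
          using dm(1,2,4) irred_upto[unfolded irred_upto_iff] p(1) unfolding p(2)
          by (intro disjI2 bexI[of _ d] exI[of _ p]) auto
      qed
    next
      assume "RHS e c"
      then show "\<exists>y\<in>carrier K. relation_matrix (e(k := y)) N c"
        unfolding RHS_def
      proof (elim disjE conjE bexE exE)
        assume gen and g: "\<forall>g. range g \<subseteq> P \<longrightarrow> ((\<forall>u\<in>words N. (\<Oplus>w\<in>words N. g w \<otimes> c (w, u)) = \<zero>) \<longleftrightarrow>
          (\<forall>j\<in>{..N}. coeff_at k N e g j = \<zero>))"
        then obtain y where y: "y \<in> carrier K" "generic e N y" using e unfolding gen_def by blast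
        have "ev (Suc N) (coeff_at k N e g) y = \<zero> \<longleftrightarrow> (\<forall>j\<in>{..N}. coeff_at k N e g j = \<zero>)"
          if "range g \<subseteq> P" for g
        proof
          assume "ev (Suc N) (coeff_at k N e g) y = \<zero>"
          then show "\<forall>j\<in>{..N}. coeff_at k N e g j = \<zero>"
            using y coeff_at_mono_span[OF e that] unfolding generic_def[OF e] by blast
        next
          assume "\<forall>j\<in>{..N}. coeff_at k N e g j = \<zero>"
          then show "ev (Suc N) (coeff_at k N e g) y = \<zero>" using y by (intro ev_zero) auto
        qed
        then show ?thesis using g rel[OF y(1)] y(1) by (intro bexI[of _ y]) simp_all
      next
        fix d and p :: "nat \<times> word \<Rightarrow> 'u"
        define m where "m = (\<lambda>j. lin_comb e (B d) (\<lambda>w. p (j, w)))"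
        assume d: "d \<in> {1..N}" and p: "range p \<subseteq> P" and nz: "lin_comb e (B d) (\<lambda>w. p (d, w)) \<noteq> \<zero>"
          and irred_upto: "\<forall>d'\<in>{1..<d}. \<forall>r :: nat \<times> word \<Rightarrow> 'u. range r \<subseteq> P \<longrightarrow> lin_comb e (C d) (\<lambda>w. r (d', w)) \<noteq> \<zero> \<longrightarrow>
        \<not> (\<forall>j\<in>{..<d'}. pseudo_rem (\<lambda>j. lin_comb e (C d) (\<lambda>w. r (j, w))) d' (k2 d d')
            (\<lambda>j. lin_comb e (B d) (\<lambda>w. p (j, w))) j = \<zero>)"
          and g: "\<forall>g. range g \<subseteq> P \<longrightarrow> ((\<forall>u\<in>words N. (\<Oplus>w\<in>words N. g w \<otimes> c (w, u)) = \<zero>) \<longleftrightarrow>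
        (\<forall>j\<in>{..<d}. pseudo_rem (\<lambda>j. lin_comb e (B d) (\<lambda>w. p (j, w))) d (k1 d) (coeff_at k N e g) j = \<zero>))"
        have i: "irred_upto e (bnd_C N d 0) d m" using irred_upto unfolding irred_upto_iff m_def C_def .
        have mS: "m j \<in> mono_span e (bnd_B N d)" for j unfolding m_def B_def by (rule mono_span[OF p])
        have mz: "m d \<noteq> \<zero>" using nz unfolding m_def .
        obtain y where y: "y \<in> carrier K" "\<forall>a. (\<forall>j. a j \<in> mono_span e N) \<longrightarrow>
            (ev (Suc N) a y = \<zero> \<longleftrightarrow> (\<forall>j<d. pseudo_rem m d (Suc N - d) a j = \<zero>))"
          using root_of_irreducible[OF e _ _ mS mz i] d by auto
        have "relation_matrix (e(k := y)) N c"
          unfolding rel[OF y(1)]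
        proof (intro allI impI)
          fix g' :: "word \<Rightarrow> 'u" assume g': "range g' \<subseteq> P"
          show "ev (Suc N) (coeff_at k N e g') y = \<zero> \<longleftrightarrow>
              (\<forall>u\<in>words N. (\<Oplus>w\<in>words N. g' w \<otimes> c (w, u)) = \<zero>)"
            using y(2)[rule_format, of "coeff_at k N e g'"] coeff_at_mono_span[OF e g'] g[rule_format, OF g']
            unfolding k1_def m_def by auto
        qed
        then show ?thesis using y(1) by blast
      qed
    qed
  qed
  ultimately show ?thesis by (rule P_definable_cong)
qed

text \<open>What \<open>\<Theta>\<close> says about \<open>e(k := y)\<close> depends only on a
  relation matrix of that tuple. So the quantifier over y becomes one over matrices c in P, subject
  to the condition that some y has c as its matrix.\<close>

lemma P_definable_exK:
  fixes \<Theta> :: "(nat \<Rightarrow> 'u) \<Rightarrow> ('i :: countable \<Rightarrow> 'u) \<Rightarrow> bool"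
  assumes dich: "\<And>N. N \<ge> N0 \<Longrightarrow> (\<forall>e. range e \<subseteq> carrier K \<longrightarrow> (\<exists>y\<in>carrier K. generic e N y)) \<or>
    (\<forall>e y. range e \<subseteq> carrier K \<and> y \<in> carrier K \<longrightarrow> \<not> generic e N y)"
    and \<Theta>: "P_definable \<Theta>"
  shows "P_definable (\<lambda>e q. \<exists>y\<in>carrier K. \<Theta> (e(k := y)) q)"
proof -
  obtain N1 \<chi> where \<chi>: "\<And>N. N \<ge> N1 \<Longrightarrow> definable (\<chi> N)"
    "\<And>N e c q. N \<ge> N1 \<Longrightarrow> range e \<subseteq> carrier K \<Longrightarrow> range c \<subseteq> P \<Longrightarrow> range q \<subseteq> P \<Longrightarrow> relation_matrix e N c \<Longrightarrow>
      \<Theta> e q \<longleftrightarrow> \<chi> N (case_sum c q)" using P_definableE[OF \<Theta>] by blast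
  \<comment> \<open>One level that serves both the dichotomy and the normal form of
    \<open>\<Theta>\<close>; the level in e of the result comes from
    \<open>P_definable_relation_matrix_ex\<close>.\<close>
  define N where "N = max N0 N1"
  have N: "N \<ge> N0" "N \<ge> N1" by (simp_all add: N_def)
  \<comment> \<open>Swaps the two blocks of indices, as \<open>P_definable_ex\<close> binds the
    right-hand one.\<close>
  define s where "s = (case_sum Inr Inl :: (word \<times> word) + 'i \<Rightarrow> 'i + (word \<times> word))"
  have s: "inj s" by (rule injI) (auto simp: s_def split: sum.splits)
  have eq: "z \<circ> s = case_sum (\<lambda>j. z (Inr j)) (\<lambda>i. z (Inl i))" for z :: "'i + word \<times> word \<Rightarrow> 'u"
    by (rule ext) (simp add: s_def split: sum.splits)
  have "P_definable (\<lambda>e (z :: 'i + word \<times> word \<Rightarrow> 'u).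
      (\<exists>y\<in>carrier K. relation_matrix (e(k := y)) N (\<lambda>j. z (Inr j))) \<and>
      \<chi> N (case_sum (\<lambda>j. z (Inr j)) (\<lambda>i. z (Inl i))))"
    unfolding eq[symmetric]
    by (intro P_definable_conj P_definable_reindex[OF P_definable_relation_matrix_ex[OF dich[OF N(1)]]] P_definable_definable definable_reindex \<chi>(1)[OF N(2)] s)
  from P_definable_ex[where \<Theta> = "\<lambda>e q c. (\<exists>y\<in>carrier K. relation_matrix (e(k := y)) N c) \<and> \<chi> N (case_sum c q)", OF this]
  have "P_definable (\<lambda>e q. \<exists>c. range c \<subseteq> P \<and> (\<exists>y\<in>carrier K. relation_matrix (e(k := y)) N c) \<and> \<chi> N (case_sum c q))" .
  then show ?thesis
  proof (rule P_definable_cong)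
    fix e :: "nat \<Rightarrow> 'u" and q :: "'i \<Rightarrow> 'u" assume e: "range e \<subseteq> carrier K" and q: "range q \<subseteq> P"
    have u: "range (e(k := y)) \<subseteq> carrier K" if "y \<in> carrier K" for y using e that by auto
    show "(\<exists>c. range c \<subseteq> P \<and> (\<exists>y\<in>carrier K. relation_matrix (e(k := y)) N c) \<and> \<chi> N (case_sum c q)) \<longleftrightarrow>
        (\<exists>y\<in>carrier K. \<Theta> (e(k := y)) q)"
    proof
      assume "\<exists>c. range c \<subseteq> P \<and> (\<exists>y\<in>carrier K. relation_matrix (e(k := y)) N c) \<and> \<chi> N (case_sum c q)"
      then show "\<exists>y\<in>carrier K. \<Theta> (e(k := y)) q" using \<chi>(2)[OF N(2) u _ q] by blast
    next
      assume "\<exists>y\<in>carrier K. \<Theta> (e(k := y)) q"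
      then obtain y where y: "y \<in> carrier K" "\<Theta> (e(k := y)) q" by blast
      obtain c where c: "range c \<subseteq> P" "relation_matrix (e(k := y)) N c" using relation_matrix_exists[OF u[OF y(1)]] by blast
      then show "\<exists>c. range c \<subseteq> P \<and> (\<exists>y\<in>carrier K. relation_matrix (e(k := y)) N c) \<and> \<chi> N (case_sum c q)"
        using \<chi>(2)[OF N(2) u[OF y(1)] c(1) q c(2)] y by blast
    qed
  qed
qed

end

section \<open>Formulas of the pair\<close>

locale pair_model = pair_formulas K P \<kappa> L PM for K :: "'u ring" (structure) and P \<kappa>
    and L :: "('f ring_sym, 'r) language" and PM +
  fixes M :: "('f ring_sym, 'r plus_P, 'u) struct"
  assumes M_structure: "is_structure (L_P L) M" and M_univ: "univ M = carrier K"
    and M_Zero: "fun_int M Zero [] = \<zero>" and M_One: "fun_int M One [] = \<one>"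
    and M_Plus: "fun_int M Plus [x, y] = x \<oplus> y" and M_Times: "fun_int M Times [x, y] = x \<otimes> y"
    and M_Minus: "x \<in> carrier K \<Longrightarrow> fun_int M Minus [x] = \<ominus> x"
    and M_P: "x \<in> carrier K \<Longrightarrow> rel_int M Pred_P [x] \<longleftrightarrow> x \<in> P"
    and M_fun: "fun_ar L (Other f) = Some (length xs) \<Longrightarrow> set xs \<subseteq> carrier K \<Longrightarrow>
      fun_int M (Other f) xs = (if set xs \<subseteq> P then fun_int PM (Other f) xs else \<zero>)"
    and M_rel: "rel_ar L R = Some (length xs) \<Longrightarrow> set xs \<subseteq> carrier K \<Longrightarrow>
      rel_int M (Old R) xs \<longleftrightarrow> set xs \<subseteq> P \<and> rel_int PM R xs"
    and dichotomy: "\<exists>N0. \<forall>N\<ge>N0. (\<forall>e. range e \<subseteq> carrier K \<longrightarrow> (\<exists>y\<in>carrier K. generic e N y)) \<or>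
      (\<forall>e y. range e \<subseteq> carrier K \<and> y \<in> carrier K \<longrightarrow> \<not> generic e N y)"
begin

section \<open>Terms as polynomials with auxiliary values in P\<close>

abbreviation pol :: "((nat \<Rightarrow> 'u) \<Rightarrow> ('i \<Rightarrow> 'u) \<Rightarrow> 'u) \<Rightarrow> bool" where
  "pol F \<equiv> polyf (range \<kappa>) (\<lambda>z. F (\<lambda>k. z (Inl k)) (\<lambda>i. z (Inr i)))"

lemma polyf_sub:
  assumes "pol F" "\<And>k. polyf (range \<kappa>) (\<lambda>z. E z k)" "\<And>i. polyf (range \<kappa>) (\<lambda>z. g z i)"
  shows "polyf (range \<kappa>) (\<lambda>z. F (E z) (g z))"
proof -
  have "polyf (range \<kappa>) (\<lambda>z. case x of Inl k \<Rightarrow> E z k | Inr i \<Rightarrow> g z i)" for x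
    using assms(2,3) by (cases x) simp_all
  from polyf_comp[where G = "\<lambda>x z. case x of Inl k \<Rightarrow> E z k | Inr i \<Rightarrow> g z i", OF assms(1) _ this]
  show ?thesis by (simp add: image_subset_iff)
qed

text \<open>The values of the function symbols outside the language of rings lie in \<open>P\<close>, so a term is a
  polynomial in its variables and in finitely many such values.\<close>

definition representable :: "'f ring_sym tm \<Rightarrow> bool" where
  "representable t \<longleftrightarrow> (\<exists>F A. pol F \<and> P_definable A \<and> (\<forall>e. range e \<subseteq> carrier K \<longrightarrow>
     (\<exists>r :: nat \<Rightarrow> 'u. range r \<subseteq> P \<and> A e r) \<and>
     (\<forall>r. range r \<subseteq> P \<and> A e r \<longrightarrow> tm_val M e t = F e r)))"

text \<open>The auxiliary values of term i occupy row \<open>Suc i\<close> of the pairing, so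
  different terms do not interfere; position \<open>prod_encode (0, 0)\<close> stays free for the
  value of a function symbol applied to the whole list.\<close>

lemma representable_list:
  assumes "\<forall>t\<in>set ts. representable t"
  obtains F A where "\<And>i. pol (F i)" "P_definable A"
    "\<And>e v. range e \<subseteq> carrier K \<Longrightarrow> v \<in> P \<Longrightarrow>
       \<exists>r :: nat \<Rightarrow> 'u. range r \<subseteq> P \<and> r (prod_encode (0, 0)) = v \<and> A e r"
    "\<And>e r i. range e \<subseteq> carrier K \<Longrightarrow> range r \<subseteq> P \<Longrightarrow> A e r \<Longrightarrow> i < length ts \<Longrightarrow>
       tm_val M e (ts ! i) = F i e r"
proof -
  have "\<forall>i. \<exists>F A. pol F \<and> P_definable A \<and> (\<forall>e. range e \<subseteq> carrier K \<longrightarrow>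
     (\<exists>r :: nat \<Rightarrow> 'u. range r \<subseteq> P \<and> A e r) \<and>
     (\<forall>r. range r \<subseteq> P \<and> A e r \<longrightarrow> i < length ts \<longrightarrow> tm_val M e (ts ! i) = F e r))"
  proof
    fix i
    show "\<exists>F A. pol F \<and> P_definable A \<and> (\<forall>e. range e \<subseteq> carrier K \<longrightarrow>
     (\<exists>r :: nat \<Rightarrow> 'u. range r \<subseteq> P \<and> A e r) \<and>
     (\<forall>r. range r \<subseteq> P \<and> A e r \<longrightarrow> i < length ts \<longrightarrow> tm_val M e (ts ! i) = F e r))"
    proof (cases "i < length ts")
      case True
      then have "representable (ts ! i)" using assms by simp
      then obtain F and A :: "(nat \<Rightarrow> 'u) \<Rightarrow> (nat \<Rightarrow> 'u) \<Rightarrow> bool" where "pol F" "P_definable A"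
        "\<forall>e. range e \<subseteq> carrier K \<longrightarrow> (\<exists>r. range r \<subseteq> P \<and> A e r) \<and>
          (\<forall>r. range r \<subseteq> P \<and> A e r \<longrightarrow> tm_val M e (ts ! i) = F e r)"
        unfolding representable_def by (elim exE conjE) (rule that)
      then show ?thesis by (intro exI[of _ F] exI[of _ A]) simp
    next
      case False
      have "pol (\<lambda>e (r :: nat \<Rightarrow> 'u). \<zero>) \<and> P_definable (\<lambda>e (r :: nat \<Rightarrow> 'u). True)"
        by (simp add: P_definable_const)
      moreover have "\<exists>r :: nat \<Rightarrow> 'u. range r \<subseteq> P" by (rule exI[of _ "\<lambda>_. \<zero>"]) simp
      ultimately show ?thesis using False
        by (intro exI[of _ "\<lambda>e r. \<zero>"] exI[of _ "\<lambda>e r. True"]) simp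
    qed
  qed
  then obtain F A where FA: "\<forall>i. pol (F i) \<and> P_definable (A i) \<and> (\<forall>e. range e \<subseteq> carrier K \<longrightarrow>
     (\<exists>r :: nat \<Rightarrow> 'u. range r \<subseteq> P \<and> A i e r) \<and>
     (\<forall>r. range r \<subseteq> P \<and> A i e r \<longrightarrow> i < length ts \<longrightarrow> tm_val M e (ts ! i) = F i e r))"
    unfolding choice_iff by (elim exE) (rule that)
  have F: "pol (F i)" and A: "P_definable (A i)" for i using FA by simp_all
  have ex: "\<exists>r :: nat \<Rightarrow> 'u. range r \<subseteq> P \<and> A i e r" if "range e \<subseteq> carrier K" for i e
    using FA that by simp
  have val: "tm_val M e (ts ! i) = F i e r"
    if "range e \<subseteq> carrier K" "range r \<subseteq> P" "A i e r" "i < length ts" for i e r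
    using FA that by simp
  define G where "G i e r = F i e (\<lambda>k. r (prod_encode (Suc i, k)))" for i and e r :: "nat \<Rightarrow> 'u"
  define B where "B e r \<longleftrightarrow> (\<forall>i\<in>{..<length ts}. A i e (\<lambda>k. r (prod_encode (Suc i, k))))"
    for e r :: "nat \<Rightarrow> 'u"
  have "pol (G i)" for i unfolding G_def by (intro polyf_sub[OF F] polyf_var)
  moreover have "P_definable B" unfolding B_def by (intro P_definable_ball finite_lessThan P_definable_reindex[OF A])
  moreover have "\<exists>r :: nat \<Rightarrow> 'u. range r \<subseteq> P \<and> r (prod_encode (0, 0)) = v \<and> B e r"
    if e: "range e \<subseteq> carrier K" and v: "v \<in> P" for e v
  proof -
    obtain r where r: "\<And>i. range (r i) \<subseteq> P \<and> A i e (r i)" using ex[OF e] by metis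
    define r' where "r' n = (case prod_decode n of (0, _) \<Rightarrow> v | (Suc i, k) \<Rightarrow> r i k)" for n
    have "(\<lambda>k. r' (prod_encode (Suc i, k))) = r i" for i by (simp add: r'_def)
    then have "B e r'" unfolding B_def using r by simp
    moreover have "r' n \<in> P" for n using r v by (auto simp: r'_def image_subset_iff split: prod.split nat.split)
    ultimately show ?thesis by (intro exI[of _ r']) (auto simp: r'_def)
  qed
  moreover have "tm_val M e (ts ! i) = G i e r"
    if e: "range e \<subseteq> carrier K" and r: "range r \<subseteq> P" "B e r" and i: "i < length ts" for e r i
  proof -
    have "range (\<lambda>k. r (prod_encode (Suc i, k))) \<subseteq> P" using r(1) by auto
    then show ?thesis unfolding G_def using r(2) i by (intro val[OF e]) (auto simp: B_def)
  qed
  ultimately show ?thesis by (rule that)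
qed

lemma definable_graph:
  assumes "fun_ar L f = Some n"
  shows "definable (\<lambda>q :: nat \<Rightarrow> 'u. q 0 = fun_int PM f (map (\<lambda>i. q (Suc i)) [0..<n]))"
proof -
  have "definable (\<lambda>q. sat PM q (Eq (Var 0) (Fn f (map (\<lambda>i. Var (Suc i)) [0..<n]))))"
    using assms by (intro definable_sat) (simp add: list_all_iff)
  then show ?thesis by (simp add: o_def)
qed

lemma definable_rel:
  assumes "rel_ar L R = Some n"
  shows "definable (\<lambda>q :: nat \<Rightarrow> 'u. rel_int PM R (map q [0..<n]))"
proof -
  have "definable (\<lambda>q. sat PM q (Rel R (map Var [0..<n])))"
    using assms by (intro definable_sat) (simp add: list_all_iff)
  then show ?thesis by (simp add: o_def)
qed

lemma M_tm_closed: "range e \<subseteq> carrier K \<Longrightarrow> is_term L t \<Longrightarrow> tm_val M e t \<in> carrier K"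
  using tm_val_closed[OF M_structure, of e t] M_univ by simp

lemma term_representable: "is_term L t \<Longrightarrow> representable t"
proof (induction t)
  case (Var x)
  have "pol (\<lambda>e (r :: nat \<Rightarrow> 'u). e x)" "P_definable (\<lambda>e (r :: nat \<Rightarrow> 'u). True)"
    by (simp_all add: P_definable_const)
  moreover have "\<exists>r :: nat \<Rightarrow> 'u. range r \<subseteq> P" by (rule exI[of _ "\<lambda>_. \<zero>"]) simp
  ultimately show ?case unfolding representable_def by (intro exI[of _ "\<lambda>e r. e x"] exI[of _ "\<lambda>e r. True"]) simp
next
  case (Fn f ts)
  then have "\<forall>t\<in>set ts. representable t" by (auto simp: list_all_iff)
  then obtain F A where F: "\<And>i. pol (F i)" and A: "P_definable A"
    and ex: "\<And>e v. range e \<subseteq> carrier K \<Longrightarrow> v \<in> P \<Longrightarrow>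
       \<exists>r :: nat \<Rightarrow> 'u. range r \<subseteq> P \<and> r (prod_encode (0, 0)) = v \<and> A e r"
    and val: "\<And>e r i. range e \<subseteq> carrier K \<Longrightarrow> range r \<subseteq> P \<Longrightarrow> A e r \<Longrightarrow> i < length ts \<Longrightarrow>
       tm_val M e (ts ! i) = F i e r"
    by (rule representable_list) (rule that)
  have ex': "\<exists>r. range r \<subseteq> P \<and> A e r" if "range e \<subseteq> carrier K" for e
    using ex[OF that P_zero] by blast
  have ar: "fun_ar L f = Some (length ts)" using Fn.prems by simp
  have tC: "tm_val M e (ts ! i) \<in> carrier K" if "range e \<subseteq> carrier K" "i < length ts" for e i
    using M_tm_closed[OF that(1)] Fn.prems that(2) by (auto simp: list_all_iff)
  have I: "representable (Fn f ts)" if "pol G"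
    "\<And>e r. range e \<subseteq> carrier K \<Longrightarrow> range r \<subseteq> P \<Longrightarrow> A e r \<Longrightarrow> tm_val M e (Fn f ts) = G e r" for G
    unfolding representable_def using that A ex' by (intro exI[of _ G] exI[of _ A]) blast
  show ?case
  proof (cases f)
    case Zero
    then show ?thesis using ar M_Zero by (intro I[of "\<lambda>e r. \<zero>"]) auto
  next
    case One
    then show ?thesis using ar M_One by (intro I[of "\<lambda>e r. \<one>"]) auto
  next
    case Plus
    then obtain s t where "ts = [s, t]" using ar by (auto simp: numeral_2_eq_2 length_Suc_conv Suc_length_conv)
    then show ?thesis using Plus val[of _ _ 0] val[of _ _ 1] M_Plus
      by (intro I[of "\<lambda>e r. F 0 e r \<oplus> F 1 e r"] polyf_add F) simp
  next
    case Times
    then obtain s t where "ts = [s, t]" using ar by (auto simp: numeral_2_eq_2 length_Suc_conv Suc_length_conv)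
    then show ?thesis using Times val[of _ _ 0] val[of _ _ 1] M_Times
      by (intro I[of "\<lambda>e r. F 0 e r \<otimes> F 1 e r"] polyf_mult F) simp
  next
    case Minus
    then obtain t where "ts = [t]" using ar by (auto simp: length_Suc_conv Suc_length_conv)
    then show ?thesis using Minus val[of _ _ 0, symmetric] M_Minus tC[of _ 0]
      by (intro I[of "\<lambda>e r. \<ominus> F 0 e r"] polyf_neg F) simp
  next
    case (Other g)
    define n where "n = length ts"
    let ?z = "prod_encode (0, 0)"
    \<comment> \<open>Membership of an argument in P is again a quantifier over P,
      \<open>F i e r = p 0\<close> for some p. The two disjuncts are the two cases of the axioms for
      a function symbol outside the language of rings.\<close>
    define B where "B e r \<longleftrightarrow> A e r \<and> ((\<exists>p :: nat \<Rightarrow> 'u. range p \<subseteq> P \<and>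
        ((\<forall>i\<in>{..<n}. F i e r = p i) \<and> r ?z = fun_int PM f (map p [0..<n]))) \<or>
        ((\<exists>i\<in>{..<n}. \<not> (\<exists>p :: nat \<Rightarrow> 'u. range p \<subseteq> P \<and> F i e r = p 0)) \<and> r ?z = \<zero>))"
      for e r :: "nat \<Rightarrow> 'u"
    have gr: "P_definable (\<lambda>e (z :: nat + nat \<Rightarrow> 'u). z (Inl ?z) = fun_int PM f (map (\<lambda>i. z (Inr i)) [0..<n]))"
      using P_definable_reindex[OF P_definable_definable[OF definable_graph[OF ar[folded n_def]]],
          of "\<lambda>k. case k of 0 \<Rightarrow> Inl ?z | Suc i \<Rightarrow> Inr i"] by simp
    have "P_definable B" unfolding B_def
      by (intro P_definable_conj P_definable_disj P_definable_ex A P_definable_ball P_definable_bex P_definable_neg P_definable_poly_eq polyf_sub[OF F] polyf_var gr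
          polyf_zero finite_lessThan)
    moreover have "\<exists>r. range r \<subseteq> P \<and> B e r" if e: "range e \<subseteq> carrier K" for e
    proof (cases "set (map (tm_val M e) ts) \<subseteq> P")
      case True
      define p where "p i = (if i < n then tm_val M e (ts ! i) else \<zero>)" for i
      have p: "range p \<subseteq> P" using True by (auto simp: p_def n_def)
      have mp: "map p [0..<n] = map (tm_val M e) ts"
        by (rule nth_equalityI) (auto simp: p_def n_def)
      have "fun_int PM f (map p [0..<n]) \<in> univ PM"
        by (rule is_structure_fun[OF PM_structure]) (use ar p in \<open>auto simp: PM_univ n_def\<close>)
      then obtain r where r: "range r \<subseteq> P" "r ?z = fun_int PM f (map p [0..<n])" "A e r"
        using ex[OF e] PM_univ by blast
      then have "\<forall>i\<in>{..<n}. F i e r = p i" using val[OF e r(1,3)] by (simp add: p_def n_def)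
      then have "B e r" unfolding B_def using r p by blast
      then show ?thesis using r(1) by blast
    next
      case False
      then obtain t where "t \<in> set ts" "tm_val M e t \<notin> P" by auto
      then obtain i where i: "i < n" "tm_val M e (ts ! i) \<notin> P"
        unfolding in_set_conv_nth n_def by auto
      obtain r where r: "range r \<subseteq> P" "r ?z = \<zero>" "A e r" using ex[OF e P_zero] by blast
      then have "F i e r \<notin> P" using val[OF e r(1,3)] i by (simp add: n_def)
      then have "\<not> (\<exists>p :: nat \<Rightarrow> 'u. range p \<subseteq> P \<and> F i e r = p 0)" by auto
      then have "B e r" unfolding B_def using r i(1) by blast
      then show ?thesis using r(1) by blast
    qed
    moreover have "tm_val M e (Fn f ts) = r ?z"
      if e: "range e \<subseteq> carrier K" and r: "range r \<subseteq> P" and B: "B e r" for e r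
    proof -
      have Ar: "A e r" using B unfolding B_def by blast
      have v: "tm_val M e (ts ! i) = F i e r" if "i < n" for i
        using val[OF e r Ar] that by (simp add: n_def)
      have mf: "tm_val M e (Fn f ts) = (if set (map (tm_val M e) ts) \<subseteq> P
          then fun_int PM f (map (tm_val M e) ts) else \<zero>)"
      proof -
        have "set (map (tm_val M e) ts) \<subseteq> carrier K"
          using tC[OF e] by (auto simp: in_set_conv_nth)
        then show ?thesis using M_fun[of g "map (tm_val M e) ts"] ar Other by simp
      qed
      from B show ?thesis unfolding B_def
      proof (elim conjE disjE exE bexE)
        fix p :: "nat \<Rightarrow> 'u" assume p: "range p \<subseteq> P" "\<forall>i\<in>{..<n}. F i e r = p i"
          "r ?z = fun_int PM f (map p [0..<n])"
        have mp: "map p [0..<n] = map (tm_val M e) ts"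
          by (rule nth_equalityI) (use p v in \<open>auto simp: n_def\<close>)
        have "set (map p [0..<n]) \<subseteq> P" using p by auto
        then show ?thesis unfolding mf mp[symmetric] using p(3) by simp
      next
        fix i assume i: "i \<in> {..<n}" "\<not> (\<exists>p :: nat \<Rightarrow> 'u. range p \<subseteq> P \<and> F i e r = p 0)" "r ?z = \<zero>"
        have "F i e r \<notin> P"
        proof
          assume "F i e r \<in> P"
          then have "range (\<lambda>_ :: nat. F i e r) \<subseteq> P" by auto
          then show False using i(2) by blast
        qed
        moreover have "tm_val M e (ts ! i) \<in> set (map (tm_val M e) ts)" using i(1) by (simp add: n_def)
        ultimately have "\<not> set (map (tm_val M e) ts) \<subseteq> P" using v[of i] i(1) by auto
        then show ?thesis unfolding mf using i(3) by simp
      qed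
    qed
    moreover have "pol (\<lambda>e r. r ?z)" by simp
    ultimately show ?thesis unfolding representable_def
      by (intro exI[of _ "\<lambda>e r. r ?z"] exI[of _ B]) blast
  qed
qed

text \<open>Atoms reduce to polynomial equations and conditions on P because terms are
  representable: quantifying existentially over the auxiliary values r loses nothing, as every
  admissible r yields the same values of the terms. Quantifiers over K fall to
  \<open>P_definable_exK\<close>; q is a dummy family.\<close>

theorem formula_P_definable:
  "is_formula (L_P L) \<phi> \<Longrightarrow> P_definable (\<lambda>e (q :: nat \<Rightarrow> 'u). sat M e \<phi>)"
proof (induction \<phi>)
  case (Eq s t)
  then have "\<forall>t\<in>set [s, t]. representable t" by (auto simp: term_representable)
  then obtain F A where F: "\<And>i. pol (F i)" and A: "P_definable A"
    and ex: "\<And>e v. range e \<subseteq> carrier K \<Longrightarrow> v \<in> P \<Longrightarrow>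
       \<exists>r :: nat \<Rightarrow> 'u. range r \<subseteq> P \<and> r (prod_encode (0, 0)) = v \<and> A e r"
    and val: "\<And>e r i. range e \<subseteq> carrier K \<Longrightarrow> range r \<subseteq> P \<Longrightarrow> A e r \<Longrightarrow> i < length [s, t] \<Longrightarrow>
       tm_val M e ([s, t] ! i) = F i e r"
    by (rule representable_list) (rule that)
  have "P_definable (\<lambda>e (q :: nat \<Rightarrow> 'u). \<exists>r :: nat \<Rightarrow> 'u. range r \<subseteq> P \<and> (A e r \<and> F 0 e r = F 1 e r))"
    by (intro P_definable_ex P_definable_conj P_definable_reindex[OF A] P_definable_poly_eq polyf_sub[OF F] polyf_var)
  then show ?case
  proof (rule P_definable_cong)
    fix e :: "nat \<Rightarrow> 'u" assume e: "range e \<subseteq> carrier K"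
    have v: "tm_val M e s = F 0 e r \<and> tm_val M e t = F 1 e r" if "range r \<subseteq> P" "A e r" for r
      using val[OF e that, of 0] val[OF e that, of 1] by simp
    obtain r0 where r0: "range r0 \<subseteq> P" "A e r0" using ex[OF e P_zero] by blast
    show "(\<exists>r. range r \<subseteq> P \<and> (A e r \<and> F 0 e r = F 1 e r)) = sat M e (Eq s t)"
      unfolding sat.simps using v r0 by metis
  qed
next
  case (Rel R ts)
  then have "\<forall>t\<in>set ts. representable t" by (auto simp: term_representable list_all_iff)
  then obtain F A where F: "\<And>i. pol (F i)" and A: "P_definable A"
    and ex: "\<And>e v. range e \<subseteq> carrier K \<Longrightarrow> v \<in> P \<Longrightarrow>
       \<exists>r :: nat \<Rightarrow> 'u. range r \<subseteq> P \<and> r (prod_encode (0, 0)) = v \<and> A e r"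
    and val: "\<And>e r i. range e \<subseteq> carrier K \<Longrightarrow> range r \<subseteq> P \<Longrightarrow> A e r \<Longrightarrow> i < length ts \<Longrightarrow>
       tm_val M e (ts ! i) = F i e r"
    by (rule representable_list) (rule that)
  have tC: "tm_val M e (ts ! i) \<in> carrier K" if "range e \<subseteq> carrier K" "i < length ts" for e i
    using M_tm_closed[OF that(1)] Rel.prems that(2) by (auto simp: list_all_iff)
  define n where "n = length ts"
  \<comment> \<open>For \<open>Pred_P\<close> nothing remains to be said, because the quantified p
    already places the argument in P.\<close>
  define S where "S p \<longleftrightarrow> (case R of Pred_P \<Rightarrow> True | Old Q \<Rightarrow> rel_int PM Q (map p [0..<n]))"
    for p :: "nat \<Rightarrow> 'u"
  have "definable S"
  proof (cases R)
    case Pred_P then show ?thesis unfolding S_def by (simp add: definable_const)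
  next
    case (Old Q)
    then have "rel_ar L Q = Some n" using Rel.prems by (simp add: n_def)
    then show ?thesis using definable_rel Old unfolding S_def by simp
  qed
  have "P_definable (\<lambda>e (q :: nat \<Rightarrow> 'u). \<exists>r :: nat \<Rightarrow> 'u. range r \<subseteq> P \<and> (A e r \<and>
      (\<exists>p :: nat \<Rightarrow> 'u. range p \<subseteq> P \<and> ((\<forall>i\<in>{..<n}. F i e r = p i) \<and> S p))))"
    by (intro P_definable_ex P_definable_conj P_definable_reindex[OF A] P_definable_reindex[OF P_definable_definable[OF \<open>definable S\<close>]] P_definable_ball P_definable_poly_eq
        polyf_sub[OF F] polyf_var finite_lessThan)
  then show ?case
  proof (rule P_definable_cong)
    fix e :: "nat \<Rightarrow> 'u" assume e: "range e \<subseteq> carrier K"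
    let ?xs = "map (tm_val M e) ts"
    have xs: "set ?xs \<subseteq> carrier K" using tC[OF e] by (auto simp: in_set_conv_nth)
    have sat: "sat M e (Rel R ts) \<longleftrightarrow> set ?xs \<subseteq> P \<and> S (\<lambda>i. if i < n then ?xs ! i else \<zero>)"
    proof (cases R)
      case Pred_P
      then have "length ts = 1" using Rel.prems by simp
      then obtain t where "ts = [t]" by (auto simp: length_Suc_conv Suc_length_conv)
      then show ?thesis using Pred_P M_P xs by (simp add: S_def)
    next
      case (Old Q)
      have "map (\<lambda>i. if i < n then ?xs ! i else \<zero>) [0..<n] = ?xs"
        by (rule nth_equalityI) (auto simp: n_def)
      moreover have "rel_ar L Q = Some (length ?xs)" using Old Rel.prems by simp
      ultimately show ?thesis using Old M_rel[of Q ?xs] xs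
        by (simp only: sat.simps S_def plus_P.case)
    qed
    have v: "?xs ! i = F i e r" if "range r \<subseteq> P" "A e r" "i < n" for r i
      using val[OF e that(1,2)] that(3) by (simp add: n_def)
    show "(\<exists>r. range r \<subseteq> P \<and> (A e r \<and>
      (\<exists>p :: nat \<Rightarrow> 'u. range p \<subseteq> P \<and> ((\<forall>i\<in>{..<n}. F i e r = p i) \<and> S p)))) = sat M e (Rel R ts)"
      (is "?l = _")
    proof
      assume ?l
      then obtain r p where r: "range r \<subseteq> P" "A e r" "range p \<subseteq> P" "\<forall>i\<in>{..<n}. F i e r = p i" "S p"
        by blast
      have eq: "?xs ! i = p i" if "i < n" for i using v r that by simp
      have "set ?xs \<subseteq> P" using eq r(3) unfolding in_set_conv_nth subset_iff n_def by auto
      moreover have "map p [0..<n] = map (\<lambda>i. if i < n then ?xs ! i else \<zero>) [0..<n]"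
        using eq by auto
      then have "S (\<lambda>i. if i < n then ?xs ! i else \<zero>) = S p" unfolding S_def by (simp only:)
      ultimately show "sat M e (Rel R ts)" using sat r(5) by blast
    next
      assume "sat M e (Rel R ts)"
      then have *: "set ?xs \<subseteq> P" "S (\<lambda>i. if i < n then ?xs ! i else \<zero>)" using sat by blast+
      obtain r where r: "range r \<subseteq> P" "A e r" using ex[OF e P_zero] by blast
      have "?xs ! i \<in> P" if "i < n" for i using *(1) that by (auto simp: n_def)
      then have "range (\<lambda>i. if i < n then ?xs ! i else \<zero>) \<subseteq> P" by auto
      moreover have "\<forall>i\<in>{..<n}. F i e r = (if i < n then ?xs ! i else \<zero>)" using v[OF r] by simp
      ultimately show ?l using r *(2) by blast
    qed
  qed
next
  case (Neg \<phi>) then show ?case by (simp add: P_definable_neg)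
next
  case (Conj \<phi> \<psi>) then show ?case by (simp add: P_definable_conj)
next
  case (Ex x \<phi>)
  obtain N0 where dich: "\<And>N. N \<ge> N0 \<Longrightarrow> (\<forall>e. range e \<subseteq> carrier K \<longrightarrow> (\<exists>y\<in>carrier K. generic e N y)) \<or>
      (\<forall>e y. range e \<subseteq> carrier K \<and> y \<in> carrier K \<longrightarrow> \<not> generic e N y)"
    using dichotomy by blast
  have "is_formula (L_P L) \<phi>" using Ex.prems by simp
  from P_definable_exK[where k = x, OF dich Ex.IH[OF this]] show ?case unfolding sat.simps M_univ .
qed

end

section \<open>Transfer of the independence property to the subfield\<close>

text \<open>A Baire category argument in the Cantor space.\<close>

lemma countable_cover_dense:
  fixes f :: "nat set \<Rightarrow> nat"
  shows "\<exists>n l. \<forall>r S'. \<exists>S. f S = n \<and> (\<forall>i. l \<le> i \<and> i < r \<longrightarrow> (i \<in> S \<longleftrightarrow> i \<in> S'))"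
proof (rule ccontr)
  assume "\<not> ?thesis"
  then have "\<forall>n l. \<exists>r S'. \<forall>S. f S = n \<longrightarrow> \<not> (\<forall>i. l \<le> i \<and> i < r \<longrightarrow> (i \<in> S \<longleftrightarrow> i \<in> S'))" by simp
  then obtain r S' where "\<forall>n l S. f S = n \<longrightarrow>
      \<not> (\<forall>i. l \<le> i \<and> i < r n l \<longrightarrow> (i \<in> S \<longleftrightarrow> i \<in> S' n l))"
    unfolding choice_iff by (elim exE) (rule that)
  then have rS: "\<exists>i. l \<le> i \<and> i < r n l \<and> (i \<in> S \<longleftrightarrow> i \<notin> S' n l)" if "f S = n" for n l S
    using that by auto
  \<comment> \<open>Stage n extends the pattern \<open>T\<close> fixed below l by a block that no
    set of value n matches.\<close>
  define step where "step n lT = (case lT of (l, T) \<Rightarrow>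
    (max l (r n l), {i \<in> T. i < l} \<union> {i \<in> S' n l. l \<le> i}))" for n and lT :: "nat \<times> nat set"
  define s where "s = rec_nat (0, {}) step"
  have s_Suc: "s (Suc n) = step n (s n)" for n by (simp add: s_def)
  define l where "l n = fst (s n)" for n
  define T where "T n = snd (s n)" for n
  have l_Suc: "l (Suc n) = max (l n) (r n (l n))" for n
    by (simp add: l_def s_Suc step_def split: prod.split)
  have T_Suc: "T (Suc n) = {i \<in> T n. i < l n} \<union> {i \<in> S' n (l n). l n \<le> i}" for n
    by (simp add: l_def T_def s_Suc step_def split: prod.split)
  have mono: "l m \<le> l n \<and> (\<forall>i<l m. i \<in> T m \<longleftrightarrow> i \<in> T n)" if "m \<le> n" for m n
    using that
  proof (induction n rule: dec_induct)
    case (step n)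
    then show ?case using l_Suc[of n] T_Suc[of n] by auto
  qed simp
  define S where "S = {i. \<exists>n. i < l n \<and> i \<in> T n}"
  have S: "i \<in> S \<longleftrightarrow> i \<in> T n" if "i < l n" for i n
  proof
    assume "i \<in> S"
    then obtain m where m: "i < l m" "i \<in> T m" unfolding S_def by blast
    show "i \<in> T n"
    proof (cases "m \<le> n")
      case True
      show ?thesis using mono[OF True] m by simp
    next
      case False
      then have "n \<le> m" by simp
      show ?thesis using mono[OF \<open>n \<le> m\<close>] m that by simp
    qed
  qed (use that in \<open>auto simp: S_def\<close>)
  \<comment> \<open>The limit S has some value \<open>f S\<close>, and at that stage it was made
    different from every set of this value.\<close>
  obtain i where i: "l (f S) \<le> i" "i < r (f S) (l (f S))" "i \<in> S \<longleftrightarrow> i \<notin> S' (f S) (l (f S))"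
    using rS[OF refl, of "l (f S)" S] by blast
  have "i < l (Suc (f S))" using i l_Suc by simp
  then have "i \<in> S \<longleftrightarrow> i \<in> S' (f S) (l (f S))" using S T_Suc i(1) by auto
  then show False using i(3) by blast
qed

section \<open>Monomials in mixed tuples\<close>

context field_pair
begin

lemma mono_val_map: "mono_val e (map (map_sum id h) w) = mono_val (e \<circ> h) w"
proof (induction w)
  case (Cons l w)
  have "letter_val e (map_sum id h l) = letter_val (e \<circ> h) l"
    by (cases l) (simp_all add: letter_val_def)
  then show ?case using Cons by (simp only: list.map mono_val_Cons)
qed simp

text \<open>A monomial in a mixed tuple is a product of one in a and one in b. The parameters all go
  to the left factor, and vacated places receive the padding letter of value 1.\<close>

definition left_word :: "nat set \<Rightarrow> word \<Rightarrow> word" where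
  "left_word J w = map (case_sum Inl (\<lambda>k. if k \<in> J then Inl 0 else Inr k)) w"

definition right_word :: "nat set \<Rightarrow> word \<Rightarrow> word" where
  "right_word J w = map (case_sum (\<lambda>_. Inl 0) (\<lambda>k. if k \<in> J then Inr k else Inl 0)) w"

lemma mono_val_mix:
  assumes a: "range a \<subseteq> carrier K" and b: "range b \<subseteq> carrier K"
  shows "mono_val (mix J a b) w = mono_val a (left_word J w) \<otimes> mono_val b (right_word J w)"
proof (induction w)
  case (Cons l w)
  have c: "mono_val a (left_word J w) \<in> carrier K" "mono_val b (right_word J w) \<in> carrier K"
    using mono_val_closed[OF a] mono_val_closed[OF b] by blast+
  have l: "a k \<in> carrier K" "b k \<in> carrier K" for k using a b by auto
  show ?case
    using Cons c l by (cases l) (auto simp: left_word_def right_word_def letter_val_def mix_def m_ac)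
qed (simp add: left_word_def right_word_def)

lemma mono_val_mono_span:
  assumes e: "range e \<subseteq> carrier K"
  shows "\<exists>N. mono_val e w \<in> mono_span e N"
proof (induction w)
  case Nil
  show ?case using mono_span_P[OF e P_one] by auto
next
  case (Cons l w)
  then obtain N where "mono_val e w \<in> mono_span e N" by blast
  moreover obtain D where "letter_val e l \<in> mono_span e D"
  proof (cases l)
    case (Inl i) then show ?thesis using mono_span_letter[OF e, of l "Suc i"] that by (auto simp: letters_def)
  next
    case (Inr i) then show ?thesis using mono_span_letter[OF e, of l "Suc i"] that by (auto simp: letters_def)
  qed
  ultimately have "mono_val e (l # w) \<in> mono_span e (D + N)" using mono_span_mult[OF e] by simp
  then show ?case by blast
qed

end

section \<open>Trading the tuple b for coefficients in P\<close>

context pair_model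
begin

text \<open>The relations of the monomials in \<open>b\<close> over the ring generated by \<open>P\<close> and all the \<open>A j\<close> are
  given by a matrix over that ring; \<open>p\<close> collects the coefficients of its entries, so that \<open>b\<close> can
  be traded for the tuple \<open>p\<close> in \<open>P\<close>.\<close>

lemma relation_transfer:
  assumes a: "\<And>i. range (A i) \<subseteq> carrier K" and b: "range b \<subseteq> carrier K"
    and f: "\<And>j k. f (prod_encode (j, k)) = A j k"
  shows "\<exists>n p. range p \<subseteq> P \<and> (\<forall>i g. range g \<subseteq> P \<longrightarrow> (lin_comb (mix J (A i) b) N g = \<zero> \<longleftrightarrow>
    (\<forall>u\<in>words N. (\<Oplus>w\<in>words N. g w \<otimes> mono_val (A i) (left_word J w) \<otimes>
        lin_comb f n (\<lambda>x :: word. p ((w, u), x))) = \<zero>)))"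
proof -
  have "f m \<in> carrier K" for m using f[of "fst (prod_decode m)" "snd (prod_decode m)"] a by auto
  then have fC: "range f \<subseteq> carrier K" by auto
  \<comment> \<open>The ring generated by P, the parameters and all the tuples \<open>A j\<close>: a
    single ring that serves every instance i.\<close>
  define R where "R = {x. \<exists>n. x \<in> mono_span f n}"
  have R_common: "\<exists>n. x \<in> mono_span f n \<and> y \<in> mono_span f n" if "x \<in> R" "y \<in> R" for x y
  proof -
    obtain m n where "x \<in> mono_span f m" "y \<in> mono_span f n" using \<open>x \<in> R\<close> \<open>y \<in> R\<close> unfolding R_def by blast
    then have "x \<in> mono_span f (max m n) \<and> y \<in> mono_span f (max m n)"
      using mono_span_mono[OF fC, of x m "max m n"] mono_span_mono[OF fC, of y n "max m n"] by simp
    then show ?thesis by blast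
  qed
  have RP: "x \<in> R" if "x \<in> P" for x using mono_span_P[OF fC that] unfolding R_def by blast
  have RC: "R \<subseteq> carrier K" unfolding R_def using mono_span_carrier[OF fC] by blast
  have R_add: "x \<oplus> y \<in> R" if "x \<in> R" "y \<in> R" for x y
    using R_common[OF that] mono_span_add[OF fC] unfolding R_def by blast
  have R_mult: "x \<otimes> y \<in> R" if "x \<in> R" "y \<in> R" for x y
    using that mono_span_mult[OF fC] unfolding R_def by blast
  have R_neg: "\<ominus> x \<in> R" if "x \<in> R" for x
    using that mono_span_neg[OF fC] unfolding R_def by blast
  \<comment> \<open>The monomials in b are the vectors here; those in \<open>A i\<close> count as
    coefficients.\<close>
  have "\<exists>c. (\<forall>w u. c w u \<in> R) \<and> (\<forall>g. (\<forall>w. g w \<in> R) \<longrightarrow>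
    ((\<Oplus>w\<in>words N. g w \<otimes> mono_val b (right_word J w)) = \<zero> \<longleftrightarrow>
      (\<forall>u\<in>words N. (\<Oplus>w\<in>words N. g w \<otimes> c w u) = \<zero>)))"
    using RC RP R_add R_mult R_neg mono_val_closed[OF b] by (intro kernel_matrix) simp_all
  then obtain d where d: "\<And>w u. d w u \<in> R"
    and ker: "\<And>g. (\<And>w. g w \<in> R) \<Longrightarrow> (\<Oplus>w\<in>words N. g w \<otimes> mono_val b (right_word J w)) = \<zero> \<longleftrightarrow>
      (\<forall>u\<in>words N. (\<Oplus>w\<in>words N. g w \<otimes> d w u) = \<zero>)"
    by (elim exE conjE) (rule that, simp_all)
  \<comment> \<open>Only finitely many entries occur, so they share one level; this n is what the
    category argument will make constant.\<close>
  have "\<exists>n. \<forall>w\<in>words N. \<forall>u\<in>words N. d w u \<in> mono_span f n"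
  proof -
    obtain n where n: "\<And>w u. d w u \<in> mono_span f (n w u)" using d unfolding R_def by (auto, metis)
    define m where "m = Max ((\<lambda>(w, u). n w u) ` (words N \<times> words N))"
    have "d w u \<in> mono_span f m" if "w \<in> words N" "u \<in> words N" for w u
      by (rule mono_span_mono[OF fC n]) (use that in \<open>auto simp: m_def intro!: Max_ge\<close>)
    then show ?thesis by blast
  qed
  then obtain n where n: "\<And>w u. w \<in> words N \<Longrightarrow> u \<in> words N \<Longrightarrow> d w u \<in> mono_span f n" by blast
  have "\<forall>w u. \<exists>h. (\<forall>x. h x \<in> P) \<and> (w \<in> words N \<longrightarrow> u \<in> words N \<longrightarrow> d w u = lin_comb f n h)"
  proof (intro allI)
    fix w u show "\<exists>h. (\<forall>x. h x \<in> P) \<and> (w \<in> words N \<longrightarrow> u \<in> words N \<longrightarrow> d w u = lin_comb f n h)"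
    proof (cases "w \<in> words N \<and> u \<in> words N")
      case True
      then show ?thesis using n[of w u] unfolding mono_span_def by blast
    next
      case False
      then show ?thesis by (intro exI[of _ "\<lambda>_. \<zero>"]) auto
    qed
  qed
  then obtain h where h: "\<And>w u x. h w u x \<in> P"
    "\<And>w u. w \<in> words N \<Longrightarrow> u \<in> words N \<Longrightarrow> d w u = lin_comb f n (h w u)" by metis
  define p where "p = (\<lambda>((w, u), x). h w u x)"
  have "range p \<subseteq> P" using h(1) by (auto simp: p_def)
  moreover have "lin_comb (mix J (A i) b) N g = \<zero> \<longleftrightarrow>
    (\<forall>u\<in>words N. (\<Oplus>w\<in>words N. g w \<otimes> mono_val (A i) (left_word J w) \<otimes> lin_comb f n (\<lambda>x. p ((w, u), x))) = \<zero>)"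
    if g: "range g \<subseteq> P" for i g
  proof -
    let ?g = "\<lambda>w. g w \<otimes> mono_val (A i) (left_word J w)"
    have gP: "g w \<in> P" for w using g by auto
    have mC: "mono_val (A i) w \<in> carrier K" "mono_val b w \<in> carrier K" for w
      using mono_val_closed[OF a] mono_val_closed[OF b] by blast+
    have "mono_val (A i) w \<in> R" for w
    proof -
      \<comment> \<open>\<open>A i\<close> is a row of f, so its monomials are monomials in f with
        renumbered letters.\<close>
      have "A i = f \<circ> (\<lambda>k. prod_encode (i, k))" using f by auto
      then have "mono_val (A i) w = mono_val f (map (map_sum id (\<lambda>k. prod_encode (i, k))) w)"
        by (simp only: mono_val_map)
      then show ?thesis using mono_val_mono_span[OF fC] unfolding R_def by simp
    qed
    then have gR: "?g w \<in> R" for w using R_mult RP[OF gP] by blast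
    have "lin_comb (mix J (A i) b) N g = (\<Oplus>w\<in>words N. ?g w \<otimes> mono_val b (right_word J w))"
      unfolding lin_comb_def using gP mC
      by (intro finsum_cong') (auto simp: mono_val_mix[OF a b] m_assoc)
    then have "lin_comb (mix J (A i) b) N g = \<zero> \<longleftrightarrow> (\<forall>u\<in>words N. (\<Oplus>w\<in>words N. ?g w \<otimes> d w u) = \<zero>)"
      using ker[of ?g] gR by simp
    moreover have "(\<Oplus>w\<in>words N. ?g w \<otimes> d w u) = (\<Oplus>w\<in>words N. ?g w \<otimes> lin_comb f n (\<lambda>x. p ((w, u), x)))"
      if u: "u \<in> words N" for u
    proof (rule finsum_cong')
      have "lin_comb f n (\<lambda>x. p ((w, u), x)) \<in> carrier K" for w
        using h(1) by (intro lin_comb_closed[OF fC]) (auto simp: p_def)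
      then show "(\<lambda>w. ?g w \<otimes> lin_comb f n (\<lambda>x. p ((w, u), x))) \<in> words N \<rightarrow> carrier K"
        using gR RC by auto
      show "?g w \<otimes> d w u = ?g w \<otimes> lin_comb f n (\<lambda>x. p ((w, u), x))" if "w \<in> words N" for w
        using h(2)[OF that u] by (simp add: p_def)
    qed simp
    ultimately show ?thesis by simp
  qed
  ultimately show ?thesis by (intro exI[of _ n] exI[of _ p]) simp
qed

text \<open>The degree n shapes the formula and cannot be passed to it as a parameter. One formula
  thus sees only the patterns with the same n, which is why the category argument is needed and why
  finite patterns on a tail are what remains.\<close>

theorem shattered_reduct:
  assumes \<phi>: "is_formula (L_P L) \<phi>" and sh: "shattered M \<phi> J A"
  shows "\<exists>\<psi> J' A'. is_formula L \<psi> \<and> fin_shattered PM \<psi> J' A'"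
proof -
  have A: "range (A i) \<subseteq> carrier K" for i using sh M_univ unfolding shattered_def by simp
  obtain B where B: "\<And>S. range (B S) \<subseteq> carrier K"
    "\<And>S i. sat M (mix J (A i) (B S)) \<phi> \<longleftrightarrow> i \<in> S"
  proof -
    have "\<forall>S. \<exists>B. range B \<subseteq> univ M \<and> (\<forall>i. sat M (mix J (A i) B) \<phi> \<longleftrightarrow> i \<in> S)"
      using sh unfolding shattered_def by blast
    from choice[OF this] obtain B where "\<forall>S. range (B S) \<subseteq> univ M \<and>
      (\<forall>i. sat M (mix J (A i) (B S)) \<phi> \<longleftrightarrow> i \<in> S)" by (rule exE)
    then show ?thesis using that[of B] M_univ by simp
  qed
  obtain N1 \<chi> where \<chi>: "\<And>N. N \<ge> N1 \<Longrightarrow> definable (\<chi> N)"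
    "\<And>N e c (q :: nat \<Rightarrow> 'u). N \<ge> N1 \<Longrightarrow> range e \<subseteq> carrier K \<Longrightarrow> range c \<subseteq> P \<Longrightarrow> range q \<subseteq> P \<Longrightarrow>
      relation_matrix e N c \<Longrightarrow> sat M e \<phi> \<longleftrightarrow> \<chi> N (case_sum c q)" by (rule P_definableE[OF formula_P_definable[OF \<phi>]]) (rule that)
  define N where "N = N1"
  \<comment> \<open>The dummy family of the normal form is set to zero.\<close>
  define \<chi>' where "\<chi>' c = \<chi> N (case_sum c (\<lambda>_. \<zero>))" for c
  have "definable \<chi>'"
  proof -
    have "polyf {} (\<lambda>c. case x of Inl i \<Rightarrow> c i | Inr (_ :: nat) \<Rightarrow> \<zero>)" for x :: "(word \<times> word) + nat"
      by (cases x) simp_all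
    from definable_subst[where F = "\<lambda>x c. case x of Inl i \<Rightarrow> c i | Inr (_ :: nat) \<Rightarrow> \<zero>", OF \<chi>(1) this]
    have "definable (\<lambda>c. \<chi> N (\<lambda>x. case x of Inl i \<Rightarrow> c i | Inr (_ :: nat) \<Rightarrow> \<zero>))" by (simp add: N_def)
    then show ?thesis unfolding \<chi>'_def .
  qed
  have \<chi>': "sat M e \<phi> \<longleftrightarrow> \<chi>' c" if "range e \<subseteq> carrier K" "range c \<subseteq> P" "relation_matrix e N c" for e c
    using \<chi>(2)[of N e c "\<lambda>_. \<zero>"] that by (auto simp: \<chi>'_def N_def)
  define f where "f m = (case prod_decode m of (j, k) \<Rightarrow> A j k)" for m
  have f: "f (prod_encode (j, k)) = A j k" for j k by (simp add: f_def)
  \<comment> \<open>The formula must not mention i: \<open>A i\<close> is copied to row 0 and all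
    the tuples occupy the rows \<open>Suc j\<close>, so that the positions read through
    \<open>h0\<close> and \<open>h1\<close> are the same for every i.\<close>
  define e' where "e' i m = (case prod_decode m of (0, k) \<Rightarrow> A i k | (Suc j, k) \<Rightarrow> A j k)" for i m
  define h0 where "h0 k = prod_encode (0, k)" for k
  define h1 where "h1 m = (case prod_decode m of (j, k) \<Rightarrow> prod_encode (Suc j, k))" for m
  have h0: "(\<lambda>k. e' i (h0 k)) = A i" for i by (auto simp: e'_def h0_def)
  have h1: "(\<lambda>m. e' i (h1 m)) = f" for i by (auto simp: e'_def h1_def f_def split: prod.splits)
  have e'C: "range (e' i) \<subseteq> carrier K" for i
    using A by (fastforce simp: e'_def image_subset_iff split: prod.split nat.split)
  \<comment> \<open>\<open>c\<close> is a relation matrix of the mixed tuple, recognised from the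
    data p without mentioning b.\<close>
  define \<Psi> where "\<Psi> n e (p :: (word \<times> word) \<times> word \<Rightarrow> 'u) \<longleftrightarrow>
    (\<exists>c. range c \<subseteq> P \<and> (\<forall>g. range g \<subseteq> P \<longrightarrow>
      ((\<forall>u\<in>words N. (\<Oplus>w\<in>words N. g w \<otimes> mono_val (\<lambda>k. e (h0 k)) (left_word J w) \<otimes>
          lin_comb (\<lambda>k. e (h1 k)) n (\<lambda>x. p ((w, u), x))) = \<zero>) \<longleftrightarrow>
       (\<forall>u\<in>words N. (\<Oplus>w\<in>words N. g w \<otimes> c (w, u)) = \<zero>))) \<and> \<chi>' c)" for n e p
  have \<Psi>_P_definable: "P_definable (\<Psi> n)" for n
    unfolding \<Psi>_def
    by (intro P_definable_ex P_definable_conj P_definable_all P_definable_iff P_definable_ball P_definable_poly polyf_finsum polyf_mult polyf_var polyf_mono_val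
        polyf_lin_comb finite_words P_definable_reindex[OF P_definable_definable[OF \<open>definable \<chi>'\<close>]]) auto
  have "\<exists>n p. range p \<subseteq> P \<and> (\<forall>i. i \<in> S \<longleftrightarrow> \<Psi> n (e' i) p)" for S
  proof -
    obtain n p where p: "range p \<subseteq> P"
      "\<And>i g. range g \<subseteq> P \<Longrightarrow> lin_comb (mix J (A i) (B S)) N g = \<zero> \<longleftrightarrow>
        (\<forall>u\<in>words N. (\<Oplus>w\<in>words N. g w \<otimes> mono_val (A i) (left_word J w) \<otimes>
            lin_comb f n (\<lambda>x :: word. p ((w, u), x))) = \<zero>)"
      using relation_transfer[where A = A and b = "B S" and f = f and J = J and N = N, OF A B(1) f]
      by (elim exE conjE) (rule that, simp_all)
    have "i \<in> S \<longleftrightarrow> \<Psi> n (e' i) p" for i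
    proof -
      have mC: "range (mix J (A i) (B S)) \<subseteq> carrier K" using A B(1) by (rule mix_range)
      have "\<Psi> n (e' i) p \<longleftrightarrow> (\<exists>c. range c \<subseteq> P \<and> relation_matrix (mix J (A i) (B S)) N c \<and> \<chi>' c)"
        unfolding \<Psi>_def h0 h1 relation_matrix_def using p(2) by simp
      also have "\<dots> \<longleftrightarrow> sat M (mix J (A i) (B S)) \<phi>"
        using \<chi>'[OF mC] relation_matrix_exists[OF mC, of N] by blast
      finally show ?thesis using B(2) by simp
    qed
    then show ?thesis using p(1) by blast
  qed
  then obtain nS p where p: "\<And>S. range (p S) \<subseteq> P" "\<And>S i. i \<in> S \<longleftrightarrow> \<Psi> (nS S) (e' i) (p S)" by metis
  obtain n l where nl: "\<And>r S'. \<exists>S. nS S = n \<and> (\<forall>i. l \<le> i \<and> i < r \<longrightarrow> (i \<in> S \<longleftrightarrow> i \<in> S'))"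
    using countable_cover_dense[of nS] by blast
  \<comment> \<open>With n constant, \<open>\<Psi> n\<close> is a single condition and has a normal
    form at a level \<open>N2\<close> common to all i.\<close>
  obtain N2 \<chi>2 where \<chi>2: "\<And>N. N \<ge> N2 \<Longrightarrow> definable (\<chi>2 N)"
    "\<And>N e c q. N \<ge> N2 \<Longrightarrow> range e \<subseteq> carrier K \<Longrightarrow> range c \<subseteq> P \<Longrightarrow> range q \<subseteq> P \<Longrightarrow>
      relation_matrix e N c \<Longrightarrow> \<Psi> n e q \<longleftrightarrow> \<chi>2 N (case_sum c q)" by (rule P_definableE[OF \<Psi>_P_definable]) (rule that)
  obtain \<psi> \<iota> where \<psi>: "is_formula L \<psi>" "inj \<iota>"
    "\<And>E. range E \<subseteq> P \<Longrightarrow> \<chi>2 N2 (E \<circ> \<iota>) \<longleftrightarrow> sat PM E \<psi>"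
    using \<chi>2(1)[OF order_refl] unfolding definable_def by blast
  \<comment> \<open>The new x-tuple is a relation matrix of \<open>e' i\<close>; the positions of p
    hold zeros until \<open>B'\<close> overrides them.\<close>
  have "\<forall>i. \<exists>E c. range c \<subseteq> P \<and> relation_matrix (e' i) N2 c \<and> range E \<subseteq> P \<and> case_sum c (\<lambda>_. \<zero>) = E \<circ> \<iota>"
  proof
    fix i
    obtain c where c: "range c \<subseteq> P" "relation_matrix (e' i) N2 c" using relation_matrix_exists[OF e'C] by blast
    have "range (case_sum c (\<lambda>_ :: (word \<times> word) \<times> word. \<zero>)) \<subseteq> P"
      using c unfolding range_case_sum by auto
    from extend_inj[OF \<psi>(2) this] c
    show "\<exists>E c. range c \<subseteq> P \<and> relation_matrix (e' i) N2 c \<and> range E \<subseteq> P \<and> case_sum c (\<lambda>_. \<zero>) = E \<circ> \<iota>"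
      by blast
  qed
  then obtain A' c where A': "\<And>i. range (c i) \<subseteq> P" "\<And>i. relation_matrix (e' i) N2 (c i)" "\<And>i. range (A' i) \<subseteq> P"
    "\<And>i. case_sum (c i) (\<lambda>_. \<zero>) = A' i \<circ> \<iota>" by metis
  define J' where "J' = range (\<iota> \<circ> Inr)"
  have "\<exists>B'. range B' \<subseteq> univ PM \<and> (\<forall>i<r. sat PM (mix J' (A' (l + i)) B') \<psi> \<longleftrightarrow> i \<in> S)" for r S
  proof -
    \<comment> \<open>The pattern is moved up by l, since it can be prescribed only from l
      on.\<close>
    obtain S1 where S1: "nS S1 = n" "\<And>i. l \<le> i \<and> i < l + r \<Longrightarrow> i \<in> S1 \<longleftrightarrow> i \<in> (+) l ` S"
      using nl[of "l + r" "(+) l ` S"] by blast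
    have "range (case_sum (\<lambda>_ :: word \<times> word. \<zero>) (p S1)) \<subseteq> P"
      using p(1) unfolding range_case_sum by auto
    from extend_inj[OF \<psi>(2) this] obtain B' where
      B': "range B' \<subseteq> P" "case_sum (\<lambda>_. \<zero>) (p S1) = B' \<circ> \<iota>" by blast
    have "sat PM (mix J' (A' (l + i)) B') \<psi> \<longleftrightarrow> i \<in> S" if "i < r" for i
    proof -
      have "mix J' (A' (l + i)) B' \<circ> \<iota> = case_sum (c (l + i)) (p S1)"
      proof
        fix x show "(mix J' (A' (l + i)) B' \<circ> \<iota>) x = case_sum (c (l + i)) (p S1) x"
        proof (cases x)
          case (Inl y)
          have "\<iota> (Inl y) \<notin> J'" using \<psi>(2) by (auto simp: J'_def inj_eq)
          then show ?thesis using Inl fun_cong[OF A'(4), of "l + i" "Inl y"] by (simp add: mix_def)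
        next
          case (Inr y)
          have "\<iota> (Inr y) \<in> J'" by (auto simp: J'_def)
          then show ?thesis using Inr fun_cong[OF B'(2), of "Inr y"] by (simp add: mix_def)
        qed
      qed
      moreover have "range (mix J' (A' (l + i)) B') \<subseteq> P" using A'(3) B'(1) by (rule mix_range)
      ultimately have "sat PM (mix J' (A' (l + i)) B') \<psi> \<longleftrightarrow> \<chi>2 N2 (case_sum (c (l + i)) (p S1))"
        using \<psi>(3) by metis
      also have "\<dots> \<longleftrightarrow> \<Psi> n (e' (l + i)) (p S1)"
        using \<chi>2(2)[OF order_refl e'C A'(1) p(1) A'(2)] by simp
      also have "\<dots> \<longleftrightarrow> i \<in> S"
        using p(2)[of "l + i" S1] S1(1) S1(2)[of "l + i"] that by auto
      finally show ?thesis .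
    qed
    then show ?thesis using B'(1) PM_univ by blast
  qed
  then have "fin_shattered PM \<psi> J' (\<lambda>i. A' (l + i))"
    unfolding fin_shattered_def using A'(3) PM_univ by blast
  then show ?thesis using \<psi>(1) by blast
qed

end

text \<open>That r instances have a common realisation of a given pattern is one existential formula
  with parameters in M; true in the extension, it is true in M.\<close>

lemma has_IP_imp_fin_shattered:
  fixes \<phi> :: "('f, 'r) fm"
  assumes IP: "has_IP TYPE('u) L T m n \<phi>" and \<phi>: "is_formula L \<phi>" "free_vars \<phi> \<subseteq> {..<m + n}"
  shows "\<exists>(M :: ('f, 'r, 'u) struct) A. is_model L T M \<and> fin_shattered M \<phi> {m..} A"
proof -
  obtain M :: "('f, 'r, 'u) struct" and a :: "nat \<Rightarrow> 'u list" where M: "is_model L T M"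
    and a': "\<forall>i. length (a i) = m \<and> set (a i) \<subseteq> univ M"
    and con: "\<forall>S. consistent_over L M n ({(\<phi>, a i) | i. i \<in> S} \<union> {(Neg \<phi>, a i) | i. i \<notin> S})"
    using IP unfolding has_IP_def by (elim exE conjE) (rule that)
  note a = a'[rule_format]
  obtain x0 where x0: "x0 \<in> univ M" using M unfolding is_model_def is_structure_def by auto
  define A where "A i k = (if k < m then a i ! k else x0)" for i k
  have aM: "a i ! k \<in> univ M" if "k < m" for i k using a[of i] that nth_mem by blast
  then have A: "A i k \<in> univ M" for i k using x0 by (simp add: A_def)
  \<comment> \<open>Even numbers carry the parameters, separately for each i; odd numbers carry the
    variables of y, which all instances share.\<close>
  define \<rho> where "\<rho> i k = (if k < m then 2 * prod_encode (i, k) else Suc (2 * k))" for i k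
  have odd: "2 * x \<noteq> Suc (2 * y)" "Suc (2 * y) \<noteq> 2 * x" for x y :: nat by presburger+
  have \<rho>: "inj (\<rho> i)" for i
    by (rule injI) (auto simp: \<rho>_def odd split: if_splits)
  have "\<exists>B. range B \<subseteq> univ M \<and> (\<forall>i<r. sat M (mix {m..} (A i) B) \<phi> \<longleftrightarrow> i \<in> S)" for r S
  proof -
    obtain N :: "('f, 'r, 'u) struct" and h b where N: "elementary_embedding L M N h"
      and b: "length b = n" "set b \<subseteq> univ N"
      and sat: "\<forall>(\<phi>, a) \<in> {(\<phi>, a i) | i. i \<in> S} \<union> {(Neg \<phi>, a i) | i. i \<notin> S}.
         sat N (nth (map h a @ b)) \<phi>"
      using con[rule_format, of S] unfolding consistent_over_def by (elim exE conjE) (rule that)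
    have sat': "sat N (nth (map h (a i) @ b)) \<phi> \<longleftrightarrow> i \<in> S" for i
    proof (cases "i \<in> S")
      case True
      then have "(\<phi>, a i) \<in> {(\<phi>, a i) | i. i \<in> S} \<union> {(Neg \<phi>, a i) | i. i \<notin> S}" by blast
      with sat True show ?thesis by blast
    next
      case False
      then have "(Neg \<phi>, a i) \<in> {(\<phi>, a i) | i. i \<in> S} \<union> {(Neg \<phi>, a i) | i. i \<notin> S}" by blast
      with sat have "sat N (nth (map h (a i) @ b)) (Neg \<phi>)" by blast
      then show ?thesis using False by simp
    qed
    define xs where "xs = map (\<lambda>k. Suc (2 * k)) [m..<m + n]"
    define \<Phi> where "\<Phi> = Conjs (map (\<lambda>i. if i \<in> S then ren (\<rho> i) \<phi> else Neg (ren (\<rho> i) \<phi>)) [0..<r])"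
    have \<Phi>: "sat Q E \<Phi> \<longleftrightarrow> (\<forall>i<r. sat Q (E \<circ> \<rho> i) \<phi> \<longleftrightarrow> i \<in> S)" for Q :: "('f, 'r, 'u) struct" and E
    proof -
      have "sat Q E (if i \<in> S then ren (\<rho> i) \<phi> else Neg (ren (\<rho> i) \<phi>)) \<longleftrightarrow>
          (sat Q (E \<circ> \<rho> i) \<phi> \<longleftrightarrow> i \<in> S)" for i
        by (simp add: sat_ren[OF \<rho>])
      then show ?thesis
        unfolding \<Phi>_def sat_Conjs set_map set_upt ball_simps(9) by (simp only:) auto
    qed
    have fm: "is_formula L (foldr Ex xs \<Phi>)" using \<phi>(1) by (auto simp: \<Phi>_def)
    define E where "E k = (if even k then (case prod_decode (k div 2) of (i, l) \<Rightarrow> A i l) else x0)" for k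
    have E: "range E \<subseteq> univ M" using A x0 by (auto simp: E_def split: prod.split)
    have hE: "range (h \<circ> E) \<subseteq> univ N" using E N unfolding elementary_embedding_def by auto
    define E' where "E' k = (if k \<in> set xs then b ! (k div 2 - m) else (h \<circ> E) k)" for k
    have "range E' \<subseteq> univ N"
    proof -
      have "b ! (k div 2 - m) \<in> univ N" if "k \<in> set xs" for k
      proof -
        have "k div 2 - m < n" using that by (auto simp: xs_def)
        then show ?thesis using b nth_mem by blast
      qed
      then show ?thesis using hE by (auto simp: E'_def)
    qed
    moreover have "sat N E' \<Phi>"
      unfolding \<Phi>
    proof (intro allI impI)
      fix i assume "i < r"
      have "(E' \<circ> \<rho> i) k = (map h (a i) @ b) ! k" if "k \<in> free_vars \<phi>" for k
      proof (cases "k < m")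
        case True
        then have "\<rho> i k \<notin> set xs" by (auto simp: \<rho>_def xs_def odd)
        then show ?thesis using True a[of i]
          by (simp add: E'_def \<rho>_def E_def A_def nth_append)
      next
        case False
        then have "k < m + n" using that \<phi>(2) by auto
        then have "\<rho> i k \<in> set xs" using False by (auto simp: \<rho>_def xs_def)
        then show ?thesis using False a[of i] by (simp add: E'_def \<rho>_def nth_append)
      qed
      then have "sat N (E' \<circ> \<rho> i) \<phi> = sat N (nth (map h (a i) @ b)) \<phi>" by (rule sat_cong)
      then show "sat N (E' \<circ> \<rho> i) \<phi> \<longleftrightarrow> i \<in> S" using sat' by simp
    qed
    moreover have "\<forall>k. k \<notin> set xs \<longrightarrow> E' k = (h \<circ> E) k" by (simp add: E'_def)
    ultimately have "sat N (h \<circ> E) (foldr Ex xs \<Phi>)" unfolding sat_Exs[OF hE] by blast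
    then have "sat M E (foldr Ex xs \<Phi>)" using elementary_embeddingD[OF N fm E] by simp
    then obtain F where F: "range F \<subseteq> univ M" "\<And>k. k \<notin> set xs \<Longrightarrow> F k = E k" "sat M F \<Phi>"
      unfolding sat_Exs[OF E] by blast
    define B where "B k = F (Suc (2 * k))" for k
    have "mix {m..} (A i) B = F \<circ> \<rho> i" for i
    proof
      fix k show "mix {m..} (A i) B k = (F \<circ> \<rho> i) k"
      proof (cases "k < m")
        case True
        then have "\<rho> i k \<notin> set xs" by (auto simp: \<rho>_def xs_def odd)
        then show ?thesis using True F(2) by (simp add: mix_def \<rho>_def E_def)
      next
        case False then show ?thesis by (simp add: mix_def \<rho>_def B_def)
      qed
    qed
    then have "\<forall>i<r. sat M (mix {m..} (A i) B) \<phi> \<longleftrightarrow> i \<in> S" using F(3) unfolding \<Phi> by simp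
    moreover have "range B \<subseteq> univ M" using F(1) by (auto simp: B_def)
    ultimately show ?thesis by blast
  qed
  moreover have "range (A i) \<subseteq> univ M" for i using A by auto
  ultimately have "fin_shattered M \<phi> {m..} A" unfolding fin_shattered_def by simp
  then show ?thesis using M by blast
qed

lemma field_pair_change_params:
  assumes "field_pair K P \<kappa>0" "\<And>i. \<kappa> i \<in> carrier K" "\<kappa> 0 = \<one>\<^bsub>K\<^esub>"
  shows "field_pair K P \<kappa>"
proof -
  interpret A: field_pair K P \<kappa>0 by fact
  show ?thesis
    by unfold_locales (use assms(2,3) A.P_carrier A.root_exists in auto)
qed

text \<open>If finitely many elements \<open>e\<close> leave no generic element over them, they are made parameters;
  then there is no generic element over any tuple.\<close>

lemma generic_dichotomy:
  assumes "field_pair K P \<kappa>0"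
  shows "\<exists>\<kappa>. field_pair K P \<kappa> \<and> (\<exists>N0. \<forall>N\<ge>N0.
    (\<forall>e. range e \<subseteq> carrier K \<longrightarrow> (\<exists>y\<in>carrier K. field_pair.generic K P \<kappa> e N y)) \<or>
    (\<forall>e y. range e \<subseteq> carrier K \<and> y \<in> carrier K \<longrightarrow> \<not> field_pair.generic K P \<kappa> e N y))"
proof (cases "\<forall>e N. range e \<subseteq> carrier K \<longrightarrow> (\<exists>y\<in>carrier K. field_pair.generic K P \<kappa>0 e N y)")
  case True
  then show ?thesis using assms by (intro exI[of _ \<kappa>0]) simp
next
  case False
  then obtain e0 N0 where e0: "range e0 \<subseteq> carrier K"
    and ng: "\<And>y. y \<in> carrier K \<Longrightarrow> \<not> field_pair.generic K P \<kappa>0 e0 N0 y" by blast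
  interpret A: field_pair K P \<kappa>0 by fact
  \<comment> \<open>Odd indices keep the old parameters, positive even ones take the entries of
    \<open>e0\<close>, and index 0 remains 1.\<close>
  define \<kappa> where "\<kappa> i = (if i = 0 then \<one>\<^bsub>K\<^esub> else if even i then e0 (i div 2 - 1) else \<kappa>0 (i div 2))" for i
  have e0C: "e0 k \<in> carrier K" for k using e0 by auto
  have "field_pair K P \<kappa>"
    by (rule field_pair_change_params[OF assms]) (use e0C in \<open>auto simp: \<kappa>_def\<close>)
  then interpret B: field_pair K P \<kappa> .
  define g where "g = case_sum (\<lambda>i :: nat. Inl (Suc (2 * i)) :: nat + nat) (\<lambda>k :: nat. Inl (2 * Suc k))"
  \<comment> \<open>\<open>g\<close> sends letters of index up to \<open>N0\<close> to letters of
    index up to \<open>2 * N0 + 2\<close>.\<close>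
  define M where "M = 2 * N0 + 2"
  have mv: "A.mono_val e0 w = B.mono_val e (map g w)" for e w
  proof (induction w)
    case (Cons l w)
    have "A.letter_val e0 l = B.letter_val e (g l)"
      by (cases l) (simp_all add: A.letter_val_def B.letter_val_def g_def \<kappa>_def)
    then show ?case using Cons by simp
  qed simp
  have sub: "A.mono_span e0 N0 \<subseteq> B.mono_span e N" if e: "range e \<subseteq> carrier K" and N: "N \<ge> M" for e N
  proof
    fix x assume x: "x \<in> A.mono_span e0 N0"
    show "x \<in> B.mono_span e N"
    proof (rule A.mono_span_induct[OF e0 x])
      show "\<zero>\<^bsub>K\<^esub> \<in> B.mono_span e N" using B.mono_span_zero[OF e] .
      show "x \<oplus>\<^bsub>K\<^esub> y \<in> B.mono_span e N" if "x \<in> B.mono_span e N" "y \<in> B.mono_span e N" for x y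
        using B.mono_span_add[OF e that] .
      fix p w assume p: "p \<in> P" and w: "w \<in> words N0"
      have "map g w @ replicate (N - N0) (Inl 0) \<in> words N"
        using w N by (fastforce simp: words_def letters_def g_def M_def split: sum.splits)
      from B.mono_span_mono_val[OF e this p]
      show "p \<otimes>\<^bsub>K\<^esub> A.mono_val e0 w \<in> B.mono_span e N"
        unfolding mv[of w e] B.mono_val_append[OF e] B.mono_val_replicate[OF e]
        using B.mono_val_closed[OF e] by simp
    qed
  qed
  have "\<not> B.generic e N y" if e: "range e \<subseteq> carrier K" and y: "y \<in> carrier K" and N: "N \<ge> M" for e N y
  proof
    assume gen: "B.generic e N y"
    have "A.generic e0 N0 y"
      unfolding A.generic_def[OF e0]
    proof (intro allI impI)
      fix a j assume a: "(\<forall>j. a j \<in> A.mono_span e0 N0) \<and> A.ev (Suc N0) a y = \<zero>\<^bsub>K\<^esub>" and j: "j \<le> N0"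
      \<comment> \<open>The coefficients of index beyond \<open>N0\<close> are set to zero, so that
        the relation of length \<open>Suc N0\<close> is also one of length
        \<open>Suc N\<close>.\<close>
      define a' where "a' i = (if i \<le> N0 then a i else \<zero>\<^bsub>K\<^esub>)" for i
      have a'B: "a' i \<in> B.mono_span e N" for i
        using a sub[OF e N] B.mono_span_zero[OF e] by (auto simp: a'_def)
      have aC: "a i \<in> carrier K" for i using a A.mono_span_carrier[OF e0] by blast
      have a'C: "a' i \<in> carrier K" for i by (rule B.mono_span_carrier[OF e a'B])
      have "A.ev (Suc N) a' y = A.ev (Suc N0) a' y"
        using a'C y N by (intro A.ev_truncate) (auto simp: a'_def M_def)
      also have "\<dots> = A.ev (Suc N0) a y"
        using aC y by (intro A.ev_cong) (auto simp: a'_def)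
      finally have "A.ev (Suc N) a' y = \<zero>\<^bsub>K\<^esub>" using a by simp
      then have "a' j = \<zero>\<^bsub>K\<^esub>"
        using gen a'B j N unfolding B.generic_def[OF e] M_def by auto
      then show "a j = \<zero>\<^bsub>K\<^esub>" using j by (simp add: a'_def)
    qed
    then show False using ng y by blast
  qed
  then show ?thesis using B.field_pair_axioms by (intro exI[of _ \<kappa>]) blast
qed

section \<open>Models of \<open>ACF\<^sub>T\<close>\<close>

lemma is_formula_Alls [simp]: "is_formula L (Alls xs \<phi>) = is_formula L \<phi>"
  by (induction xs) auto

lemma is_formula_Imps [simp]: "is_formula L (Imps \<phi>s \<psi>) \<longleftrightarrow> (\<forall>\<phi>\<in>set \<phi>s. is_formula L \<phi>) \<and> is_formula L \<psi>"
  by (induction \<phi>s) auto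

lemma is_formula_relativise: "is_formula L \<phi> \<Longrightarrow> is_formula (L_P L) (relativise \<phi>)"
proof -
  have "is_term (L_P L) = is_term L" by (rule ext) simp
  then show "is_formula L \<phi> \<Longrightarrow> is_formula (L_P L) (relativise \<phi>)"
    by (induction \<phi>) auto
qed

text \<open>What transfers the axioms to the ultrapower: \<open>holds\<close> ranges over all
  assignments, so \<open>ultrapower_holds\<close> asks for formulas only.\<close>

lemma is_formula_ACF_T:
  fixes L :: "('f ring_sym, 'r) language"
  assumes L: "L_rings \<subseteq>\<^sub>L L" and T: "is_theory L T" and \<phi>: "\<phi> \<in> ACF_T L T"
  shows "is_formula (L_P L) \<phi>"
proof -
  note [simp] = fun_ar_ring_sym[OF L] list_all_iff
  have pow: "is_term (L_P L) (tpower (Var k) n)" for k n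
    by (induction n) auto
  have sum: "is_term (L_P L) (tsum ts) \<longleftrightarrow> (\<forall>t\<in>set ts. is_term (L_P L) t)" for ts
    by (induction ts) auto
  from \<phi> show ?thesis
    unfolding ACF_T_def ACF_def
  proof (elim UnE)
    assume "\<phi> \<in> Defs.field_axioms"
    then show ?thesis unfolding Defs.field_axioms_def Let_def by (elim insertE) simp_all
  next
    assume "\<phi> \<in> {root_axiom n | n. 1 \<le> n}"
    then show ?thesis using pow sum by (auto simp: root_axiom_def)
  next
    assume "\<phi> \<in> P_subfield_axioms"
    then show ?thesis unfolding P_subfield_axioms_def Let_def by (elim insertE) simp_all
  next
    assume "\<phi> \<in> relativise ` T"
    then show ?thesis using T is_formula_relativise unfolding is_theory_def is_sentence_def by blast
  next
    assume "\<phi> \<in> fun_axioms L"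
    then show ?thesis by (auto simp: fun_axioms_def)
  next
    assume "\<phi> \<in> rel_axioms L"
    then show ?thesis by (auto simp: rel_axioms_def)
  next
    assume "\<phi> \<in> range degree_axiom"
    then show ?thesis using sum by (auto simp: degree_axiom_def)
  qed
qed

section \<open>The field and the subfield given by a model\<close>

definition ring_of :: "('f ring_sym, 's, 'u) struct \<Rightarrow> 'u ring" where
  "ring_of M = \<lparr>carrier = univ M, monoid.mult = (\<lambda>x y. fun_int M Times [x, y]),
     one = fun_int M One [], zero = fun_int M Zero [], add = (\<lambda>x y. fun_int M Plus [x, y])\<rparr>"

definition P_part :: "('f ring_sym, 'r plus_P, 'u) struct \<Rightarrow> ('f ring_sym, 'r, 'u) struct" where
  "P_part M = \<lparr>univ = {x \<in> univ M. rel_int M Pred_P [x]}, fun_int = fun_int M,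
     rel_int = (\<lambda>r xs. rel_int M (Old r) xs)\<rparr>"

lemma tm_val_P_part: "tm_val (P_part M) e t = tm_val M e t"
proof (induction t)
  case (Fn f ts)
  then have "map (tm_val (P_part M) e) ts = map (tm_val M e) ts" by simp
  then show ?case by (simp add: P_part_def del: map_eq_conv)
qed simp

lemma sat_relativise:
  "range e \<subseteq> univ (P_part M) \<Longrightarrow> sat M e (relativise \<phi>) \<longleftrightarrow> sat (P_part M) e \<phi>"
proof (induction \<phi> arbitrary: e)
  case (Rel r ts)
  have "map (tm_val (P_part M) e) ts = map (tm_val M e) ts" by (simp add: tm_val_P_part)
  then show ?case by (simp add: P_part_def del: map_eq_conv)
next
  case (Ex x \<phi>)
  have "sat M (e(x := a)) (relativise \<phi>) \<longleftrightarrow> sat (P_part M) (e(x := a)) \<phi>" if "a \<in> univ (P_part M)" for a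
    using Ex.prems that by (intro Ex.IH) auto
  then have "(\<exists>a\<in>univ (P_part M). sat M (e(x := a)) (relativise \<phi>)) \<longleftrightarrow>
      (\<exists>a\<in>univ (P_part M). sat (P_part M) (e(x := a)) \<phi>)" by blast
  moreover have "sat M e (relativise (Ex x \<phi>)) \<longleftrightarrow>
      (\<exists>a\<in>univ (P_part M). sat M (e(x := a)) (relativise \<phi>))"
    by (auto simp: P_part_def)
  ultimately show ?case by simp
qed (simp_all add: tm_val_P_part)

locale ACF_T_model =
  fixes L :: "('f ring_sym, 'r) language" and T and M :: "('f ring_sym, 'r plus_P, 'u) struct"
  assumes L: "L_rings \<subseteq>\<^sub>L L" and M: "is_structure (L_P L) M"
    and ax: "\<phi> \<in> ACF_T L T \<Longrightarrow> holds M \<phi>"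
begin

abbreviation K :: "'u ring" where "K \<equiv> ring_of M"
abbreviation PM :: "('f ring_sym, 'r, 'u) struct" where "PM \<equiv> P_part M"
abbreviation P :: "'u set" where "P \<equiv> univ (P_part M)"

lemma ax_sat: "\<phi> \<in> ACF_T L T \<Longrightarrow> range e \<subseteq> univ M \<Longrightarrow> sat M e \<phi>"
  using ax unfolding holds_def by blast

lemma ring_closed:
  "fun_int M Zero [] \<in> univ M" "fun_int M One [] \<in> univ M"
  "x \<in> univ M \<Longrightarrow> y \<in> univ M \<Longrightarrow> fun_int M Plus [x, y] \<in> univ M"
  "x \<in> univ M \<Longrightarrow> y \<in> univ M \<Longrightarrow> fun_int M Times [x, y] \<in> univ M"
  "x \<in> univ M \<Longrightarrow> fun_int M Minus [x] \<in> univ M"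
  by (rule is_structure_fun[OF M]; simp add: fun_ar_ring_sym[OF L])+

lemma univ_ne: "\<exists>d. d \<in> univ M"
  using M unfolding is_structure_def by auto

lemma K_simps [simp]:
  "carrier K = univ M" "x \<otimes>\<^bsub>K\<^esub> y = fun_int M Times [x, y]" "\<one>\<^bsub>K\<^esub> = fun_int M One []"
  "\<zero>\<^bsub>K\<^esub> = fun_int M Zero []" "x \<oplus>\<^bsub>K\<^esub> y = fun_int M Plus [x, y]"
  by (simp_all add: ring_of_def)

lemma field_K: "field K"
proof -
  obtain d where d: "d \<in> univ M" using univ_ne by blast
  have f: "sat M (\<lambda>_. d) \<phi>" if "\<phi> \<in> Defs.field_axioms" for \<phi>
    by (rule ax_sat) (use that d in \<open>auto simp: ACF_T_def ACF_def\<close>)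
  let ?p = "\<lambda>x y. fun_int M Plus [x, y]" and ?t = "\<lambda>x y. fun_int M Times [x, y]"
    and ?o = "fun_int M Zero []" and ?e = "fun_int M One []" and ?m = "\<lambda>x. fun_int M Minus [x]"
  have 1: "\<forall>x\<in>univ M. \<forall>y\<in>univ M. \<forall>z\<in>univ M. ?p (?p x y) z = ?p x (?p y z)"
    using f[of "Alls [0, 1, 2] (Eq (tplus (tplus (Var 0) (Var 1)) (Var 2)) (tplus (Var 0) (tplus (Var 1) (Var 2))))"]
    by (simp add: Defs.field_axioms_def Let_def)
  have 2: "\<forall>x\<in>univ M. \<forall>y\<in>univ M. ?p x y = ?p y x"
    using f[of "Alls [0, 1] (Eq (tplus (Var 0) (Var 1)) (tplus (Var 1) (Var 0)))"]
    by (simp add: Defs.field_axioms_def Let_def)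
  have 3: "\<forall>x\<in>univ M. ?p x ?o = x"
    using f[of "Alls [0] (Eq (tplus (Var 0) tzero) (Var 0))"]
    by (simp add: Defs.field_axioms_def Let_def)
  have 4: "\<forall>x\<in>univ M. ?p x (?m x) = ?o"
    using f[of "Alls [0] (Eq (tplus (Var 0) (tminus (Var 0))) tzero)"]
    by (simp add: Defs.field_axioms_def Let_def)
  have 5: "\<forall>x\<in>univ M. \<forall>y\<in>univ M. \<forall>z\<in>univ M. ?t (?t x y) z = ?t x (?t y z)"
    using f[of "Alls [0, 1, 2] (Eq (ttimes (ttimes (Var 0) (Var 1)) (Var 2)) (ttimes (Var 0) (ttimes (Var 1) (Var 2))))"]
    by (simp add: Defs.field_axioms_def Let_def)
  have 6: "\<forall>x\<in>univ M. \<forall>y\<in>univ M. ?t x y = ?t y x"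
    using f[of "Alls [0, 1] (Eq (ttimes (Var 0) (Var 1)) (ttimes (Var 1) (Var 0)))"]
    by (simp add: Defs.field_axioms_def Let_def)
  have 7: "\<forall>x\<in>univ M. ?t x ?e = x"
    using f[of "Alls [0] (Eq (ttimes (Var 0) tone) (Var 0))"]
    by (simp add: Defs.field_axioms_def Let_def)
  have 8: "\<forall>x\<in>univ M. \<forall>y\<in>univ M. \<forall>z\<in>univ M. ?t x (?p y z) = ?p (?t x y) (?t x z)"
    using f[of "Alls [0, 1, 2] (Eq (ttimes (Var 0) (tplus (Var 1) (Var 2))) (tplus (ttimes (Var 0) (Var 1)) (ttimes (Var 0) (Var 2))))"]
    by (simp add: Defs.field_axioms_def Let_def)
  have 9: "?o \<noteq> ?e"
    using f[of "Neg (Eq tzero tone)"] by (simp add: Defs.field_axioms_def Let_def)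
  have 10: "\<forall>x\<in>univ M. x \<noteq> ?o \<longrightarrow> (\<exists>y\<in>univ M. ?t x y = ?e)"
    using f[of "Alls [0] (Imp (Neg (Eq (Var 0) tzero)) (Ex 1 (Eq (ttimes (Var 0) (Var 1)) tone)))"]
    by (simp add: Defs.field_axioms_def Let_def) blast
  have "cring K"
  proof (intro cringI abelian_groupI comm_monoidI)
    show "\<exists>y\<in>carrier K. y \<oplus>\<^bsub>K\<^esub> x = \<zero>\<^bsub>K\<^esub>" if "x \<in> carrier K" for x
      using that 2 4 ring_closed(5) by (intro bexI[of _ "?m x"]) auto
    show "\<zero>\<^bsub>K\<^esub> \<oplus>\<^bsub>K\<^esub> x = x" if "x \<in> carrier K" for x
      using that 2 3 ring_closed(1) by simp
    show "\<one>\<^bsub>K\<^esub> \<otimes>\<^bsub>K\<^esub> x = x" if "x \<in> carrier K" for x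
      using that 6 7 ring_closed(2) by simp
    show "(x \<oplus>\<^bsub>K\<^esub> y) \<otimes>\<^bsub>K\<^esub> z = x \<otimes>\<^bsub>K\<^esub> z \<oplus>\<^bsub>K\<^esub> y \<otimes>\<^bsub>K\<^esub> z"
      if "x \<in> carrier K" "y \<in> carrier K" "z \<in> carrier K" for x y z
      using that 6 8 ring_closed(3) by simp
    show "x \<oplus>\<^bsub>K\<^esub> y = y \<oplus>\<^bsub>K\<^esub> x" if "x \<in> carrier K" "y \<in> carrier K" for x y
      using that 2 by simp
    show "x \<otimes>\<^bsub>K\<^esub> y = y \<otimes>\<^bsub>K\<^esub> x" if "x \<in> carrier K" "y \<in> carrier K" for x y
      using that 6 by simp
  qed (use 1 5 ring_closed in simp_all)
  then show ?thesis by (rule cring.cring_fieldI2) (use 9 10 in simp_all)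
qed

sublocale K: field K by (rule field_K)

text \<open>The ring record has no negation, so the symbol \<open>Minus\<close> has to be identified
  with the additive inverse.\<close>

lemma K_minus:
  assumes "x \<in> univ M" shows "fun_int M Minus [x] = \<ominus>\<^bsub>K\<^esub> x"
proof -
  obtain d where d: "d \<in> univ M" using univ_ne by blast
  have "sat M (\<lambda>_. d) (Alls [0] (Eq (tplus (Var 0) (tminus (Var 0))) tzero))"
    by (rule ax_sat) (use d in \<open>auto simp: ACF_T_def ACF_def Defs.field_axioms_def Let_def\<close>)
  then have "x \<oplus>\<^bsub>K\<^esub> fun_int M Minus [x] = \<zero>\<^bsub>K\<^esub>" using assms by simp
  moreover have "x \<oplus>\<^bsub>K\<^esub> fun_int M Minus [x] = fun_int M Minus [x] \<oplus>\<^bsub>K\<^esub> x"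
    using assms ring_closed(5) by (intro K.a_comm) simp_all
  ultimately have "fun_int M Minus [x] \<oplus>\<^bsub>K\<^esub> x = \<zero>\<^bsub>K\<^esub>" by metis
  then show ?thesis using K.minus_equality[of "fun_int M Minus [x]" x] assms ring_closed(5) by simp
qed

lemma K_root:
  assumes n: "1 \<le> n" and c: "\<And>i. c i \<in> carrier K"
  shows "\<exists>y\<in>carrier K. K.ev n c y \<oplus>\<^bsub>K\<^esub> y [^]\<^bsub>K\<^esub> n = \<zero>\<^bsub>K\<^esub>"
proof -
  have cr: "range c \<subseteq> univ M" using c by auto
  \<comment> \<open>\<open>c\<close> itself is the assignment: variable i below n carries the
    coefficient \<open>c i\<close>, and variable n is left for the root.\<close>
  have "sat M c (root_axiom n)"
    by (rule ax_sat[OF _ cr]) (use n in \<open>auto simp: ACF_T_def ACF_def\<close>)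
  then have "sat M c (Ex n (Eq (tplus (tsum (map (\<lambda>i. ttimes (Var i) (tpower (Var n) i)) [0..<n]))
      (tpower (Var n) n)) tzero))"
    unfolding root_axiom_def sat_Alls[OF cr] using cr by blast
  then obtain y where y: "y \<in> univ M"
    and e: "tm_val M (c(n := y)) (tplus (tsum (map (\<lambda>i. ttimes (Var i) (tpower (Var n) i)) [0..<n]))
      (tpower (Var n) n)) = fun_int M Zero []" by auto
  have yK: "y \<in> carrier K" using y by simp
  define E where "E = c(n := y)"
  have E: "E n = y" "i \<noteq> n \<Longrightarrow> E i = c i" for i by (simp_all add: E_def)
  have pow: "tm_val M E (tpower (Var n) i) = y [^]\<^bsub>K\<^esub> i" for i
  proof (induction i)
    case (Suc i)
    have "tm_val M E (tpower (Var n) (Suc i)) = y \<otimes>\<^bsub>K\<^esub> y [^]\<^bsub>K\<^esub> i" using Suc E by simp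
    also have "\<dots> = y [^]\<^bsub>K\<^esub> i \<otimes>\<^bsub>K\<^esub> y" using yK by (intro K.m_comm K.nat_pow_closed)
    also have "\<dots> = y [^]\<^bsub>K\<^esub> Suc i" by (rule K.nat_pow_Suc[symmetric])
    finally show ?case .
  qed simp
  have sum: "tm_val M E (tsum (map f xs)) = (\<Oplus>\<^bsub>K\<^esub>i\<in>set xs. tm_val M E (f i))"
    if "distinct xs" "\<And>i. i \<in> set xs \<Longrightarrow> tm_val M E (f i) \<in> carrier K" for f :: "nat \<Rightarrow> 'f ring_sym tm" and xs
    using that
  proof (induction xs)
    case (Cons x xs)
    have "(\<Oplus>\<^bsub>K\<^esub>i\<in>insert x (set xs). tm_val M E (f i)) =
        tm_val M E (f x) \<oplus>\<^bsub>K\<^esub> (\<Oplus>\<^bsub>K\<^esub>i\<in>set xs. tm_val M E (f i))"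
      using Cons.prems by (intro K.finsum_insert) auto
    then show ?case using Cons by simp
  qed simp
  have "tm_val M E (ttimes (Var i) (tpower (Var n) i)) = c i \<otimes>\<^bsub>K\<^esub> y [^]\<^bsub>K\<^esub> i" if "i < n" for i
    using pow[of i] that E by simp
  moreover have "c i \<otimes>\<^bsub>K\<^esub> y [^]\<^bsub>K\<^esub> i \<in> carrier K" for i
    using c yK by (intro K.m_closed K.nat_pow_closed)
  ultimately have "tm_val M E (tsum (map (\<lambda>i. ttimes (Var i) (tpower (Var n) i)) [0..<n])) =
      (\<Oplus>\<^bsub>K\<^esub>i\<in>{..<n}. c i \<otimes>\<^bsub>K\<^esub> y [^]\<^bsub>K\<^esub> i)"
    by (subst sum) (auto simp del: K_simps tm_val.simps simp: atLeast0LessThan intro!: K.finsum_cong')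
  then have "K.ev n c y \<oplus>\<^bsub>K\<^esub> y [^]\<^bsub>K\<^esub> n = \<zero>\<^bsub>K\<^esub>"
    using e[folded E_def] pow[of n] by (simp add: K.ev_def)
  then show ?thesis using yK by blast
qed

lemma P_iff: "x \<in> P \<longleftrightarrow> x \<in> univ M \<and> rel_int M Pred_P [x]"
  by (simp add: P_part_def)

lemma P_closed:
  "fun_int M Zero [] \<in> P" "fun_int M One [] \<in> P"
  "x \<in> P \<Longrightarrow> y \<in> P \<Longrightarrow> fun_int M Plus [x, y] \<in> P"
  "x \<in> P \<Longrightarrow> y \<in> P \<Longrightarrow> fun_int M Times [x, y] \<in> P"
  "x \<in> P \<Longrightarrow> fun_int M Minus [x] \<in> P"
proof -
  obtain d where d: "d \<in> univ M" using univ_ne by blast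
  have f: "sat M (\<lambda>_. d) \<phi>" if "\<phi> \<in> P_subfield_axioms" for \<phi>
    by (rule ax_sat) (use that d in \<open>auto simp: ACF_T_def\<close>)
  show "fun_int M Zero [] \<in> P" "fun_int M One [] \<in> P"
    using f[of "inP tzero"] f[of "inP tone"] ring_closed
    by (simp_all add: P_subfield_axioms_def Let_def P_iff)
  show "x \<in> P \<Longrightarrow> y \<in> P \<Longrightarrow> fun_int M Plus [x, y] \<in> P"
    using f[of "Alls [0, 1] (Imps [inP (Var 0), inP (Var 1)] (inP (tplus (Var 0) (Var 1))))"] ring_closed(3)
    by (simp add: P_subfield_axioms_def Let_def P_iff)
  show "x \<in> P \<Longrightarrow> y \<in> P \<Longrightarrow> fun_int M Times [x, y] \<in> P"
    using f[of "Alls [0, 1] (Imps [inP (Var 0), inP (Var 1)] (inP (ttimes (Var 0) (Var 1))))"] ring_closed(4)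
    by (simp add: P_subfield_axioms_def Let_def P_iff)
  show "x \<in> P \<Longrightarrow> fun_int M Minus [x] \<in> P"
    using f[of "Alls [0] (Imp (inP (Var 0)) (inP (tminus (Var 0))))"] ring_closed(5)
    by (simp add: P_subfield_axioms_def Let_def P_iff)
qed

lemma list_env:
  assumes "set xs \<subseteq> univ M" "length xs = n"
  shows "\<exists>E. range E \<subseteq> univ M \<and> map E [0..<n] = xs \<and> (\<forall>i<n. E i = xs ! i)"
proof -
  obtain d where d: "d \<in> univ M" using univ_ne by blast
  define E where "E k = (if k < n then xs ! k else d)" for k
  have "range E \<subseteq> univ M" using assms d by (auto simp: E_def)
  moreover have "map E [0..<n] = xs" using assms by (intro nth_equalityI) (auto simp: E_def)
  ultimately show ?thesis by (intro exI[of _ E]) (auto simp: E_def)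
qed

lemma Other_fun:
  assumes f: "fun_ar L (Other f) = Some n" and xs: "set xs \<subseteq> univ M" "length xs = n"
  shows "set xs \<subseteq> P \<Longrightarrow> fun_int M (Other f) xs \<in> P"
    and "\<not> set xs \<subseteq> P \<Longrightarrow> fun_int M (Other f) xs = fun_int M Zero []"
proof -
  obtain E where E: "range E \<subseteq> univ M" "map E [0..<n] = xs" "\<And>i. i < n \<Longrightarrow> E i = xs ! i"
    using list_env[OF xs] by blast
  have nr: "Other f \<notin> dom (fun_ar (L_rings :: ('f ring_sym, 'r) language))" by (simp add: L_rings_def)
  have v: "tm_val M E (Fn (Other f) (map Var [0..<n])) = fun_int M (Other f) xs"
    using E(2) by (simp add: o_def)
  let ?t = "Fn (Other f) (map Var [0..<n])"
  show "fun_int M (Other f) xs \<in> P" if P: "set xs \<subseteq> P"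
  proof -
    have "Alls [0..<n] (Imps (map (inP \<circ> Var) [0..<n]) (inP ?t)) \<in> ACF_T L T"
      using f nr unfolding ACF_T_def fun_axioms_def by blast
    from ax_sat[OF this E(1)]
    have "sat M E (Imps (map (inP \<circ> Var) [0..<n]) (inP ?t))"
      unfolding sat_Alls[OF E(1)] using E(1) by blast
    moreover have "sat M E (inP (Var i))" if "i < n" for i
    proof -
      have "xs ! i \<in> P" using P that xs(2) nth_mem by blast
      then show ?thesis using E(3)[OF that] by (simp add: P_iff)
    qed
    ultimately have "rel_int M Pred_P [tm_val M E ?t]" unfolding sat_Imps by simp
    moreover have "fun_int M (Other f) xs \<in> univ M"
      by (rule is_structure_fun[OF M]) (use f xs in simp_all)
    ultimately show ?thesis unfolding v by (simp add: P_iff)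
  qed
  show "fun_int M (Other f) xs = fun_int M Zero []" if P: "\<not> set xs \<subseteq> P"
  proof -
    obtain x where x: "x \<in> set xs" "x \<notin> P" using P by blast
    then obtain i where i: "i < n" "xs ! i \<notin> P" using xs(2) unfolding in_set_conv_nth by blast
    have "Alls [0..<n] (Imp (Neg (inP (Var i))) (Eq ?t tzero)) \<in> ACF_T L T"
      using f nr i unfolding ACF_T_def fun_axioms_def by blast
    from ax_sat[OF this E(1)]
    have "sat M E (Imp (Neg (inP (Var i))) (Eq ?t tzero))"
      unfolding sat_Alls[OF E(1)] using E(1) by blast
    moreover have "\<not> rel_int M Pred_P [E i]"
      using i xs E(3)[OF i(1)] nth_mem by (fastforce simp: P_iff)
    ultimately show ?thesis using v by simp
  qed
qed

lemma Old_rel: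
  assumes R: "rel_ar L R = Some n" and xs: "set xs \<subseteq> univ M" "length xs = n"
    and r: "rel_int M (Old R) xs"
  shows "set xs \<subseteq> P"
proof (rule ccontr)
  assume P: "\<not> set xs \<subseteq> P"
  obtain E where E: "range E \<subseteq> univ M" "map E [0..<n] = xs" "\<And>i. i < n \<Longrightarrow> E i = xs ! i"
    using list_env[OF xs] by blast
  obtain x where x: "x \<in> set xs" "x \<notin> P" using P by blast
  then obtain i where i: "i < n" "xs ! i \<notin> P" using xs(2) unfolding in_set_conv_nth by blast
  have "Alls [0..<n] (Imp (Neg (inP (Var i))) (Neg (Rel (Old R) (map Var [0..<n])))) \<in> ACF_T L T"
    using R i unfolding ACF_T_def rel_axioms_def by blast
  from ax_sat[OF this E(1)]
  have "sat M E (Imp (Neg (inP (Var i))) (Neg (Rel (Old R) (map Var [0..<n]))))"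
    unfolding sat_Alls[OF E(1)] using E(1) by blast
  moreover have "\<not> rel_int M Pred_P [E i]"
    using i xs E(3)[OF i(1)] nth_mem by (fastforce simp: P_iff)
  ultimately show False using r E(2) by (simp add: o_def)
qed

lemma PM_structure: "is_structure L PM"
  unfolding is_structure_def
proof (intro conjI allI impI)
  show "P \<noteq> {}" using P_closed(1) by blast
  fix f n xs assume f: "fun_ar L f = Some n" and xs: "length xs = n \<and> set xs \<subseteq> P"
  have i: "fun_int PM = fun_int M" by (simp add: P_part_def)
  have xM: "set xs \<subseteq> univ M" using xs by (auto simp: P_iff)
  show "fun_int PM f xs \<in> P"
  proof (cases f)
    case (Other g)
    then show ?thesis using Other_fun(1)[of g n xs] f xs xM unfolding i by simp
  next
    case Plus
    then obtain x y where "xs = [x, y]" using f xs fun_ar_ring_sym[OF L]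
      by (auto simp: numeral_2_eq_2 length_Suc_conv)
    then show ?thesis using Plus P_closed xs unfolding i by simp
  next
    case Times
    then obtain x y where "xs = [x, y]" using f xs fun_ar_ring_sym[OF L]
      by (auto simp: numeral_2_eq_2 length_Suc_conv)
    then show ?thesis using Times P_closed xs unfolding i by simp
  next
    case Minus
    then obtain x where "xs = [x]" using f xs fun_ar_ring_sym[OF L] by (auto simp: length_Suc_conv)
    then show ?thesis using Minus P_closed xs unfolding i by simp
  qed (use f xs fun_ar_ring_sym[OF L] P_closed in \<open>auto simp: i\<close>)
qed

lemma PM_model: "is_model L T PM"
proof -
  have "holds PM \<phi>" if "\<phi> \<in> T" for \<phi>
    unfolding holds_def
  proof (intro allI impI)
    fix e :: "nat \<Rightarrow> 'u" assume e: "range e \<subseteq> P"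
    then have "range e \<subseteq> univ M" by (auto simp: P_iff)
    moreover have "relativise \<phi> \<in> ACF_T L T" using that by (auto simp: ACF_T_def)
    ultimately have "sat M e (relativise \<phi>)" using ax_sat by blast
    then show "sat PM e \<phi>" using sat_relativise[OF e] by blast
  qed
  then show ?thesis using PM_structure unfolding is_model_def by blast
qed

text \<open>Starting from trivial parameters, \<open>generic_dichotomy\<close> supplies those for
  which, from some level on, the existence of a generic element is independent of e.\<close>

lemma pair_model_exists: "\<exists>\<kappa>. pair_model K P \<kappa> L PM M"
proof -
  have fp: "field_pair K P (\<lambda>_. \<one>\<^bsub>K\<^esub>)"
  proof unfold_locales
    show "\<ominus>\<^bsub>K\<^esub> x \<in> P" if "x \<in> P" for x
      using that P_closed(5) K_minus by (auto simp: P_iff)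
    show "\<exists>y\<in>carrier K. K.ev n c y \<oplus>\<^bsub>K\<^esub> y [^]\<^bsub>K\<^esub> n = \<zero>\<^bsub>K\<^esub>"
      if "1 \<le> n" "\<And>i. c i \<in> carrier K" for n c by (rule K_root[OF that])
  qed (use P_closed ring_closed in \<open>auto simp: P_iff\<close>)
  obtain \<kappa> where \<kappa>: "field_pair K P \<kappa>" "\<exists>N0. \<forall>N\<ge>N0.
    (\<forall>e. range e \<subseteq> carrier K \<longrightarrow> (\<exists>y\<in>carrier K. field_pair.generic K P \<kappa> e N y)) \<or>
    (\<forall>e y. range e \<subseteq> carrier K \<and> y \<in> carrier K \<longrightarrow> \<not> field_pair.generic K P \<kappa> e N y)"
    using generic_dichotomy[OF fp] by blast
  interpret F: field_pair K P \<kappa> by (rule \<kappa>(1))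
  have i: "fun_int PM = fun_int M" "rel_int PM R = rel_int M (Old R)" for R
    by (simp_all add: P_part_def fun_eq_iff)
  have "pair_model K P \<kappa> L PM M"
  proof unfold_locales
    show "is_structure L PM" by (rule PM_structure)
    show "fun_int M (Other f) xs = (if set xs \<subseteq> P then fun_int PM (Other f) xs else \<zero>\<^bsub>K\<^esub>)"
      if "fun_ar L (Other f) = Some (length xs)" "set xs \<subseteq> carrier K" for f xs
      using Other_fun(2)[of f "length xs" xs] that by (simp add: i)
    show "rel_int M (Old R) xs \<longleftrightarrow> set xs \<subseteq> P \<and> rel_int PM R xs"
      if "rel_ar L R = Some (length xs)" "set xs \<subseteq> carrier K" for R xs
      using Old_rel[of R "length xs" xs] that by (auto simp: i)
  qed (use L M \<kappa>(2) K_minus in \<open>auto simp: i P_iff\<close>)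
  then show ?thesis by blast
qed

end

theorem theorem5p34:
  fixes L :: "('f ring_sym, 'r) language"
    and T :: "('f ring_sym, 'r) fm set"
  assumes "theory_of_fields L T"
    and "complete_theory TYPE(('f ring_sym, 'r) fm) L T"
    and "NIP TYPE(('f ring_sym, 'r) fm) L T"
  shows "NIP TYPE('u) (L_P L) (ACF_T L T)"
  unfolding NIP_def
proof (intro allI impI notI)
  fix \<phi> :: "('f ring_sym, 'r plus_P) fm" and m n
  assume \<phi>: "is_formula (L_P L) \<phi> \<and> free_vars \<phi> \<subseteq> {..<m + n}"
    and IP: "has_IP TYPE('u) (L_P L) (ACF_T L T) m n \<phi>"
  have L: "L_rings \<subseteq>\<^sub>L L" and T: "is_theory L T"
    using assms(1) unfolding theory_of_fields_def by blast+
  obtain M0 :: "('f ring_sym, 'r plus_P, 'u) struct" and A where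
    M0: "is_model (L_P L) (ACF_T L T) M0" "fin_shattered M0 \<phi> {m..} A"
    using has_IP_imp_fin_shattered[OF IP] \<phi> by blast
  have M0s: "is_structure (L_P L) M0" using M0(1) unfolding is_model_def by blast
  \<comment> \<open>The category argument needs one tuple for each infinite pattern in a single
    model, hence the ultrapower.\<close>
  obtain M :: "('f ring_sym, 'r plus_P, nat \<Rightarrow> 'u) struct" and h where M_ext: "is_structure (L_P L) M"
    "\<And>\<psi>. is_formula (L_P L) \<psi> \<Longrightarrow> holds M0 \<psi> \<Longrightarrow> holds M \<psi>"
    "shattered M \<phi> {m..} (\<lambda>i k. h (A i k))"
    by (rule shattered_elementary_extension[OF M0s _ M0(2)]) (use \<phi> in auto)
  interpret ACF_T_model L T M
  proof
    show "holds M \<psi>" if "\<psi> \<in> ACF_T L T" for \<psi>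
      using M_ext(2)[OF is_formula_ACF_T[OF L T that]] M0(1) that unfolding is_model_def by blast
  qed (rule L, rule M_ext(1))
  obtain \<kappa> where "pair_model K P \<kappa> L PM M" using pair_model_exists by blast
  then interpret Q: pair_model K P \<kappa> L PM M .
  obtain \<psi> J' A' where \<psi>: "is_formula L \<psi>" "fin_shattered PM \<psi> J' A'"
    using Q.shattered_reduct[OF _ M_ext(3)] \<phi> by blast
  \<comment> \<open>P has inherited finite patterns only; a second ultrapower completes them, and
    \<open>shattered_imp_not_NIP\<close> returns from its element type to that of formulas.\<close>
  obtain N :: "('f ring_sym, 'r, nat \<Rightarrow> nat \<Rightarrow> 'u) struct" and h' where N: "is_structure L N"
    "elementary_embedding L PM N h'" "shattered N \<psi> J' (\<lambda>i k. h' (A' i k))"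
    by (rule shattered_elementary_extension[OF PM_structure \<psi>])
  have "is_model L T N"
    using elementary_embedding_model_iff[OF N(2) PM_structure N(1) T] PM_model by blast
  from shattered_imp_not_NIP[OF this T \<psi>(1) N(3)] show False using assms(3) by blast
qed

end
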